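(* Let $k$ be a field and $S$ an inverse semigroup. Let $e$ be an idempotent of $\mathcal{L}(S)$ of finite index and let $N$ be a simple $kG_e$-module. Then $\mathrm{Ind}_e(N)$ is a simple $kS$-module. Moreover, $\mathrm{Ind}_e(N)$ is finite dimensional over $k$ if and only if $N$ is.
   Context: $kS$ is the semigroup algebra. Modules are left modules; for a ring $A$ (not necessarily unital), $A$-modules $M$ are assumed unitary ($AM=M$), and a simple $A$-module is an $A$-module $M$ with $AM\ne 0$ and no non-zero proper submodules. For $A\subseteq S$, $A^{\uparrow}=\{s\in S: a\le s\text{ for some }a\in A\}$ (natural partial order); $A$ is closed if $A=A^{\uparrow}$, and directed if it is non-empty and any $a,b\in A$ have a lower bound $c\le a,b$ in $A$. $\mathcal{L}(S)$ is the inverse semigroup of all closed directed subsets of $S$ with product $A\otimes B=(AB)^{\uparrow}$ and inverse $A^{-1}=\{a^{-1}:a\in A\}$. The map $\iota:S\to\mathcal{L}(S)$, $s\mapsto s^{\uparrow}$, is an embedding. Let $e$ be an idempotent of $\mathcal{L}(S)$. It has finite index if the $\mathcal{D}$-class of $e$ in $\mathcal{L}(S)$ contains only finitely many idempotents. $G_e$ is the maximal subgroup (the $\mathcal{H}$-class) of $\mathcal{L}(S)$ at $e$. $L_e=\{A\in\mathcal{L}(S):A^{-1}\otimes A=e\}$ is the $\mathcal{L}$-class of $e$. The vector space $kL_e$ with basis $L_e$ is a right $kG_e$-module via right multiplication in $\mathcal{L}(S)$, and a left $k\mathcal{L}(S)$-module via the left Schützenberger action: $B\in\mathcal{L}(S)$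 sends a basis element $A\in L_e$ to $B\otimes A$ if $B\otimes A\in L_e$ and to $0$ otherwise. For a $kG_e$-module $N$, $\mathrm{Ind}_e(N)=kL_e\otimes_{kG_e}N$, regarded as a $kS$-module via $\iota$. *)

theory Defs
  imports "HOL-Algebra.Module" "HOL-Algebra.Generated_Groups" "HOL-Algebra.Free_Abelian_Groups"
begin

text \<open>
  Semigroups, non-unital rings and modules are carried by the records of HOL-Algebra. The fields
  that make no sense for a structure (\<open>one\<close> for semigroups and non-unital rings, \<open>mult\<close> and \<open>one\<close>
  for modules) are never used; they are \<open>undefined\<close> in the structures constructed below.
\<close>

section \<open>Inverse semigroups and Green's relations\<close>

locale inverse_semigroup =
  fixes S (structure)
  assumes closed: "\<lbrakk>x \<in> carrier S; y \<in> carrier S\<rbrakk> \<Longrightarrow> x \<otimes> y \<in> carrier S"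
    and assoc: "\<lbrakk>x \<in> carrier S; y \<in> carrier S; z \<in> carrier S\<rbrakk> \<Longrightarrow> (x \<otimes> y) \<otimes> z = x \<otimes> (y \<otimes> z)"
    and ex1_inverse:
      "x \<in> carrier S \<Longrightarrow> \<exists>!y. y \<in> carrier S \<and> x \<otimes> y \<otimes> x = x \<and> y \<otimes> x \<otimes> y = y"

definition sinv :: "('a, 'z) monoid_scheme \<Rightarrow> 'a \<Rightarrow> 'a" where
  "sinv S x = (THE y. y \<in> carrier S \<and> x \<otimes>\<^bsub>S\<^esub> y \<otimes>\<^bsub>S\<^esub> x = x \<and> y \<otimes>\<^bsub>S\<^esub> x \<otimes>\<^bsub>S\<^esub> y = y)"

definition idems :: "('a, 'z) monoid_scheme \<Rightarrow> 'a set" where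
  "idems S = {e \<in> carrier S. e \<otimes>\<^bsub>S\<^esub> e = e}"

text \<open>The principal one-sided ideals \<open>S\<^sup>1 a\<close> and \<open>a S\<^sup>1\<close>.\<close>

definition left_ideal1 :: "('a, 'z) monoid_scheme \<Rightarrow> 'a \<Rightarrow> 'a set" where
  "left_ideal1 S a = insert a {t \<otimes>\<^bsub>S\<^esub> a | t. t \<in> carrier S}"

definition right_ideal1 :: "('a, 'z) monoid_scheme \<Rightarrow> 'a \<Rightarrow> 'a set" where
  "right_ideal1 S a = insert a {a \<otimes>\<^bsub>S\<^esub> t | t. t \<in> carrier S}"

definition greenL :: "('a, 'z) monoid_scheme \<Rightarrow> 'a \<Rightarrow> 'a \<Rightarrow> bool" where
  "greenL S a b \<longleftrightarrow> a \<in> carrier S \<and> b \<in> carrier S \<and> left_ideal1 S a = left_ideal1 S b"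

definition greenR :: "('a, 'z) monoid_scheme \<Rightarrow> 'a \<Rightarrow> 'a \<Rightarrow> bool" where
  "greenR S a b \<longleftrightarrow> a \<in> carrier S \<and> b \<in> carrier S \<and> right_ideal1 S a = right_ideal1 S b"

definition greenH :: "('a, 'z) monoid_scheme \<Rightarrow> 'a \<Rightarrow> 'a \<Rightarrow> bool" where
  "greenH S a b \<longleftrightarrow> greenL S a b \<and> greenR S a b"

definition greenD :: "('a, 'z) monoid_scheme \<Rightarrow> 'a \<Rightarrow> 'a \<Rightarrow> bool" where
  "greenD S a b \<longleftrightarrow> (\<exists>c. greenL S a c \<and> greenR S c b)"

section \<open>The inverse semigroup of closed directed subsets\<close>

text \<open>The natural partial order: \<open>s \<le> t\<close> iff \<open>s = f t\<close> for some idempotent \<open>f\<close>.\<close>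

definition nat_le :: "('a, 'z) monoid_scheme \<Rightarrow> 'a \<Rightarrow> 'a \<Rightarrow> bool" where
  "nat_le S s t \<longleftrightarrow> s \<in> carrier S \<and> t \<in> carrier S \<and> (\<exists>f \<in> idems S. s = f \<otimes>\<^bsub>S\<^esub> t)"

definition up :: "('a, 'z) monoid_scheme \<Rightarrow> 'a set \<Rightarrow> 'a set" where
  "up S A = {s \<in> carrier S. \<exists>a \<in> A. nat_le S a s}"

definition up_closed :: "('a, 'z) monoid_scheme \<Rightarrow> 'a set \<Rightarrow> bool" where
  "up_closed S A \<longleftrightarrow> A \<subseteq> carrier S \<and> A = up S A"

definition directed :: "('a, 'z) monoid_scheme \<Rightarrow> 'a set \<Rightarrow> bool" where
  "directed S A \<longleftrightarrow> A \<noteq> {} \<and> (\<forall>a \<in> A. \<forall>b \<in> A. \<exists>c \<in> A. nat_le S c a \<and> nat_le S c b)"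

definition LS :: "('a, 'z) monoid_scheme \<Rightarrow> 'a set monoid" where
  "LS S = \<lparr>carrier = {A. up_closed S A \<and> directed S A},
           monoid.mult = (\<lambda>A B. up S (A <#>\<^bsub>S\<^esub> B)),
           monoid.one = undefined\<rparr>"

definition set_sinv :: "('a, 'z) monoid_scheme \<Rightarrow> 'a set \<Rightarrow> 'a set" where
  "set_sinv S A = sinv S ` A"

definition iota :: "('a, 'z) monoid_scheme \<Rightarrow> 'a \<Rightarrow> 'a set" where
  "iota S s = up S {s}"

definition finite_index :: "('a, 'z) monoid_scheme \<Rightarrow> 'a set \<Rightarrow> bool" where
  "finite_index S e \<longleftrightarrow> finite {f \<in> idems (LS S). greenD (LS S) e f}"

definition max_subgroup :: "('a, 'z) monoid_scheme \<Rightarrow> 'a set \<Rightarrow> 'a set monoid" where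
  "max_subgroup S e = \<lparr>carrier = {A. greenH (LS S) e A}, monoid.mult = monoid.mult (LS S), monoid.one = e\<rparr>"

definition L_class :: "('a, 'z) monoid_scheme \<Rightarrow> 'a set \<Rightarrow> 'a set set" where
  "L_class S e = {A \<in> carrier (LS S). set_sinv S A \<otimes>\<^bsub>LS S\<^esub> A = e}"

section \<open>Semigroup algebras\<close>

text \<open>
  The vector space with basis a set \<open>X\<close> consists of the finitely supported functions
  with support in \<open>X\<close>; the basis vector of \<open>x\<close> is \<open>Poly_Mapping.single x 1\<close>.
\<close>

definition pm_scale :: "'k::field \<Rightarrow> ('a \<Rightarrow>\<^sub>0 'k) \<Rightarrow> ('a \<Rightarrow>\<^sub>0 'k)" where
  "pm_scale c f = Poly_Mapping.map ((*) c) f"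

definition bilinear_ext ::
  "('a \<Rightarrow> 'b \<Rightarrow> ('c \<Rightarrow>\<^sub>0 'k)) \<Rightarrow> ('a \<Rightarrow>\<^sub>0 'k::field) \<Rightarrow> ('b \<Rightarrow>\<^sub>0 'k) \<Rightarrow> ('c \<Rightarrow>\<^sub>0 'k)" where
  "bilinear_ext p f g =
    (\<Sum>a \<in> Poly_Mapping.keys f. \<Sum>b \<in> Poly_Mapping.keys g.
       pm_scale (Poly_Mapping.lookup f a * Poly_Mapping.lookup g b) (p a b))"

definition linear_ext :: "('a \<Rightarrow> 'b) \<Rightarrow> ('a \<Rightarrow>\<^sub>0 'k::field) \<Rightarrow> ('b \<Rightarrow>\<^sub>0 'k)" where
  "linear_ext h f = (\<Sum>a \<in> Poly_Mapping.keys f. Poly_Mapping.single (h a) (Poly_Mapping.lookup f a))"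

definition semigroup_algebra :: "('a, 'z) monoid_scheme \<Rightarrow> ('a \<Rightarrow>\<^sub>0 'k::field) ring" where
  "semigroup_algebra T =
    \<lparr>carrier = {f. Poly_Mapping.keys f \<subseteq> carrier T},
     monoid.mult = bilinear_ext (\<lambda>s t. Poly_Mapping.single (s \<otimes>\<^bsub>T\<^esub> t) 1),
     monoid.one = undefined, ring.zero = 0, ring.add = (+)\<rparr>"

section \<open>Modules over non-unital rings\<close>

locale nonunital_ring = abelian_group R for R (structure) +
  assumes m_closed: "\<lbrakk>a \<in> carrier R; b \<in> carrier R\<rbrakk> \<Longrightarrow> a \<otimes> b \<in> carrier R"
    and m_assoc: "\<lbrakk>a \<in> carrier R; b \<in> carrier R; c \<in> carrier R\<rbrakk> \<Longrightarrow> (a \<otimes> b) \<otimes> c = a \<otimes> (b \<otimes> c)"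
    and l_distr: "\<lbrakk>a \<in> carrier R; b \<in> carrier R; c \<in> carrier R\<rbrakk> \<Longrightarrow> (a \<oplus> b) \<otimes> c = a \<otimes> c \<oplus> b \<otimes> c"
    and r_distr: "\<lbrakk>a \<in> carrier R; b \<in> carrier R; c \<in> carrier R\<rbrakk> \<Longrightarrow> c \<otimes> (a \<oplus> b) = c \<otimes> a \<oplus> c \<otimes> b"

text \<open>
  Unitary left modules. The subgroup generated by the products \<open>a \<odot> x\<close> is \<open>R M\<close>, so the last
  axiom says \<open>R M = M\<close>.
\<close>

locale unitary_left_module = R?: nonunital_ring R + M?: abelian_group M
  for R :: "('r, 'y) ring_scheme" (structure) and M :: "('r, 'm, 'z) module_scheme" (structure) +
  assumes smult_closed: "\<lbrakk>a \<in> carrier R; x \<in> carrier M\<rbrakk> \<Longrightarrow> a \<odot>\<^bsub>M\<^esub> x \<in> carrier M"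
    and smult_l_distr: "\<lbrakk>a \<in> carrier R; b \<in> carrier R; x \<in> carrier M\<rbrakk> \<Longrightarrow>
      (a \<oplus>\<^bsub>R\<^esub> b) \<odot>\<^bsub>M\<^esub> x = a \<odot>\<^bsub>M\<^esub> x \<oplus>\<^bsub>M\<^esub> b \<odot>\<^bsub>M\<^esub> x"
    and smult_r_distr: "\<lbrakk>a \<in> carrier R; x \<in> carrier M; y \<in> carrier M\<rbrakk> \<Longrightarrow>
      a \<odot>\<^bsub>M\<^esub> (x \<oplus>\<^bsub>M\<^esub> y) = a \<odot>\<^bsub>M\<^esub> x \<oplus>\<^bsub>M\<^esub> a \<odot>\<^bsub>M\<^esub> y"
    and smult_assoc: "\<lbrakk>a \<in> carrier R; b \<in> carrier R; x \<in> carrier M\<rbrakk> \<Longrightarrow>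
      (a \<otimes>\<^bsub>R\<^esub> b) \<odot>\<^bsub>M\<^esub> x = a \<odot>\<^bsub>M\<^esub> (b \<odot>\<^bsub>M\<^esub> x)"
    and unitary: "carrier M =
      generate (add_monoid M) {a \<odot>\<^bsub>M\<^esub> x | a x. a \<in> carrier R \<and> x \<in> carrier M}"

definition simple_module ::
  "('r, 'y) ring_scheme \<Rightarrow> ('r, 'm, 'z) module_scheme \<Rightarrow> bool" where
  "simple_module R M \<longleftrightarrow> unitary_left_module R M
     \<and> (\<exists>a \<in> carrier R. \<exists>x \<in> carrier M. a \<odot>\<^bsub>M\<^esub> x \<noteq> \<zero>\<^bsub>M\<^esub>)
     \<and> (\<forall>H. submodule H R M \<longrightarrow> H = {\<zero>\<^bsub>M\<^esub>} \<or> H = carrier M)"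

text \<open>
  Finite dimensionality of the abelian group \<open>M\<close> over the field \<open>'k\<close> acting by \<open>scal\<close>:
  existence of a finite spanning set.
\<close>

definition finite_dimensional ::
  "('k::field \<Rightarrow> 'm \<Rightarrow> 'm) \<Rightarrow> ('r, 'm, 'z) module_scheme \<Rightarrow> bool" where
  "finite_dimensional scal M \<longleftrightarrow>
    (\<exists>B. finite B \<and> B \<subseteq> carrier M \<and>
      (\<forall>x \<in> carrier M. \<exists>c :: 'm \<Rightarrow> 'k. x = (\<Oplus>\<^bsub>M\<^esub>b \<in> B. scal (c b) b)))"

section \<open>Tensor products over a non-commutative ring\<close>

text \<open>
  \<open>X\<close> is a right \<open>R\<close>-module, stored in a module record whose \<open>smult a x\<close> means \<open>x a\<close>.
  The tensor product is the free abelian group on pairs modulo the usual relations.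
\<close>

definition tensor_free ::
  "('r, 'x, 'w) module_scheme \<Rightarrow> ('r, 'm, 'z) module_scheme \<Rightarrow> ('x \<times> 'm \<Rightarrow>\<^sub>0 int) monoid" where
  "tensor_free X N = free_Abelian_group (carrier X \<times> carrier N)"

definition tensor_rels ::
  "('r, 'x, 'w) module_scheme \<Rightarrow> ('r, 'y) ring_scheme \<Rightarrow> ('r, 'm, 'z) module_scheme
    \<Rightarrow> ('x \<times> 'm \<Rightarrow>\<^sub>0 int) set" where
  "tensor_rels X R N =
     {frag_of (x \<oplus>\<^bsub>X\<^esub> y, n) - frag_of (x, n) - frag_of (y, n) | x y n.
        x \<in> carrier X \<and> y \<in> carrier X \<and> n \<in> carrier N}
   \<union> {frag_of (x, n \<oplus>\<^bsub>N\<^esub> m) - frag_of (x, n) - frag_of (x, m) | x n m.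
        x \<in> carrier X \<and> n \<in> carrier N \<and> m \<in> carrier N}
   \<union> {frag_of (a \<odot>\<^bsub>X\<^esub> x, n) - frag_of (x, a \<odot>\<^bsub>N\<^esub> n) | x a n.
        x \<in> carrier X \<and> a \<in> carrier R \<and> n \<in> carrier N}"

definition tensor_ker ::
  "('r, 'x, 'w) module_scheme \<Rightarrow> ('r, 'y) ring_scheme \<Rightarrow> ('r, 'm, 'z) module_scheme
    \<Rightarrow> ('x \<times> 'm \<Rightarrow>\<^sub>0 int) set" where
  "tensor_ker X R N = generate (tensor_free X N) (tensor_rels X R N)"

definition tensor_group ::
  "('r, 'x, 'w) module_scheme \<Rightarrow> ('r, 'y) ring_scheme \<Rightarrow> ('r, 'm, 'z) module_scheme
    \<Rightarrow> ('x \<times> 'm \<Rightarrow>\<^sub>0 int) set monoid" where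
  "tensor_group X R N = tensor_free X N Mod tensor_ker X R N"

text \<open>
  The map \<open>x \<otimes> n \<mapsto> \<phi> x \<otimes> n\<close> on cosets, for an endomorphism \<open>\<phi>\<close> of the right module \<open>X\<close>.
\<close>

definition tensor_map ::
  "('r, 'x, 'w) module_scheme \<Rightarrow> ('r, 'y) ring_scheme \<Rightarrow> ('r, 'm, 'z) module_scheme
    \<Rightarrow> ('x \<Rightarrow> 'x) \<Rightarrow> ('x \<times> 'm \<Rightarrow>\<^sub>0 int) set \<Rightarrow> ('x \<times> 'm \<Rightarrow>\<^sub>0 int) set" where
  "tensor_map X R N \<phi> C =
     tensor_ker X R N <#>\<^bsub>tensor_free X N\<^esub> (frag_extend (\<lambda>(x, n). frag_of (\<phi> x, n)) ` C)"

section \<open>The induced modules\<close>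

text \<open>The right \<open>kG\<^sub>e\<close>-module \<open>kL\<^sub>e\<close>; \<open>smult a x\<close> means \<open>x a\<close>.\<close>

definition kL :: "('a, 'z) monoid_scheme \<Rightarrow> 'a set \<Rightarrow> ('a set \<Rightarrow>\<^sub>0 'k::field, 'a set \<Rightarrow>\<^sub>0 'k) module" where
  "kL S e =
    \<lparr>carrier = {f. Poly_Mapping.keys f \<subseteq> L_class S e},
     monoid.mult = undefined, monoid.one = undefined, ring.zero = 0, ring.add = (+),
     smult = (\<lambda>a x. bilinear_ext (\<lambda>A g. Poly_Mapping.single (A \<otimes>\<^bsub>LS S\<^esub> g) 1) x a)\<rparr>"

definition schutz ::
  "('a, 'z) monoid_scheme \<Rightarrow> 'a set \<Rightarrow> ('a set \<Rightarrow>\<^sub>0 'k::field) \<Rightarrow> ('a set \<Rightarrow>\<^sub>0 'k) \<Rightarrow> ('a set \<Rightarrow>\<^sub>0 'k)" where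
  "schutz S e = bilinear_ext (\<lambda>B A.
     if B \<otimes>\<^bsub>LS S\<^esub> A \<in> L_class S e then Poly_Mapping.single (B \<otimes>\<^bsub>LS S\<^esub> A) 1 else 0)"

definition Ind ::
  "('a, 'z) monoid_scheme \<Rightarrow> 'a set \<Rightarrow> ('a set \<Rightarrow>\<^sub>0 'k::field, 'n) module
    \<Rightarrow> ('a \<Rightarrow>\<^sub>0 'k, (('a set \<Rightarrow>\<^sub>0 'k) \<times> 'n \<Rightarrow>\<^sub>0 int) set) module" where
  "Ind S e N = (let G = semigroup_algebra (max_subgroup S e); T = tensor_group (kL S e) G N in
    \<lparr>carrier = carrier T, monoid.mult = undefined, monoid.one = undefined, ring.zero = monoid.one T, ring.add = monoid.mult T,
     smult = (\<lambda>a. tensor_map (kL S e) G N (schutz S e (linear_ext (iota S) a)))\<rparr>)"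

text \<open>
  The \<open>k\<close>-vector space structures: \<open>c n = (c \<cdot> 1) n\<close> on a unitary \<open>kG\<^sub>e\<close>-module, where \<open>1\<close> is the
  basis vector of the identity \<open>e\<close> of \<open>G\<^sub>e\<close>, and \<open>c (x \<otimes> n) = (c x) \<otimes> n\<close> on the induced module.
  Modules are ring modules without separate scalar multiplication; any \<open>k\<close>-structure on a unitary
  \<open>kG\<^sub>e\<close>-module compatible with that of \<open>kG\<^sub>e\<close> is the one given here.
\<close>

definition group_module_scale ::
  "'a set \<Rightarrow> ('a set \<Rightarrow>\<^sub>0 'k::field, 'n) module \<Rightarrow> 'k \<Rightarrow> 'n \<Rightarrow> 'n" where
  "group_module_scale e N c n = Poly_Mapping.single e c \<odot>\<^bsub>N\<^esub> n"

definition Ind_scale ::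
  "('a, 'z) monoid_scheme \<Rightarrow> 'a set \<Rightarrow> ('a set \<Rightarrow>\<^sub>0 'k::field, 'n) module
    \<Rightarrow> 'k \<Rightarrow> (('a set \<Rightarrow>\<^sub>0 'k) \<times> 'n \<Rightarrow>\<^sub>0 int) set \<Rightarrow> (('a set \<Rightarrow>\<^sub>0 'k) \<times> 'n \<Rightarrow>\<^sub>0 int) set" where
  "Ind_scale S e N c =
    tensor_map (kL S e) (semigroup_algebra (max_subgroup S e)) N (pm_scale c)"

end

theory Submission
  imports Defs
begin

text \<open>
  Write \<open>L\<close> for the L-class of \<open>e\<close>, \<open>G\<close> for the maximal subgroup at \<open>e\<close>, and \<open>V\<close> for the induced
  module \<open>kL \<otimes> N\<close>. The group \<open>G\<close> acts on \<open>L\<close> on the right, and two elements of \<open>L\<close> lie in the same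
  orbit iff they have the same range idempotent \<open>A \<otimes> A\<inverse>\<close> (\<open>H_related_in_orbit\<close>). Hence, as an abelian
  group, \<open>V\<close> is a sum of copies \<open>A \<otimes> N\<close> of \<open>N\<close>, one for each of the idempotents in question. These are
  idempotents of the D-class of \<open>e\<close>, so finite index makes their number finite.

  If \<open>L(S)\<close> itself were acting, simplicity would be the classical argument for Schuetzenberger
  representations. Two facts show that the smaller semigroup \<open>S\<close> acts richly enough.

  First, \<open>S\<close> is transitive on \<open>L\<close>: if \<open>a \<in> A\<close> and \<open>b \<in> B\<close> then the element \<open>b a\<inverse>\<close> of \<open>S\<close> moves \<open>A\<close> to
  \<open>B\<close> (\<open>iota_transport\<close>). So a submodule containing one non-zero \<open>A \<otimes> n\<close> meets \<open>A \<otimes> N\<close> in a non-zero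
  submodule of the simple module \<open>N\<close> (\<open>fibre_submodule\<close>), contains all of \<open>A \<otimes> N\<close>, and by
  transitivity all of \<open>V\<close>.

  Second, \<open>S\<close> separates the summands. An idempotent \<open>p\<close> of \<open>S\<close> fixes \<open>A \<otimes> n\<close> if
  \<open>p\<close> belongs to the set \<open>A \<otimes> A\<inverse>\<close> and kills it otherwise (\<open>smult_idem_pt\<close>). There are
  only finitely many range idempotents, and this forces them to be pairwise incomparable
  (\<open>finite_D_class_idems_incomparable\<close>); the natural order on \<open>L(S)\<close> is reverse inclusion, so for each
  of them there is a \<open>p\<close> that belongs to it and to none of the others (\<open>separating_idem\<close>). This \<open>p\<close>
  acts as the projection to the corresponding summand. A non-zero submodule therefore does
  contain a non-zero \<open>A \<otimes> n\<close>.

  That \<open>V\<close> is not zero, and that finite-dimensionality passes from \<open>V\<close> back to \<open>N\<close>, is read off from a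
  map \<open>V \<rightarrow> N\<close> that sends \<open>e \<otimes> n\<close> to \<open>n\<close> (\<open>evaluation_map\<close>). The converse direction is the
  decomposition into finitely many copies of \<open>N\<close>.
\<close>
section \<open>Inverse semigroups\<close>

context inverse_semigroup
begin

declare closed [simp]

lemma sinv_props:
  assumes "x \<in> carrier S"
  shows sinv_closed [simp]: "sinv S x \<in> carrier S"
    and mult_sinv_mult: "x \<otimes> sinv S x \<otimes> x = x"
    and sinv_mult_sinv: "sinv S x \<otimes> x \<otimes> sinv S x = sinv S x"
  using theI'[OF ex1_inverse[OF assms]] unfolding sinv_def by auto

lemma sinv_unique:
  assumes "x \<in> carrier S" "y \<in> carrier S" "x \<otimes> y \<otimes> x = x" "y \<otimes> x \<otimes> y = y"
  shows "sinv S x = y"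
  unfolding sinv_def by (rule the1_equality[OF ex1_inverse[OF assms(1)]]) (simp add: assms)

lemma cancel_simps:
  assumes "x \<in> carrier S"
  shows "x \<otimes> (sinv S x \<otimes> x) = x" "sinv S x \<otimes> (x \<otimes> sinv S x) = sinv S x"
    and "y \<in> carrier S \<Longrightarrow> x \<otimes> (sinv S x \<otimes> (x \<otimes> y)) = x \<otimes> y"
    and "y \<in> carrier S \<Longrightarrow> sinv S x \<otimes> (x \<otimes> (sinv S x \<otimes> y)) = sinv S x \<otimes> y"
proof -
  show 1: "x \<otimes> (sinv S x \<otimes> x) = x" and 2: "sinv S x \<otimes> (x \<otimes> sinv S x) = sinv S x"
    using mult_sinv_mult[OF assms] sinv_mult_sinv[OF assms] assms by (simp_all add: assoc)
  show "x \<otimes> (sinv S x \<otimes> (x \<otimes> y)) = x \<otimes> y" if "y \<in> carrier S"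
    using arg_cong[OF 1, of "\<lambda>z. z \<otimes> y"] assms that by (simp add: assoc)
  show "sinv S x \<otimes> (x \<otimes> (sinv S x \<otimes> y)) = sinv S x \<otimes> y" if "y \<in> carrier S"
    using arg_cong[OF 2, of "\<lambda>z. z \<otimes> y"] assms that by (simp add: assoc)
qed

lemma sinv_sinv [simp]: "x \<in> carrier S \<Longrightarrow> sinv S (sinv S x) = x"
  by (rule sinv_unique) (simp_all add: assoc cancel_simps)

lemma idem_closed [simp]: "e \<in> idems S \<Longrightarrow> e \<in> carrier S"
  by (simp add: idems_def)

lemma idem_idem [simp]: "e \<in> idems S \<Longrightarrow> e \<otimes> e = e"
  unfolding idems_def by simp

lemma idemI: "e \<in> carrier S \<Longrightarrow> e \<otimes> e = e \<Longrightarrow> e \<in> idems S"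
  unfolding idems_def by simp

lemma idem_idem_left [simp]: "e \<in> idems S \<Longrightarrow> y \<in> carrier S \<Longrightarrow> e \<otimes> (e \<otimes> y) = e \<otimes> y"
  by (simp add: assoc[symmetric])

lemma sinv_idem [simp]: "e \<in> idems S \<Longrightarrow> sinv S e = e"
  by (rule sinv_unique) simp_all

lemma sinv_mult_idem [simp]: "x \<in> carrier S \<Longrightarrow> sinv S x \<otimes> x \<in> idems S"
  by (rule idemI) (simp_all add: assoc cancel_simps)

lemma mult_sinv_idem [simp]: "x \<in> carrier S \<Longrightarrow> x \<otimes> sinv S x \<in> idems S"
  by (rule idemI) (simp_all add: assoc cancel_simps)

text \<open>If \<open>x\<close> is the inverse of \<open>ef\<close> then so is \<open>fxe\<close>, which is idempotent once it equals \<open>x\<close>;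
  an idempotent is its own inverse, hence \<open>ef = x\<close>.\<close>

lemma idem_mult [simp]:
  assumes e: "e \<in> idems S" and f: "f \<in> idems S"
  shows "e \<otimes> f \<in> idems S"
proof -
  define x where "x = sinv S (e \<otimes> f)"
  have x: "x \<in> carrier S" using e f by (simp add: x_def)
  have 1: "e \<otimes> (f \<otimes> (x \<otimes> (e \<otimes> f))) = e \<otimes> f" and 2: "x \<otimes> (e \<otimes> (f \<otimes> x)) = x"
    using cancel_simps(1,2)[of "e \<otimes> f"] e f x by (simp_all add: x_def[symmetric] assoc)
  have x2: "x \<otimes> (e \<otimes> (f \<otimes> (x \<otimes> y))) = x \<otimes> y" if "y \<in> carrier S" for y
    using arg_cong[OF 2, of "\<lambda>z. z \<otimes> y"] e f x that by (simp add: assoc)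
  have "sinv S (e \<otimes> f) = f \<otimes> (x \<otimes> e)"
    by (rule sinv_unique) (use 1 x2 e f x in \<open>simp_all add: assoc\<close>)
  then have x': "x = f \<otimes> (x \<otimes> e)" by (simp add: x_def)
  have "f \<otimes> (x \<otimes> e) \<otimes> (f \<otimes> (x \<otimes> e)) = f \<otimes> (x \<otimes> e)"
    using x2 e f x by (simp add: assoc)
  then have "x \<in> idems S" unfolding x'[symmetric] using x by (simp add: idemI)
  moreover have "sinv S x = e \<otimes> f" using e f by (simp add: x_def)
  ultimately show ?thesis by simp
qed

lemma idem_commute:
  assumes e: "e \<in> idems S" and f: "f \<in> idems S"
  shows "e \<otimes> f = f \<otimes> e"
proof -
  have ef: "e \<otimes> (f \<otimes> (e \<otimes> f)) = e \<otimes> f" and fe: "f \<otimes> (e \<otimes> (f \<otimes> e)) = f \<otimes> e"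
    using idem_idem[OF idem_mult[OF e f]] idem_idem[OF idem_mult[OF f e]] e f
    by (simp_all add: assoc del: idem_idem)
  have "sinv S (e \<otimes> f) = f \<otimes> e"
    by (rule sinv_unique) (use e f ef fe in \<open>simp_all add: assoc\<close>)
  then show ?thesis using e f by simp
qed

lemma sinv_mult:
  assumes x: "x \<in> carrier S" and y: "y \<in> carrier S"
  shows "sinv S (x \<otimes> y) = sinv S y \<otimes> sinv S x"
proof (rule sinv_unique)
  have *: "y \<otimes> sinv S y \<otimes> (sinv S x \<otimes> x) = sinv S x \<otimes> x \<otimes> (y \<otimes> sinv S y)"
    using x y by (simp add: idem_commute)
  have "x \<otimes> y \<otimes> (sinv S y \<otimes> sinv S x) \<otimes> (x \<otimes> y) = x \<otimes> (y \<otimes> sinv S y \<otimes> (sinv S x \<otimes> x)) \<otimes> y"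
    using x y by (simp add: assoc)
  also have "\<dots> = x \<otimes> y" unfolding * using x y by (simp add: assoc cancel_simps)
  finally show "x \<otimes> y \<otimes> (sinv S y \<otimes> sinv S x) \<otimes> (x \<otimes> y) = x \<otimes> y" .
  have "sinv S y \<otimes> sinv S x \<otimes> (x \<otimes> y) \<otimes> (sinv S y \<otimes> sinv S x)
      = sinv S y \<otimes> (sinv S x \<otimes> x \<otimes> (y \<otimes> sinv S y)) \<otimes> sinv S x"
    using x y by (simp add: assoc)
  also have "\<dots> = sinv S y \<otimes> sinv S x" unfolding *[symmetric] using x y by (simp add: assoc cancel_simps)
  finally show "sinv S y \<otimes> sinv S x \<otimes> (x \<otimes> y) \<otimes> (sinv S y \<otimes> sinv S x) = sinv S y \<otimes> sinv S x" .
qed (use x y in simp_all)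

lemma conj_idem:
  assumes "x \<in> carrier S" "e \<in> idems S"
  shows "x \<otimes> (e \<otimes> sinv S x) \<in> idems S"
proof -
  have "x \<otimes> (e \<otimes> sinv S x) = (x \<otimes> e) \<otimes> sinv S (x \<otimes> e)"
    using assms by (simp add: sinv_mult assoc)
  then show ?thesis using assms by simp
qed

text \<open>An idempotent can be moved to the other side of \<open>x\<close> at the price of being conjugated by \<open>x\<close>.
  This makes the natural order, defined with idempotents on the left, left-right symmetric.\<close>
lemma idem_mult_move:
  assumes "x \<in> carrier S" "e \<in> idems S"
  shows "x \<otimes> e = x \<otimes> (e \<otimes> sinv S x) \<otimes> x" "e \<otimes> x = x \<otimes> (sinv S x \<otimes> e \<otimes> x)"
proof -
  have "x \<otimes> e = x \<otimes> (sinv S x \<otimes> x \<otimes> e)" using assms by (simp add: assoc cancel_simps)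
  also have "sinv S x \<otimes> x \<otimes> e = e \<otimes> (sinv S x \<otimes> x)"
    using assms by (simp add: idem_commute)
  finally show "x \<otimes> e = x \<otimes> (e \<otimes> sinv S x) \<otimes> x" using assms by (simp add: assoc)
  have "e \<otimes> x = (e \<otimes> (x \<otimes> sinv S x)) \<otimes> x" using assms by (simp add: assoc cancel_simps)
  also have "e \<otimes> (x \<otimes> sinv S x) = (x \<otimes> sinv S x) \<otimes> e"
    using assms by (simp add: idem_commute)
  finally show "e \<otimes> x = x \<otimes> (sinv S x \<otimes> e \<otimes> x)" using assms by (simp add: assoc)
qed

subsection \<open>The natural partial order\<close>

lemma nat_le_carrier: "nat_le S s t \<Longrightarrow> s \<in> carrier S" "nat_le S s t \<Longrightarrow> t \<in> carrier S"
  by (simp_all add: nat_le_def)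

lemma nat_leI: "t \<in> carrier S \<Longrightarrow> f \<in> idems S \<Longrightarrow> nat_le S (f \<otimes> t) t"
  by (auto simp: nat_le_def)

lemma nat_leI_right: "t \<in> carrier S \<Longrightarrow> f \<in> idems S \<Longrightarrow> nat_le S (t \<otimes> f) t"
  by (simp add: idem_mult_move(1) nat_leI conj_idem)

lemma nat_le_refl [simp]: "s \<in> carrier S \<Longrightarrow> nat_le S s s"
  using nat_leI[of s "s \<otimes> sinv S s"] by (simp add: assoc cancel_simps)

lemma nat_leE:
  assumes "nat_le S s t"
  obtains f where "f \<in> idems S" "s = f \<otimes> t" "t \<in> carrier S"
  using assms by (auto simp: nat_le_def)

lemma nat_leE_right:
  assumes "nat_le S s t"
  obtains f where "f \<in> idems S" "s = t \<otimes> f" "t \<in> carrier S"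
proof -
  obtain f where f: "f \<in> idems S" "s = f \<otimes> t" "t \<in> carrier S" using assms by (rule nat_leE)
  have "sinv S t \<otimes> f \<otimes> t \<in> idems S"
    using conj_idem[of "sinv S t" f] f by (simp add: assoc)
  then show ?thesis using that f idem_mult_move(2) by blast
qed

lemma nat_le_trans: "nat_le S r s \<Longrightarrow> nat_le S s t \<Longrightarrow> nat_le S r t"
proof (elim nat_leE)
  fix f g assume "f \<in> idems S" "r = f \<otimes> s" "g \<in> idems S" "s = g \<otimes> t" "t \<in> carrier S"
  then show "nat_le S r t" using nat_leI[of t "f \<otimes> g"] by (simp add: assoc)
qed

lemma nat_le_mult:
  assumes "nat_le S s t" "nat_le S u v"
  shows "nat_le S (s \<otimes> u) (t \<otimes> v)"
proof -
  obtain f g where f: "f \<in> idems S" "s = f \<otimes> t" "t \<in> carrier S"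
    and g: "g \<in> idems S" "u = v \<otimes> g" "v \<in> carrier S"
    using assms by (meson nat_leE nat_leE_right)
  have "nat_le S (f \<otimes> (t \<otimes> v \<otimes> g)) (t \<otimes> v \<otimes> g)" using f g by (simp add: nat_leI)
  moreover have "nat_le S (t \<otimes> v \<otimes> g) (t \<otimes> v)" using f g by (simp add: nat_leI_right)
  ultimately have "nat_le S (f \<otimes> (t \<otimes> v \<otimes> g)) (t \<otimes> v)" by (rule nat_le_trans)
  then show ?thesis using f g by (simp add: assoc)
qed

lemma nat_le_sinv: "nat_le S s t \<Longrightarrow> nat_le S (sinv S s) (sinv S t)"
  by (erule nat_leE) (simp add: sinv_mult nat_leI_right)

lemma nat_le_idem: "nat_le S s e \<Longrightarrow> e \<in> idems S \<Longrightarrow> s \<in> idems S"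
  by (auto elim: nat_leE)

text \<open>In the language of partial bijections: \<open>d\<close> and \<open>d d\<close> agree on the domain of \<open>p\<close>, and since \<open>d\<close> is
  injective it fixes this domain pointwise. So its restriction \<open>p\<close> is a partial identity.\<close>

lemma idem_if_below_square:
  assumes "nat_le S p d" "nat_le S p (d \<otimes> d)"
  shows "p \<in> idems S"
proof -
  obtain g h where d: "d \<in> carrier S" and g: "g \<in> idems S" "p = d \<otimes> g"
    and h: "h \<in> idems S" "p = d \<otimes> d \<otimes> h"
    using assms by (meson nat_leE_right)
  \<comment> \<open>the domain of \<open>p\<close>; the aim is \<open>p = f\<close>\<close>
  define f where "f = sinv S p \<otimes> p"
  have p: "p \<in> carrier S" using d g by simp
  have f: "f \<in> idems S" using p by (simp add: f_def)
  have pf: "p \<otimes> f = p" using p by (simp add: f_def cancel_simps)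
  have restrict: "q \<otimes> f = p" if "q \<in> carrier S" "k \<in> idems S" "p = q \<otimes> k" for q k
  proof -
    have "f \<otimes> k = f" using that by (simp add: f_def assoc)
    then have "q \<otimes> f = q \<otimes> k \<otimes> f"
      using that f idem_commute[of f k] by (simp add: assoc)
    then show ?thesis using that pf by simp
  qed
  have df: "d \<otimes> f = p" and ddf: "d \<otimes> (d \<otimes> f) = p"
    using restrict[OF d g] restrict[OF _ h] d f by (simp_all add: assoc)
  have "sinv S p = f \<otimes> sinv S d" using d f df[symmetric] by (simp add: sinv_mult)
  then have "f = f \<otimes> sinv S d \<otimes> p" unfolding f_def by simp
  then have "f \<otimes> (sinv S d \<otimes> p) = f" using d f p by (simp add: assoc)
  then have ff: "f \<otimes> (sinv S d \<otimes> d) \<otimes> f = f" using d f df by (simp add: assoc)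
  have "sinv S d \<otimes> d \<otimes> f = f \<otimes> (sinv S d \<otimes> d)"
    using idem_commute[OF f sinv_mult_idem[OF d]] by simp
  then have "sinv S d \<otimes> d \<otimes> f = f \<otimes> (sinv S d \<otimes> d) \<otimes> f"
    using d f by (metis assoc closed idem_closed idem_idem sinv_closed)
  then have ddf1: "sinv S d \<otimes> d \<otimes> f = f" using ff by simp
  have "f = sinv S d \<otimes> d \<otimes> p"
    using ddf1 df ddf d f by (metis assoc closed idem_closed sinv_closed)
  then have "nat_le S f p" using nat_leI[OF p sinv_mult_idem[OF d]] by metis
  then obtain k where k: "k \<in> idems S" "f = p \<otimes> k" by (rule nat_leE_right)
  have "p \<otimes> (f \<otimes> k) = p \<otimes> k" using pf p f k by (metis assoc idem_closed)
  have "f \<otimes> k = f" using k p by (metis assoc idem_closed idem_idem)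
  then have "p \<otimes> f = p \<otimes> (f \<otimes> k)" by simp
  then have "p = f" using \<open>p \<otimes> (f \<otimes> k) = p \<otimes> k\<close> k(2) pf by metis
  then show ?thesis using f by simp
qed

subsection \<open>Green's relations\<close>

text \<open>The principal one-sided ideals of \<open>a\<close> depend only on the idempotents \<open>a\<inverse> a\<close> and \<open>a a\<inverse>\<close>, which
  turns Green's relations into equations between idempotents.\<close>
lemma left_ideal1_eq:
  assumes "a \<in> carrier S"
  shows "left_ideal1 S a = {x \<in> carrier S. x \<otimes> (sinv S a \<otimes> a) = x}"
proof (intro equalityI subsetI)
  fix x assume "x \<in> left_ideal1 S a"
  then show "x \<in> {x \<in> carrier S. x \<otimes> (sinv S a \<otimes> a) = x}"
    using assms by (auto simp: left_ideal1_def assoc cancel_simps)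
next
  fix x assume "x \<in> {x \<in> carrier S. x \<otimes> (sinv S a \<otimes> a) = x}"
  then have "x \<in> carrier S" "x \<otimes> (sinv S a \<otimes> a) = x" by auto
  then have "x = (x \<otimes> sinv S a) \<otimes> a" "x \<otimes> sinv S a \<in> carrier S" using assms by (simp_all add: assoc)
  then show "x \<in> left_ideal1 S a" unfolding left_ideal1_def by blast
qed

lemma right_ideal1_eq:
  assumes "a \<in> carrier S"
  shows "right_ideal1 S a = {x \<in> carrier S. (a \<otimes> sinv S a) \<otimes> x = x}"
proof (intro equalityI subsetI)
  fix x assume "x \<in> right_ideal1 S a"
  then show "x \<in> {x \<in> carrier S. (a \<otimes> sinv S a) \<otimes> x = x}"
    using assms by (auto simp: right_ideal1_def assoc cancel_simps)
next
  fix x assume "x \<in> {x \<in> carrier S. (a \<otimes> sinv S a) \<otimes> x = x}"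
  then have "x \<in> carrier S" "a \<otimes> sinv S a \<otimes> x = x" by auto
  then have "x = a \<otimes> (sinv S a \<otimes> x)" "sinv S a \<otimes> x \<in> carrier S" using assms by (simp_all add: assoc)
  then show "x \<in> right_ideal1 S a" unfolding right_ideal1_def by blast
qed

lemma greenL_iff:
  "greenL S a b \<longleftrightarrow> a \<in> carrier S \<and> b \<in> carrier S \<and> sinv S a \<otimes> a = sinv S b \<otimes> b"
proof -
  have "sinv S a \<otimes> a = sinv S b \<otimes> b"
    if a: "a \<in> carrier S" and b: "b \<in> carrier S" and eq: "left_ideal1 S a = left_ideal1 S b"
  proof -
    have m: "sinv S a \<otimes> a \<in> left_ideal1 S a" "sinv S b \<otimes> b \<in> left_ideal1 S b"
      using a b by (simp_all add: left_ideal1_eq)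
    from m(1)[unfolded eq] m(2)[folded eq]
    have "sinv S a \<otimes> a \<otimes> (sinv S b \<otimes> b) = sinv S a \<otimes> a" "sinv S b \<otimes> b \<otimes> (sinv S a \<otimes> a) = sinv S b \<otimes> b"
      using a b by (simp_all add: left_ideal1_eq)
    then show ?thesis using idem_commute[OF sinv_mult_idem[OF a] sinv_mult_idem[OF b]] by simp
  qed
  then show ?thesis by (auto simp: greenL_def left_ideal1_eq)
qed

lemma greenR_iff:
  "greenR S a b \<longleftrightarrow> a \<in> carrier S \<and> b \<in> carrier S \<and> a \<otimes> sinv S a = b \<otimes> sinv S b"
proof -
  have "a \<otimes> sinv S a = b \<otimes> sinv S b"
    if a: "a \<in> carrier S" and b: "b \<in> carrier S" and eq: "right_ideal1 S a = right_ideal1 S b"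
  proof -
    have m: "a \<otimes> sinv S a \<in> right_ideal1 S a" "b \<otimes> sinv S b \<in> right_ideal1 S b"
      using a b by (simp_all add: right_ideal1_eq)
    from m(1)[unfolded eq] m(2)[folded eq]
    have "b \<otimes> sinv S b \<otimes> (a \<otimes> sinv S a) = a \<otimes> sinv S a" "a \<otimes> sinv S a \<otimes> (b \<otimes> sinv S b) = b \<otimes> sinv S b"
      using a b by (simp_all add: right_ideal1_eq)
    then show ?thesis using idem_commute[OF mult_sinv_idem[OF a] mult_sinv_idem[OF b]] by simp
  qed
  then show ?thesis by (auto simp: greenR_def right_ideal1_eq)
qed

lemma greenH_idem_iff:
  "e \<in> idems S \<Longrightarrow> greenH S e a \<longleftrightarrow> a \<in> carrier S \<and> sinv S a \<otimes> a = e \<and> a \<otimes> sinv S a = e"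
  by (auto simp: greenH_def greenL_iff greenR_iff)

lemma greenD_mult_sinv:
  assumes "a \<in> carrier S" "sinv S a \<otimes> a = e"
  shows "greenD S e (a \<otimes> sinv S a)"
proof -
  have "e \<in> idems S" using assms by auto
  then show ?thesis unfolding greenD_def
    using assms by (intro exI[of _ a]) (auto simp: greenL_iff greenR_iff)
qed

text \<open>For partial bijections: \<open>b a\<close> has the same domain as \<open>a\<close> iff the domain of \<open>b\<close> contains the range
  of \<open>a\<close>.\<close>
lemma mult_in_L_iff:
  assumes a: "a \<in> carrier S" and b: "b \<in> carrier S"
  shows "sinv S (b \<otimes> a) \<otimes> (b \<otimes> a) = sinv S a \<otimes> a
    \<longleftrightarrow> sinv S b \<otimes> b \<otimes> (a \<otimes> sinv S a) = a \<otimes> sinv S a" (is "?l = ?r")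
proof
  assume ?l
  then have "sinv S a \<otimes> (sinv S b \<otimes> (b \<otimes> a)) = sinv S a \<otimes> a"
    using a b by (simp add: sinv_mult assoc)
  then have "a \<otimes> (sinv S a \<otimes> (sinv S b \<otimes> (b \<otimes> a))) \<otimes> sinv S a = a \<otimes> (sinv S a \<otimes> a) \<otimes> sinv S a"
    by simp
  then have "(a \<otimes> sinv S a) \<otimes> (sinv S b \<otimes> b) \<otimes> (a \<otimes> sinv S a) = a \<otimes> sinv S a"
    using a b by (simp add: assoc cancel_simps)
  then show ?r
    using idem_commute[OF mult_sinv_idem[OF a] sinv_mult_idem[OF b]] a b
    by (simp add: assoc cancel_simps)
next
  assume r: ?r
  have "sinv S (b \<otimes> a) \<otimes> (b \<otimes> a) = sinv S a \<otimes> (sinv S b \<otimes> b \<otimes> (a \<otimes> sinv S a)) \<otimes> a"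
    using a b by (simp add: sinv_mult assoc cancel_simps)
  also have "\<dots> = sinv S a \<otimes> a" unfolding r using a by (simp add: assoc cancel_simps)
  finally show ?l .
qed

text \<open>Left multiplication by \<open>b a\<inverse>\<close>, a map from the range of \<open>a\<close> to that of \<open>b\<close>, moves \<open>a\<close> to \<open>b\<close>.\<close>
lemma L_transport:
  assumes a: "a \<in> carrier S" and b: "b \<in> carrier S" and eq: "sinv S a \<otimes> a = sinv S b \<otimes> b"
  shows "b \<otimes> sinv S a \<otimes> a = b"
    and "sinv S (b \<otimes> sinv S a) \<otimes> (b \<otimes> sinv S a) = a \<otimes> sinv S a"
    and "b \<otimes> sinv S a \<otimes> sinv S (b \<otimes> sinv S a) = b \<otimes> sinv S b"
proof -
  have "b \<otimes> sinv S a \<otimes> a = b \<otimes> (sinv S a \<otimes> a)" using a b by (simp add: assoc)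
  then show 1: "b \<otimes> sinv S a \<otimes> a = b" unfolding eq using b by (simp add: cancel_simps)
  have "sinv S (b \<otimes> sinv S a) \<otimes> (b \<otimes> sinv S a) = a \<otimes> (sinv S b \<otimes> b) \<otimes> sinv S a"
    using a b by (simp add: sinv_mult assoc)
  then show "sinv S (b \<otimes> sinv S a) \<otimes> (b \<otimes> sinv S a) = a \<otimes> sinv S a"
    unfolding eq[symmetric] using a by (simp add: assoc cancel_simps)
  have "b \<otimes> sinv S a \<otimes> sinv S (b \<otimes> sinv S a) = b \<otimes> sinv S a \<otimes> a \<otimes> sinv S b"
    using a b by (simp add: sinv_mult assoc)
  then show "b \<otimes> sinv S a \<otimes> sinv S (b \<otimes> sinv S a) = b \<otimes> sinv S b" unfolding 1 .
qed

lemma L_act_group: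
  assumes "a \<in> carrier S" "g \<in> carrier S"
    and "sinv S a \<otimes> a = e" "sinv S g \<otimes> g = e" "g \<otimes> sinv S g = e"
  shows "sinv S (a \<otimes> g) \<otimes> (a \<otimes> g) = e" "a \<otimes> g \<otimes> sinv S (a \<otimes> g) = a \<otimes> sinv S a"
proof -
  have "sinv S (a \<otimes> g) \<otimes> (a \<otimes> g) = sinv S g \<otimes> (sinv S a \<otimes> a) \<otimes> g"
    using assms(1,2) by (simp add: sinv_mult assoc)
  also have "\<dots> = sinv S g \<otimes> (g \<otimes> sinv S g) \<otimes> g" using assms by simp
  also have "\<dots> = sinv S g \<otimes> g" using assms(1,2) by (simp add: assoc cancel_simps)
  finally show "sinv S (a \<otimes> g) \<otimes> (a \<otimes> g) = e" using assms by simp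
  have "a \<otimes> g \<otimes> sinv S (a \<otimes> g) = a \<otimes> (g \<otimes> sinv S g) \<otimes> sinv S a"
    using assms(1,2) by (simp add: sinv_mult assoc)
  also have "\<dots> = a \<otimes> (sinv S a \<otimes> a) \<otimes> sinv S a" using assms by simp
  also have "\<dots> = a \<otimes> sinv S a" using assms(1,2) by (simp add: assoc cancel_simps)
  finally show "a \<otimes> g \<otimes> sinv S (a \<otimes> g) = a \<otimes> sinv S a" .
qed

text \<open>The elements of an L-class with a given range form a single orbit of the maximal subgroup.\<close>
lemma H_related_in_orbit:
  assumes a: "a \<in> carrier S" and b: "b \<in> carrier S"
    and L: "sinv S a \<otimes> a = e" "sinv S b \<otimes> b = e" and R: "a \<otimes> sinv S a = b \<otimes> sinv S b"
  defines "g \<equiv> sinv S a \<otimes> b"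
  shows "a \<otimes> g = b" "sinv S g \<otimes> g = e" "g \<otimes> sinv S g = e"
proof -
  have "a \<otimes> g = (a \<otimes> sinv S a) \<otimes> b" using a b by (simp add: g_def assoc)
  then show "a \<otimes> g = b" unfolding R using b by (simp add: assoc cancel_simps)
  have "sinv S g \<otimes> g = sinv S b \<otimes> (a \<otimes> sinv S a) \<otimes> b" using a b by (simp add: g_def sinv_mult assoc)
  then show "sinv S g \<otimes> g = e" unfolding R using b L by (simp add: assoc cancel_simps)
  have "g \<otimes> sinv S g = sinv S a \<otimes> (b \<otimes> sinv S b) \<otimes> a" using a b by (simp add: g_def sinv_mult assoc)
  then show "g \<otimes> sinv S g = e" unfolding R[symmetric] using a L by (simp add: assoc cancel_simps)
qed

text \<open>Conjugation by \<open>b a\<inverse>\<close> carries the idempotents of the D-class below \<open>a a\<inverse>\<close>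
  injectively to those below \<open>b b\<inverse>\<close>, so if there are finitely many, all these sets of idempotents are
  equinumerous. A strict inequality would make one of the sets a proper subset of another.\<close>

lemma finite_D_class_idems_incomparable:
  defines "F e \<equiv> {a \<otimes> sinv S a | a. a \<in> carrier S \<and> sinv S a \<otimes> a = e}"
  assumes fin: "finite (F e)" and f: "f \<in> F e" and g: "g \<in> F e" and le: "g \<otimes> f = g"
  shows "g = f"
proof -
  define down where "down f = {h \<in> F e. h \<otimes> f = h}" for f
  have F_idem: "h \<in> idems S" if "h \<in> F e" for h using that by (auto simp: F_def)
  have card: "card (down p) \<le> card (down q)" if p: "p \<in> F e" and q: "q \<in> F e" for p q
  proof -
    obtain a b where a: "a \<in> carrier S" "sinv S a \<otimes> a = e" "p = a \<otimes> sinv S a"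
      and b: "b \<in> carrier S" "sinv S b \<otimes> b = e" "q = b \<otimes> sinv S b"
      using p q by (auto simp: F_def)
    define x where "x = b \<otimes> sinv S a"
    have x: "x \<in> carrier S" using a b by (simp add: x_def)
    have xp: "sinv S x \<otimes> x = p" and xq: "x \<otimes> sinv S x = q"
      using L_transport[of a b] a b by (simp_all add: x_def)
    have ph: "p \<otimes> h = h" if "h \<in> down p" for h
      using that idem_commute[OF F_idem[OF p] F_idem[of h]] by (simp add: down_def)
    \<comment> \<open>conjugation by \<open>x\<close>, with the inverse map given by conjugation by \<open>x\<inverse>\<close>\<close>
    let ?c = "\<lambda>h. x \<otimes> (h \<otimes> sinv S x)"
    have "?c h \<in> down q" if h: "h \<in> down p" for h
    proof -
      obtain c where c: "c \<in> carrier S" "sinv S c \<otimes> c = e" "h = c \<otimes> sinv S c"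
        using h by (auto simp: F_def down_def)
      have "sinv S (x \<otimes> c) \<otimes> (x \<otimes> c) = e"
        using mult_in_L_iff[OF c(1) x] c xp ph[OF h] by simp
      moreover have "?c h = (x \<otimes> c) \<otimes> sinv S (x \<otimes> c)" using x c(1) by (simp add: c(3) sinv_mult assoc)
      ultimately have "?c h \<in> F e" using x c(1) by (auto simp: F_def)
      moreover have "?c h \<otimes> q = ?c h" using x c(1) by (simp add: xq[symmetric] c(3) assoc cancel_simps)
      ultimately show ?thesis by (simp add: down_def)
    qed
    moreover have "inj_on ?c (down p)"
    proof (rule inj_on_inverseI[where g = "\<lambda>k. sinv S x \<otimes> (k \<otimes> x)"])
      fix h assume h: "h \<in> down p"
      then have "h \<in> carrier S" using F_idem by (simp add: down_def)
      then have "sinv S x \<otimes> (?c h \<otimes> x) = p \<otimes> h \<otimes> p" using x by (simp add: xp[symmetric] assoc)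
      also have "\<dots> = h" using h ph by (simp add: down_def)
      finally show "sinv S x \<otimes> (?c h \<otimes> x) = h" .
    qed
    moreover have "finite (down q)" using fin by (simp add: down_def)
    ultimately show ?thesis by (intro card_inj_on_le[of ?c]) auto
  qed
  have "down g \<subseteq> down f"
  proof
    fix h assume h: "h \<in> down g"
    then have "h \<otimes> f = h \<otimes> g \<otimes> f" by (simp add: down_def)
    also have "\<dots> = h \<otimes> (g \<otimes> f)" using h f g F_idem by (intro assoc) (auto simp: down_def)
    also have "\<dots> = h" using h le by (simp add: down_def)
    finally show "h \<in> down f" using h by (simp add: down_def)
  qed
  moreover have "finite (down f)" using fin by (simp add: down_def)
  ultimately have "down g = down f" using card[OF f g] card_seteq by blast
  moreover have "f \<in> down f" using f F_idem by (simp add: down_def)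
  ultimately have "f \<in> down g" by simp
  then have "f \<otimes> g = f" by (simp add: down_def)
  then show ?thesis using le idem_commute[OF F_idem[OF f] F_idem[OF g]] by simp
qed

end

text \<open>Commuting idempotents force inverses to be unique: two inverses \<open>y\<close> and \<open>z\<close> of \<open>x\<close> both equal
  \<open>z x y\<close>.\<close>

lemma inverse_semigroupI:
  fixes T (structure)
  assumes closed: "\<And>x y. \<lbrakk>x \<in> carrier T; y \<in> carrier T\<rbrakk> \<Longrightarrow> x \<otimes> y \<in> carrier T"
    and assoc: "\<And>x y z. \<lbrakk>x \<in> carrier T; y \<in> carrier T; z \<in> carrier T\<rbrakk> \<Longrightarrow> (x \<otimes> y) \<otimes> z = x \<otimes> (y \<otimes> z)"
    and ex_inverse: "\<And>x. x \<in> carrier T \<Longrightarrow> \<exists>y\<in>carrier T. x \<otimes> y \<otimes> x = x \<and> y \<otimes> x \<otimes> y = y"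
    and commute: "\<And>e f. \<lbrakk>e \<in> idems T; f \<in> idems T\<rbrakk> \<Longrightarrow> e \<otimes> f = f \<otimes> e"
  shows "inverse_semigroup T"
proof
  fix x assume x: "x \<in> carrier T"
  have "y = z" if y: "y \<in> carrier T" "x \<otimes> y \<otimes> x = x" "y \<otimes> x \<otimes> y = y"
    and z: "z \<in> carrier T" "x \<otimes> z \<otimes> x = x" "z \<otimes> x \<otimes> z = z" for y z
  proof -
    have id: "y \<otimes> x \<in> idems T" "z \<otimes> x \<in> idems T" "x \<otimes> y \<in> idems T" "x \<otimes> z \<in> idems T"
      using x y z assoc[of "y \<otimes> x" y x] assoc[of "z \<otimes> x" z x] assoc[of "x \<otimes> y" x y]
        assoc[of "x \<otimes> z" x z] by (simp_all add: idems_def closed)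
    have "y = y \<otimes> (x \<otimes> z \<otimes> x) \<otimes> y" using y z by simp
    also have "\<dots> = (y \<otimes> x) \<otimes> (z \<otimes> x) \<otimes> y" using x y(1) z(1) by (simp add: closed assoc)
    also have "\<dots> = (z \<otimes> x) \<otimes> (y \<otimes> x) \<otimes> y" using commute id by metis
    also have "\<dots> = z \<otimes> x \<otimes> (y \<otimes> x \<otimes> y)" using x y(1) z(1) by (simp add: closed assoc)
    also have "\<dots> = z \<otimes> x \<otimes> y" using y(3) by simp
    finally have 1: "y = z \<otimes> x \<otimes> y" .
    have "z = z \<otimes> (x \<otimes> y \<otimes> x) \<otimes> z" using y z by simp
    also have "\<dots> = z \<otimes> ((x \<otimes> y) \<otimes> (x \<otimes> z))" using x y(1) z(1) by (simp add: closed assoc)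
    also have "\<dots> = z \<otimes> ((x \<otimes> z) \<otimes> (x \<otimes> y))" using commute id by metis
    also have "\<dots> = (z \<otimes> x \<otimes> z) \<otimes> x \<otimes> y" using x y(1) z(1) by (simp add: closed assoc)
    finally have "z = z \<otimes> x \<otimes> y" using z by simp
    with 1 show "y = z" by metis
  qed
  then show "\<exists>!y. y \<in> carrier T \<and> x \<otimes> y \<otimes> x = x \<and> y \<otimes> x \<otimes> y = y"
    using ex_inverse[OF x] by blast
qed (fact closed assoc)+

section \<open>The inverse semigroup of closed directed subsets\<close>

context inverse_semigroup
begin

lemma up_subset [simp]: "up S A \<subseteq> carrier S"
  by (auto simp: up_def)

lemma upI: "a \<in> A \<Longrightarrow> nat_le S a s \<Longrightarrow> s \<in> up S A"
  using nat_le_carrier by (auto simp: up_def)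

lemma upE:
  assumes "s \<in> up S A"
  obtains a where "a \<in> A" "nat_le S a s"
  using assms by (auto simp: up_def)

lemma subset_up: "A \<subseteq> carrier S \<Longrightarrow> A \<subseteq> up S A"
  by (meson nat_le_refl subsetD subsetI upI)

lemma up_minimal:
  assumes "A \<subseteq> up S B"
  shows "up S A \<subseteq> up S B"
proof
  fix s assume "s \<in> up S A"
  then obtain a where "a \<in> A" "nat_le S a s" by (rule upE)
  moreover then obtain b where "b \<in> B" "nat_le S b a" using assms by (blast elim: upE)
  ultimately show "s \<in> up S B" by (blast intro: upI nat_le_trans)
qed

lemma up_eqI: "A \<subseteq> up S B \<Longrightarrow> B \<subseteq> up S A \<Longrightarrow> up S A = up S B"
  by (intro equalityI up_minimal)

lemma up_up [simp]: "up S (up S A) = up S A"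
  using up_minimal[of "up S A" A] subset_up[OF up_subset] by blast

lemma directedE:
  assumes "directed S A" "a \<in> A" "b \<in> A"
  obtains c where "c \<in> A" "nat_le S c a" "nat_le S c b"
  using assms by (auto simp: directed_def)

lemma set_mult_subset: "A \<subseteq> carrier S \<Longrightarrow> B \<subseteq> carrier S \<Longrightarrow> A <#> B \<subseteq> carrier S"
  by (auto simp: set_mult_def intro!: closed dest: subsetD)

lemma set_multI: "a \<in> A \<Longrightarrow> b \<in> B \<Longrightarrow> a \<otimes> b \<in> A <#> B"
  by (auto simp: set_mult_def)

lemma set_multE:
  assumes "x \<in> A <#> B"
  obtains a b where "a \<in> A" "b \<in> B" "x = a \<otimes> b"
  using assms by (auto simp: set_mult_def)

lemma set_mult_assoc_semigroup:
  "A \<subseteq> carrier S \<Longrightarrow> B \<subseteq> carrier S \<Longrightarrow> C \<subseteq> carrier S \<Longrightarrow> (A <#> B) <#> C = A <#> (B <#> C)"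
proof -
  assume sub: "A \<subseteq> carrier S" "B \<subseteq> carrier S" "C \<subseteq> carrier S"
  have "a \<otimes> b \<otimes> c = a \<otimes> (b \<otimes> c)" if "a \<in> A" "b \<in> B" "c \<in> C" for a b c
    using sub that by (intro assoc) auto
  then show "(A <#> B) <#> C = A <#> (B <#> C)"
    unfolding set_mult_def by force
qed

text \<open>Multiplication is monotone for the natural order, so up-closures can be postponed to the end
  of a computation. This reduces products in \<open>L(S)\<close> to products of subsets of \<open>S\<close>.\<close>
lemma set_mult_up:
  assumes "A \<subseteq> carrier S" "B \<subseteq> carrier S"
  shows "up S (up S A <#> up S B) = up S (A <#> B)"
proof (rule up_eqI)
  show "up S A <#> up S B \<subseteq> up S (A <#> B)"
  proof
    fix x assume "x \<in> up S A <#> up S B"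
    then obtain a b where "a \<in> up S A" "b \<in> up S B" and x: "x = a \<otimes> b" by (rule set_multE)
    then obtain a' b' where "a' \<in> A" "nat_le S a' a" "b' \<in> B" "nat_le S b' b" by (blast elim: upE)
    then show "x \<in> up S (A <#> B)" unfolding x by (blast intro: upI set_multI nat_le_mult)
  qed
  have "A <#> B \<subseteq> up S A <#> up S B"
    using subset_up[OF assms(1)] subset_up[OF assms(2)] by (blast intro: set_multI elim: set_multE)
  also have "\<dots> \<subseteq> up S (up S A <#> up S B)"
    by (intro subset_up set_mult_subset up_subset)
  finally show "A <#> B \<subseteq> up S (up S A <#> up S B)" .
qed

lemma LS_I: "A \<subseteq> carrier S \<Longrightarrow> directed S A \<Longrightarrow> up S A \<in> carrier (LS S)"
proof -
  assume A: "A \<subseteq> carrier S" "directed S A"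
  have "directed S (up S A)"
    unfolding directed_def
  proof (intro conjI ballI)
    show "up S A \<noteq> {}" using A subset_up[OF A(1)] by (auto simp: directed_def)
    fix a b assume "a \<in> up S A" "b \<in> up S A"
    then obtain a' b' where *: "a' \<in> A" "b' \<in> A" "nat_le S a' a" "nat_le S b' b" by (blast elim: upE)
    obtain c where "c \<in> A" "nat_le S c a'" "nat_le S c b'" using A(2) *(1,2) by (rule directedE)
    then show "\<exists>c \<in> up S A. nat_le S c a \<and> nat_le S c b"
      using * subset_up[OF A(1)] by (blast intro: nat_le_trans)
  qed
  then show ?thesis by (simp add: LS_def up_closed_def)
qed

lemma LS_subset: "A \<in> carrier (LS S) \<Longrightarrow> A \<subseteq> carrier S"
  and LS_up: "A \<in> carrier (LS S) \<Longrightarrow> up S A = A"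
  and LS_directed: "A \<in> carrier (LS S) \<Longrightarrow> directed S A"
  by (auto simp: LS_def up_closed_def)

lemma LS_elem: "A \<in> carrier (LS S) \<Longrightarrow> a \<in> A \<Longrightarrow> a \<in> carrier S"
  using LS_subset by blast

lemma LS_upward: "A \<in> carrier (LS S) \<Longrightarrow> a \<in> A \<Longrightarrow> nat_le S a b \<Longrightarrow> b \<in> A"
  using upI[of a A b] LS_up[of A] by simp

lemma LS_nonempty: "A \<in> carrier (LS S) \<Longrightarrow> \<exists>a. a \<in> A"
  using LS_directed[of A] by (auto simp: directed_def)

lemma LS_lower_bound:
  assumes "A \<in> carrier (LS S)" "a \<in> A" "b \<in> A"
  obtains c where "c \<in> A" "nat_le S c a" "nat_le S c b"
  using directedE[OF LS_directed] assms by blast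

lemma LS_mult: "A \<otimes>\<^bsub>LS S\<^esub> B = up S (A <#> B)"
  by (simp add: LS_def)

lemma LS_multI: "A \<in> carrier (LS S) \<Longrightarrow> B \<in> carrier (LS S) \<Longrightarrow> a \<in> A \<Longrightarrow> b \<in> B \<Longrightarrow> a \<otimes> b \<in> A \<otimes>\<^bsub>LS S\<^esub> B"
  unfolding LS_mult using subset_up[OF set_mult_subset[OF LS_subset LS_subset]] by (blast intro: set_multI)

lemma LS_multE:
  assumes "x \<in> A \<otimes>\<^bsub>LS S\<^esub> B"
  obtains a b where "a \<in> A" "b \<in> B" "nat_le S (a \<otimes> b) x"
  using assms unfolding LS_mult by (blast elim: upE set_multE)

lemma LS_closed:
  assumes A: "A \<in> carrier (LS S)" and B: "B \<in> carrier (LS S)"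
  shows "A \<otimes>\<^bsub>LS S\<^esub> B \<in> carrier (LS S)"
  unfolding LS_mult
proof (rule LS_I)
  show "A <#> B \<subseteq> carrier S" using A B by (simp add: LS_subset set_mult_subset)
  show "directed S (A <#> B)"
    unfolding directed_def
  proof (intro conjI ballI)
    show "A <#> B \<noteq> {}" using LS_nonempty[OF A] LS_nonempty[OF B] by (auto simp: set_mult_def)
    fix x y assume "x \<in> A <#> B" "y \<in> A <#> B"
    then obtain a b a' b' where *: "a \<in> A" "b \<in> B" "x = a \<otimes> b" "a' \<in> A" "b' \<in> B" "y = a' \<otimes> b'"
      by (metis set_multE)
    obtain c where c: "c \<in> A" "nat_le S c a" "nat_le S c a'" using A *(1,4) by (rule LS_lower_bound)
    obtain d where d: "d \<in> B" "nat_le S d b" "nat_le S d b'" using B *(2,5) by (rule LS_lower_bound)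
    have "nat_le S (c \<otimes> d) x" "nat_le S (c \<otimes> d) y" using c d * by (simp_all add: nat_le_mult)
    then show "\<exists>z \<in> A <#> B. nat_le S z x \<and> nat_le S z y" using c d by (blast intro: set_multI)
  qed
qed

lemma LS_mult3:
  assumes "A \<in> carrier (LS S)" "B \<in> carrier (LS S)" "C \<in> carrier (LS S)"
  shows "A \<otimes>\<^bsub>LS S\<^esub> B \<otimes>\<^bsub>LS S\<^esub> C = up S (A <#> B <#> C)"
    and "A \<otimes>\<^bsub>LS S\<^esub> (B \<otimes>\<^bsub>LS S\<^esub> C) = up S (A <#> B <#> C)"
proof -
  note sub = LS_subset[OF assms(1)] LS_subset[OF assms(2)] LS_subset[OF assms(3)]
  show "A \<otimes>\<^bsub>LS S\<^esub> B \<otimes>\<^bsub>LS S\<^esub> C = up S (A <#> B <#> C)"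
    using set_mult_up[OF set_mult_subset[OF sub(1,2)] sub(3)] LS_up[OF assms(3)] by (simp add: LS_mult)
  show "A \<otimes>\<^bsub>LS S\<^esub> (B \<otimes>\<^bsub>LS S\<^esub> C) = up S (A <#> B <#> C)"
    using set_mult_up[OF sub(1) set_mult_subset[OF sub(2,3)]] LS_up[OF assms(1)]
    by (simp add: LS_mult set_mult_assoc_semigroup sub)
qed

lemma set_sinv_closed:
  assumes A: "A \<in> carrier (LS S)"
  shows "set_sinv S A \<in> carrier (LS S)"
proof -
  have "directed S (set_sinv S A)"
    unfolding directed_def set_sinv_def
  proof (intro conjI ballI)
    show "sinv S ` A \<noteq> {}" using LS_nonempty[OF A] by blast
    fix x y assume "x \<in> sinv S ` A" "y \<in> sinv S ` A"
    then obtain a b where *: "a \<in> A" "b \<in> A" "x = sinv S a" "y = sinv S b" by blast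
    obtain c where "c \<in> A" "nat_le S c a" "nat_le S c b" using A *(1,2) by (rule LS_lower_bound)
    then show "\<exists>z \<in> sinv S ` A. nat_le S z x \<and> nat_le S z y" using * by (blast intro: nat_le_sinv)
  qed
  moreover have sub: "set_sinv S A \<subseteq> carrier S" using LS_subset[OF A] by (auto simp: set_sinv_def)
  ultimately have "up S (set_sinv S A) \<in> carrier (LS S)" by (simp add: LS_I)
  moreover have "up S (set_sinv S A) \<subseteq> set_sinv S A"
  proof
    fix x assume "x \<in> up S (set_sinv S A)"
    then obtain a where a: "a \<in> A" "nat_le S (sinv S a) x" by (auto elim!: upE simp: set_sinv_def)
    then have "nat_le S a (sinv S x)" using nat_le_sinv[OF a(2)] LS_elem[OF A a(1)] by simp
    then have "sinv S x \<in> A" using A a by (blast intro: LS_upward)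
    then show "x \<in> set_sinv S A" using nat_le_carrier(2)[OF a(2)]
      unfolding set_sinv_def by (metis imageI sinv_sinv)
  qed
  ultimately show ?thesis using subset_up[OF sub] by (metis subset_antisym)
qed

lemma set_sinv_set_sinv:
  assumes "A \<in> carrier (LS S)" shows "set_sinv S (set_sinv S A) = A"
proof -
  have "sinv S (sinv S a) = a" if "a \<in> A" for a using LS_elem[OF assms that] by simp
  then show ?thesis by (simp add: set_sinv_def image_image cong: image_cong)
qed

lemma set_sinvI: "a \<in> A \<Longrightarrow> sinv S a \<in> set_sinv S A"
  by (simp add: set_sinv_def)

text \<open>Together with the same statement for \<open>A\<inverse>\<close> this makes \<open>A\<inverse>\<close> an inverse of \<open>A\<close> in \<open>L(S)\<close>.\<close>
lemma LS_regular:
  assumes A: "A \<in> carrier (LS S)"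
  shows "A \<otimes>\<^bsub>LS S\<^esub> set_sinv S A \<otimes>\<^bsub>LS S\<^esub> A = A"
proof -
  let ?P = "A <#> set_sinv S A <#> A"
  have "A \<subseteq> ?P"
  proof
    fix a assume a: "a \<in> A"
    then have "a \<otimes> sinv S a \<otimes> a \<in> ?P" by (intro set_multI set_sinvI)
    then show "a \<in> ?P" using LS_elem[OF A a] by (simp add: mult_sinv_mult)
  qed
  moreover have P: "?P \<subseteq> carrier S"
    using A set_sinv_closed[OF A] by (simp add: LS_subset set_mult_subset)
  moreover have "?P \<subseteq> up S A"
  proof
    fix x assume "x \<in> ?P"
    then obtain a b c where abc: "a \<in> A" "b \<in> A" "c \<in> A" "x = a \<otimes> sinv S b \<otimes> c"
      by (auto elim!: set_multE simp: set_sinv_def)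
    obtain p where p: "p \<in> A" "nat_le S p a" "nat_le S p b" using A abc(1,2) by (rule LS_lower_bound)
    obtain d where d: "d \<in> A" "nat_le S d p" "nat_le S d c" using A p(1) abc(3) by (rule LS_lower_bound)
    \<comment> \<open>directedness: a common lower bound \<open>d = d d\<inverse> d\<close> of the three factors bounds the product\<close>
    have "nat_le S (d \<otimes> sinv S d \<otimes> d) x"
      unfolding abc(4) using p d by (intro nat_le_mult nat_le_sinv) (blast intro: nat_le_trans)+
    then show "x \<in> up S A" using d LS_elem[OF A d(1)] by (simp add: mult_sinv_mult upI)
  qed
  ultimately have "up S ?P = up S A" by (intro up_eqI) (use subset_up in blast)+
  then show ?thesis using A by (simp add: LS_mult3 set_sinv_closed LS_up)
qed

text \<open>An element \<open>a\<close> of an idempotent \<open>E\<close> of \<open>L(S)\<close> has a lower bound in common with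
  \<open>a a \<in> E \<otimes> E = E\<close>, and such a lower bound is idempotent.\<close>

lemma LS_idem_cofinal:
  assumes E: "E \<in> idems (LS S)" and a: "a \<in> E"
  obtains p where "p \<in> E" "p \<in> idems S" "nat_le S p a"
proof -
  have E': "E \<in> carrier (LS S)" "E \<otimes>\<^bsub>LS S\<^esub> E = E" using E by (auto simp: idems_def)
  have "a \<otimes> a \<in> E" using LS_multI[OF E'(1,1) a a] E'(2) by simp
  then obtain p where "p \<in> E" "nat_le S p a" "nat_le S p (a \<otimes> a)" using E' a by (metis LS_lower_bound)
  then show ?thesis using that idem_if_below_square by blast
qed

text \<open>Idempotents of \<open>L(S)\<close> are generated as up-closed sets by the idempotents of \<open>S\<close> that they
  contain, and those commute.\<close>
lemma LS_idem_commute: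
  assumes E: "E \<in> idems (LS S)" and F: "F \<in> idems (LS S)"
  shows "E \<otimes>\<^bsub>LS S\<^esub> F = F \<otimes>\<^bsub>LS S\<^esub> E"
proof -
  have "E \<otimes>\<^bsub>LS S\<^esub> F \<subseteq> F \<otimes>\<^bsub>LS S\<^esub> E" if E: "E \<in> idems (LS S)" and F: "F \<in> idems (LS S)" for E F
  proof
    have carr: "E \<in> carrier (LS S)" "F \<in> carrier (LS S)" using E F by (auto simp: idems_def)
    fix x assume "x \<in> E \<otimes>\<^bsub>LS S\<^esub> F"
    then obtain a b where ab: "a \<in> E" "b \<in> F" "nat_le S (a \<otimes> b) x" by (rule LS_multE)
    obtain p where p: "p \<in> E" "p \<in> idems S" "nat_le S p a" using E ab(1) by (rule LS_idem_cofinal)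
    obtain q where q: "q \<in> F" "q \<in> idems S" "nat_le S q b" using F ab(2) by (rule LS_idem_cofinal)
    have "nat_le S (q \<otimes> p) x"
      using nat_le_trans[OF nat_le_mult[OF p(3) q(3)] ab(3)] p q by (simp add: idem_commute)
    then show "x \<in> F \<otimes>\<^bsub>LS S\<^esub> E"
      unfolding LS_mult using p q by (blast intro: upI set_multI)
  qed
  then show ?thesis using E F by blast
qed

lemma inverse_semigroup_LS: "inverse_semigroup (LS S)"
proof (rule inverse_semigroupI)
  fix A assume A: "A \<in> carrier (LS S)"
  show "\<exists>B\<in>carrier (LS S). A \<otimes>\<^bsub>LS S\<^esub> B \<otimes>\<^bsub>LS S\<^esub> A = A \<and> B \<otimes>\<^bsub>LS S\<^esub> A \<otimes>\<^bsub>LS S\<^esub> B = B"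
    using LS_regular[OF A] LS_regular[OF set_sinv_closed[OF A]] A
    by (intro bexI[of _ "set_sinv S A"]) (simp_all add: set_sinv_closed set_sinv_set_sinv)
qed (simp_all add: LS_closed LS_mult3 LS_idem_commute)

lemma sinv_LS: "A \<in> carrier (LS S) \<Longrightarrow> sinv (LS S) A = set_sinv S A"
  using LS_regular[of A] LS_regular[OF set_sinv_closed[of A]]
  by (intro inverse_semigroup.sinv_unique inverse_semigroup_LS)
    (simp_all add: set_sinv_closed set_sinv_set_sinv)

subsection \<open>The embedding of the semigroup\<close>

lemma iota_closed [simp]: "s \<in> carrier S \<Longrightarrow> iota S s \<in> carrier (LS S)"
  unfolding iota_def by (rule LS_I) (auto simp: directed_def)

lemma iota_mult_LS:
  assumes "s \<in> carrier S" "A \<in> carrier (LS S)"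
  shows "iota S s \<otimes>\<^bsub>LS S\<^esub> A = up S ({s} <#> A)"
  using set_mult_up[of "{s}" A] assms by (simp add: LS_mult iota_def LS_up LS_subset)

lemma iota_mult:
  assumes "s \<in> carrier S" "t \<in> carrier S"
  shows "iota S (s \<otimes> t) = iota S s \<otimes>\<^bsub>LS S\<^esub> iota S t"
  using set_mult_up[of "{s}" "{t}"] assms by (simp add: LS_mult iota_def set_mult_def)

lemma iota_sinv: 
  assumes "s \<in> carrier S"
  shows "sinv (LS S) (iota S s) = iota S (sinv S s)"
  by (rule inverse_semigroup.sinv_unique[OF inverse_semigroup_LS])
    (use assms in \<open>simp_all add: iota_mult[symmetric] mult_sinv_mult sinv_mult_sinv\<close>)

text \<open>The natural order of \<open>L(S)\<close> is reverse inclusion. For idempotents, \<open>\<iota>(s) \<otimes> F = F\<close> expresses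
  \<open>F \<le> \<iota>(s)\<close>, that is, that \<open>F\<close> contains the up-closure of \<open>s\<close>.\<close>

lemma iota_mult_idem_iff:
  assumes s: "s \<in> idems S" and F: "F \<in> idems (LS S)"
  shows "iota S s \<otimes>\<^bsub>LS S\<^esub> F = F \<longleftrightarrow> s \<in> F"
proof -
  have F': "F \<in> carrier (LS S)" "F \<otimes>\<^bsub>LS S\<^esub> F = F" using F by (auto simp: idems_def)
  show ?thesis
  proof
    assume eq: "iota S s \<otimes>\<^bsub>LS S\<^esub> F = F"
    obtain a where "a \<in> F" using LS_nonempty[OF F'(1)] by blast
    then obtain p where p: "p \<in> F" "p \<in> idems S" using LS_idem_cofinal[OF F] by blast
    have "s \<in> iota S s" using s unfolding iota_def by (auto intro: upI)
    then have "s \<otimes> p \<in> F" using LS_multI[of "iota S s" F s p] eq F' p s by simp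
    moreover have "nat_le S (s \<otimes> p) s" using s p by (simp add: nat_leI_right)
    ultimately show "s \<in> F" using F' by (blast intro: LS_upward)
  next
    assume sF: "s \<in> F"
    have "up S ({s} <#> F) = up S F"
    proof (rule up_eqI)
      show "{s} <#> F \<subseteq> up S F"
        using LS_multI[OF F'(1,1) sF] F' by (auto elim!: set_multE simp: LS_up)
      show "F \<subseteq> up S ({s} <#> F)"
      proof
        fix x assume "x \<in> F"
        then show "x \<in> up S ({s} <#> F)"
          using LS_elem[OF F'(1)] s nat_leI by (blast intro: upI set_multI)
      qed
    qed
    then show "iota S s \<otimes>\<^bsub>LS S\<^esub> F = F" using s F' by (simp add: iota_mult_LS LS_up)
  qed
qed

lemma LS_idem_mult_subset:
  assumes F: "F \<in> idems (LS S)" and G: "G \<in> idems (LS S)" and sub: "F \<subseteq> G"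
  shows "G \<otimes>\<^bsub>LS S\<^esub> F = G"
proof -
  have carr: "F \<in> carrier (LS S)" "G \<in> carrier (LS S)" "G \<otimes>\<^bsub>LS S\<^esub> G = G"
    using F G by (auto simp: idems_def)
  have "G <#> F \<subseteq> up S G"
    using LS_multI[OF carr(2,2)] carr sub by (auto elim!: set_multE simp: LS_up)
  moreover have "G \<subseteq> up S (G <#> F)"
  proof
    fix x assume x: "x \<in> G"
    obtain a where "a \<in> F" using LS_nonempty[OF carr(1)] by blast
    then obtain p where p: "p \<in> F" "p \<in> idems S" using LS_idem_cofinal[OF F] by blast
    then show "x \<in> up S (G <#> F)"
      using x LS_elem[OF carr(2)] nat_leI_right by (blast intro: upI set_multI)
  qed
  ultimately show ?thesis using carr by (simp add: LS_mult LS_up up_eqI[of "G <#> F" G])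
qed

text \<open>The translation by the single element \<open>b a\<inverse>\<close> of \<open>S\<close> already moves \<open>A\<close> to \<open>B\<close>: this is
  how the action of \<open>S\<close> inherits transitivity from that of \<open>L(S)\<close>.\<close>

lemma iota_transport:
  assumes A: "A \<in> carrier (LS S)" and B: "B \<in> carrier (LS S)"
    and eq: "set_sinv S A \<otimes>\<^bsub>LS S\<^esub> A = set_sinv S B \<otimes>\<^bsub>LS S\<^esub> B"
    and a: "a \<in> A" and b: "b \<in> B"
  shows "iota S (b \<otimes> sinv S a) \<otimes>\<^bsub>LS S\<^esub> A = B"
proof -
  have ac: "a \<in> carrier S" and bc: "b \<in> carrier S" using LS_elem A B a b by auto
  note A' = set_sinv_closed[OF A] and B' = set_sinv_closed[OF B]
  have "{b \<otimes> sinv S a} <#> A \<subseteq> up S B"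
  proof
    fix x assume "x \<in> {b \<otimes> sinv S a} <#> A"
    then obtain c where c: "c \<in> A" "x = b \<otimes> sinv S a \<otimes> c" by (auto elim: set_multE)
    have "sinv S a \<otimes> c \<in> set_sinv S B \<otimes>\<^bsub>LS S\<^esub> B"
      using LS_multI[OF A' A set_sinvI[OF a] c(1)] eq by simp
    then have "b \<otimes> (sinv S a \<otimes> c) \<in> B \<otimes>\<^bsub>LS S\<^esub> (set_sinv S B \<otimes>\<^bsub>LS S\<^esub> B)"
      by (rule LS_multI[OF B LS_closed[OF B' B] b])
    moreover have "B \<otimes>\<^bsub>LS S\<^esub> (set_sinv S B \<otimes>\<^bsub>LS S\<^esub> B) = B"
      using LS_regular[OF B] by (simp add: LS_mult3 B B')
    ultimately show "x \<in> up S B" using c ac bc LS_elem[OF A] B by (simp add: LS_up assoc)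
  qed
  moreover have "B \<subseteq> up S ({b \<otimes> sinv S a} <#> A)"
  proof
    fix x assume x: "x \<in> B"
    have xc: "x \<in> carrier S" using LS_elem B x by auto
    have "sinv S b \<otimes> x \<in> set_sinv S A \<otimes>\<^bsub>LS S\<^esub> A"
      using LS_multI[OF B' B set_sinvI[OF b] x] eq by simp
    then obtain p q where pq: "p \<in> A" "q \<in> A" "nat_le S (sinv S p \<otimes> q) (sinv S b \<otimes> x)"
      by (auto elim!: LS_multE simp: set_sinv_def)
    obtain r where r: "r \<in> A" "nat_le S r p" "nat_le S r q" using A pq(1,2) by (rule LS_lower_bound)
    obtain d where d: "d \<in> A" "nat_le S d r" "nat_le S d a" using A r(1) a by (rule LS_lower_bound)
    have dc: "d \<in> carrier S" using LS_elem A d by auto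
    have dp: "nat_le S d p" "nat_le S d q" using r d by (blast intro: nat_le_trans)+
    have 1: "nat_le S (sinv S d \<otimes> d) (sinv S b \<otimes> x)"
      using nat_le_trans[OF nat_le_mult[OF nat_le_sinv[OF dp(1)] dp(2)] pq(3)] .
    \<comment> \<open>as \<open>d \<le> a\<close>, the elements \<open>a\<inverse> d\<close> and \<open>d\<inverse> d\<close> coincide, so \<open>b a\<inverse> d \<le> b b\<inverse> x \<le> x\<close>\<close>
    obtain k where k: "k \<in> idems S" "d = a \<otimes> k" using d(3) by (rule nat_leE_right)
    have "sinv S d \<otimes> d = k \<otimes> (sinv S a \<otimes> d)" using k ac dc by (simp add: sinv_mult assoc)
    also have "\<dots> = k \<otimes> (sinv S a \<otimes> a) \<otimes> k" using k ac by (simp add: assoc)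
    also have "\<dots> = (sinv S a \<otimes> a) \<otimes> k \<otimes> k" using idem_commute[OF k(1) sinv_mult_idem[OF ac]] by simp
    also have "\<dots> = sinv S a \<otimes> d" using k ac by (simp add: assoc)
    finally have "nat_le S (sinv S a \<otimes> d) (sinv S b \<otimes> x)" using 1 by simp
    then have "nat_le S (b \<otimes> (sinv S a \<otimes> d)) (b \<otimes> (sinv S b \<otimes> x))"
      using bc by (intro nat_le_mult[OF nat_le_refl]) auto
    moreover have "nat_le S (b \<otimes> sinv S b \<otimes> x) x" using bc xc by (intro nat_leI) auto
    ultimately have "nat_le S (b \<otimes> sinv S a \<otimes> d) x"
      using ac bc dc xc nat_le_trans[of "b \<otimes> (sinv S a \<otimes> d)" "b \<otimes> (sinv S b \<otimes> x)" x] by (simp add: assoc)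
    then show "x \<in> up S ({b \<otimes> sinv S a} <#> A)" using d(1) by (blast intro: upI set_multI)
  qed
  ultimately have "up S ({b \<otimes> sinv S a} <#> A) = B" using up_eqI LS_up[OF B] by metis
  then show ?thesis using A ac bc by (simp add: iota_mult_LS)
qed

text \<open>Going down in \<open>F\<close> to a common lower bound with an element outside \<open>G\<close> leaves \<open>G\<close>, and no \<open>G\<close> that has
  been left is entered again because \<open>G\<close> is up-closed. After finitely many steps every \<open>G\<close> has been left.\<close>
lemma separating_idem:
  assumes "finite X" and F: "F \<in> idems (LS S)"
    and X: "\<And>G. G \<in> X \<Longrightarrow> G \<in> carrier (LS S) \<and> \<not> F \<subseteq> G"
  shows "\<exists>p \<in> F \<inter> idems S. \<forall>G \<in> X. p \<notin> G"
  using assms(1) X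
proof (induction X)
  case empty
  have "F \<in> carrier (LS S)" using F by (simp add: idems_def)
  then show ?case using LS_nonempty LS_idem_cofinal[OF F] by blast
next
  case (insert G X)
  have F': "F \<in> carrier (LS S)" using F by (simp add: idems_def)
  have "\<exists>p \<in> F \<inter> idems S. \<forall>G \<in> X. p \<notin> G" using insert.prems by (intro insert.IH) simp
  then obtain p where p: "p \<in> F" "p \<in> idems S" "\<forall>G \<in> X. p \<notin> G" by blast
  obtain x where x: "x \<in> F" "x \<notin> G" using insert.prems by blast
  obtain q where q: "q \<in> F" "nat_le S q p" "nat_le S q x" using F' p(1) x(1) by (rule LS_lower_bound)
  have up: "q \<notin> H" if "H \<in> insert G X" "nat_le S q y" "y \<notin> H" for H y
    using that insert.prems[OF that(1)] LS_upward[of H q y] by blast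
  have "\<forall>H \<in> insert G X. q \<notin> H"
    using up[of G x] up[of _ p] q x p by blast
  moreover have "q \<in> idems S" using q(2) p(2) by (rule nat_le_idem)
  ultimately show ?case using q(1) by blast
qed

end

section \<open>Linear and bilinear extension\<close>

lemma lookup_pm_scale [simp]: "Poly_Mapping.lookup (pm_scale c f) a = c * Poly_Mapping.lookup f a"
  by (simp add: pm_scale_def Poly_Mapping.map.rep_eq when_def)

lemma keys_pm_scale: "Poly_Mapping.keys (pm_scale c f) \<subseteq> Poly_Mapping.keys f"
  by (auto simp: in_keys_iff)

lemma pm_scale_simps [simp]:
  "pm_scale c 0 = 0" "pm_scale 0 f = 0" "pm_scale 1 f = f"
  "pm_scale c (Poly_Mapping.single a d) = Poly_Mapping.single a (c * d)"
  "pm_scale c (pm_scale d f) = pm_scale (c * d) f"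
  by (auto intro!: poly_mapping_eqI simp: lookup_single when_def)

lemma pm_scale_add: "pm_scale c (f + g) = pm_scale c f + pm_scale c g"
  by (auto intro!: poly_mapping_eqI simp: lookup_add algebra_simps)

lemma pm_scale_add_left: "pm_scale (c + d) f = pm_scale c f + pm_scale d f"
  by (auto intro!: poly_mapping_eqI simp: lookup_add algebra_simps)

lemma poly_mapping_sum_single:
  fixes f :: "'a \<Rightarrow>\<^sub>0 'k::field"
  shows "(\<Sum>a\<in>Poly_Mapping.keys f. Poly_Mapping.single a (Poly_Mapping.lookup f a)) = f"
  by (rule poly_mapping_eqI) (auto simp: lookup_sum lookup_single when_def in_keys_iff)

text \<open>Additive identities on the span of \<open>A\<close> need only be checked on multiples of basis vectors.\<close>
lemma poly_mapping_supported_induct [consumes 1, case_names zero single add]: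
  fixes f :: "'a \<Rightarrow>\<^sub>0 'k::field"
  assumes "Poly_Mapping.keys f \<subseteq> A" and zero: "P 0"
    and single: "\<And>a c. a \<in> A \<Longrightarrow> P (Poly_Mapping.single a c)"
    and add: "\<And>f g. \<lbrakk>Poly_Mapping.keys f \<subseteq> A; Poly_Mapping.keys g \<subseteq> A; P f; P g\<rbrakk> \<Longrightarrow> P (f + g)"
  shows "P f"
proof -
  have "P (\<Sum>a\<in>I. Poly_Mapping.single a (Poly_Mapping.lookup f a))
    \<and> Poly_Mapping.keys (\<Sum>a\<in>I. Poly_Mapping.single a (Poly_Mapping.lookup f a)) \<subseteq> A"
    if "finite I" "I \<subseteq> A" for I
    using that
  proof (induction I)
    case empty then show ?case by (simp add: zero)
  next
    case (insert i I)
    let ?s = "Poly_Mapping.single i (Poly_Mapping.lookup f i)"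
    let ?t = "\<Sum>a\<in>I. Poly_Mapping.single a (Poly_Mapping.lookup f a)"
    have t: "P ?t" "Poly_Mapping.keys ?t \<subseteq> A" using insert by auto
    have s: "P ?s" "Poly_Mapping.keys ?s \<subseteq> A" using insert single by auto
    have "P (?s + ?t)" using s t by (intro add)
    moreover have "Poly_Mapping.keys (?s + ?t) \<subseteq> A" using s(2) t(2) keys_add[of ?s ?t] by blast
    ultimately show ?case using insert by simp
  qed
  from this[OF finite_keys assms(1)] show ?thesis by (simp add: poly_mapping_sum_single)
qed

lemma bilinear_ext_superset:
  assumes "finite X" "Poly_Mapping.keys f \<subseteq> X" "finite Y" "Poly_Mapping.keys g \<subseteq> Y"
  shows "bilinear_ext p f g =
    (\<Sum>a\<in>X. \<Sum>b\<in>Y. pm_scale (Poly_Mapping.lookup f a * Poly_Mapping.lookup g b) (p a b))"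
proof -
  have "bilinear_ext p f g = (\<Sum>a\<in>Poly_Mapping.keys f. \<Sum>b\<in>Y.
      pm_scale (Poly_Mapping.lookup f a * Poly_Mapping.lookup g b) (p a b))"
    unfolding bilinear_ext_def using assms
    by (intro sum.cong refl sum.mono_neutral_left) (auto simp: in_keys_iff)
  also have "\<dots> = (\<Sum>a\<in>X. \<Sum>b\<in>Y. pm_scale (Poly_Mapping.lookup f a * Poly_Mapping.lookup g b) (p a b))"
    using assms by (intro sum.mono_neutral_left) (auto simp: in_keys_iff intro!: sum.neutral)
  finally show ?thesis .
qed

lemma bilinear_ext_zero [simp]: "bilinear_ext p 0 g = 0" "bilinear_ext p f 0 = 0"
  by (simp_all add: bilinear_ext_def)

lemma bilinear_ext_add_left: "bilinear_ext p (f + f') g = bilinear_ext p f g + bilinear_ext p f' g"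
proof -
  let ?X = "Poly_Mapping.keys f \<union> Poly_Mapping.keys f'" and ?Y = "Poly_Mapping.keys g"
  show ?thesis
    using bilinear_ext_superset[of ?X "f + f'" ?Y g p] bilinear_ext_superset[of ?X f ?Y g p]
      bilinear_ext_superset[of ?X f' ?Y g p] keys_add[of f f']
    by (simp add: sum.distrib lookup_add distrib_right pm_scale_add_left)
qed

lemma bilinear_ext_add_right: "bilinear_ext p f (g + g') = bilinear_ext p f g + bilinear_ext p f g'"
proof -
  let ?Y = "Poly_Mapping.keys g \<union> Poly_Mapping.keys g'" and ?X = "Poly_Mapping.keys f"
  show ?thesis
    using bilinear_ext_superset[of ?X f ?Y "g + g'" p] bilinear_ext_superset[of ?X f ?Y g p]
      bilinear_ext_superset[of ?X f ?Y g' p] keys_add[of g g']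
    by (simp add: sum.distrib lookup_add distrib_left pm_scale_add_left)
qed

lemma bilinear_ext_single [simp]:
  "bilinear_ext p (Poly_Mapping.single a c) (Poly_Mapping.single b d) = pm_scale (c * d) (p a b)"
  using bilinear_ext_superset[of "{a}" "Poly_Mapping.single a c" "{b}" "Poly_Mapping.single b d" p]
  by simp

lemma keys_bilinear_ext:
  assumes "\<And>a b. a \<in> Poly_Mapping.keys f \<Longrightarrow> b \<in> Poly_Mapping.keys g \<Longrightarrow> Poly_Mapping.keys (p a b) \<subseteq> K"
  shows "Poly_Mapping.keys (bilinear_ext p f g) \<subseteq> K"
proof -
  have "Poly_Mapping.keys (pm_scale (Poly_Mapping.lookup f a * Poly_Mapping.lookup g b) (p a b)) \<subseteq> K"
    if "a \<in> Poly_Mapping.keys f" "b \<in> Poly_Mapping.keys g" for a b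
    by (rule order_trans[OF keys_pm_scale assms[OF that]])
  note * = this
  show ?thesis unfolding bilinear_ext_def
    by (rule order_trans[OF keys_sum], rule UN_least, rule order_trans[OF keys_sum], rule UN_least, rule *)
qed

lemma bilinear_ext_pm_scale:
  "bilinear_ext p f (pm_scale c g) = pm_scale c (bilinear_ext p f g)"
proof -
  have f: "Poly_Mapping.keys f \<subseteq> UNIV" and g: "Poly_Mapping.keys g \<subseteq> UNIV" by auto
  from f show ?thesis
  proof (induction f rule: poly_mapping_supported_induct)
    case (single a d)
    from g show ?case
    proof (induction g rule: poly_mapping_supported_induct)
      case (single b r) then show ?case by (simp add: mult.left_commute)
    qed (simp_all add: bilinear_ext_add_right pm_scale_add)
  qed (simp_all add: bilinear_ext_add_left pm_scale_add)
qed

lemma bilinear_ext_pm_scale_left: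
  "bilinear_ext p (pm_scale c f) g = pm_scale c (bilinear_ext p f g)"
proof -
  have f: "Poly_Mapping.keys f \<subseteq> UNIV" and g: "Poly_Mapping.keys g \<subseteq> UNIV" by auto
  from f show ?thesis
  proof (induction f rule: poly_mapping_supported_induct)
    case (single a d)
    from g show ?case
    proof (induction g rule: poly_mapping_supported_induct)
      case (single b r) then show ?case by (simp add: mult.assoc)
    qed (simp_all add: bilinear_ext_add_right pm_scale_add)
  qed (simp_all add: bilinear_ext_add_left pm_scale_add)
qed

text \<open>Both sides are trilinear, so associativity is inherited from the basis. Four independent
  operations appear because the lemma is applied to the product of an algebra, to a left action
  of an algebra, and to commuting left and right actions.\<close>

lemma bilinear_ext_assoc:
  assumes basis: "\<And>a b c. \<lbrakk>a \<in> A; b \<in> B; c \<in> C\<rbrakk> \<Longrightarrow>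
      bilinear_ext q (p a b) (Poly_Mapping.single c 1) = bilinear_ext s (Poly_Mapping.single a 1) (r b c)"
    and f: "Poly_Mapping.keys f \<subseteq> A" and g: "Poly_Mapping.keys g \<subseteq> B" and h: "Poly_Mapping.keys h \<subseteq> C"
  shows "bilinear_ext q (bilinear_ext p f g) h = bilinear_ext s f (bilinear_ext r g h)"
  using f
proof (induction f rule: poly_mapping_supported_induct)
  case (single a x)
  from g show ?case
  proof (induction g rule: poly_mapping_supported_induct)
    case (single b y)
    from h show ?case
    proof (induction h rule: poly_mapping_supported_induct)
      case (single c z)
      have "bilinear_ext q (pm_scale (x * y) (p a b)) (pm_scale z (Poly_Mapping.single c 1))
          = bilinear_ext s (pm_scale x (Poly_Mapping.single a 1)) (pm_scale (y * z) (r b c))"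
        unfolding bilinear_ext_pm_scale bilinear_ext_pm_scale_left
        using \<open>a \<in> A\<close> \<open>b \<in> B\<close> \<open>c \<in> C\<close> by (simp add: basis mult_ac)
      then show ?case by simp
    qed (simp_all add: bilinear_ext_add_right)
  qed (simp_all add: bilinear_ext_add_left bilinear_ext_add_right)
qed (simp_all add: bilinear_ext_add_left)

lemma linear_ext_superset:
  assumes "finite X" "Poly_Mapping.keys f \<subseteq> X"
  shows "linear_ext h f = (\<Sum>a\<in>X. Poly_Mapping.single (h a) (Poly_Mapping.lookup f a))"
  unfolding linear_ext_def using assms by (intro sum.mono_neutral_left) (auto simp: in_keys_iff)

lemma linear_ext_zero [simp]: "linear_ext h 0 = 0"
  by (simp add: linear_ext_def)

lemma linear_ext_add: "linear_ext h (f + g) = linear_ext h f + linear_ext h g"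
proof -
  let ?X = "Poly_Mapping.keys f \<union> Poly_Mapping.keys g"
  show ?thesis
    using linear_ext_superset[of ?X "f + g" h] linear_ext_superset[of ?X f h]
      linear_ext_superset[of ?X g h] keys_add[of f g]
    by (simp add: sum.distrib lookup_add single_add)
qed

lemma linear_ext_single [simp]:
  "linear_ext h (Poly_Mapping.single a c) = Poly_Mapping.single (h a) c"
  using linear_ext_superset[of "{a}" "Poly_Mapping.single a c" h] by simp

lemma keys_linear_ext: "Poly_Mapping.keys (linear_ext h f) \<subseteq> h ` Poly_Mapping.keys f"
  unfolding linear_ext_def by (rule order_trans[OF keys_sum]) auto

lemma linear_ext_mult:
  assumes h: "\<And>s t. \<lbrakk>s \<in> A; t \<in> B\<rbrakk> \<Longrightarrow> h (m s t) = m' (h s) (h t)"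
    and f: "Poly_Mapping.keys f \<subseteq> A" and g: "Poly_Mapping.keys g \<subseteq> B"
  shows "linear_ext h (bilinear_ext (\<lambda>s t. Poly_Mapping.single (m s t) 1) f g)
    = bilinear_ext (\<lambda>s t. Poly_Mapping.single (m' s t) 1) (linear_ext h f) (linear_ext h g)"
  using f
proof (induction f rule: poly_mapping_supported_induct)
  case (single a x)
  from g show ?case
  proof (induction g rule: poly_mapping_supported_induct)
    case (single b y)
    then show ?case using \<open>a \<in> A\<close> by (simp add: h)
  qed (simp_all add: bilinear_ext_add_right linear_ext_add)
qed (simp_all add: bilinear_ext_add_left linear_ext_add)

section \<open>Tensor products\<close>

locale balanced_modules = X: abelian_group X + N: abelian_group N
  for X :: "('r, 'x, 'w) module_scheme" and R :: "('r, 'y) ring_scheme"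
    and N :: "('r, 'm, 'z) module_scheme" +
  assumes X_smult_closed: "\<lbrakk>a \<in> carrier R; x \<in> carrier X\<rbrakk> \<Longrightarrow> a \<odot>\<^bsub>X\<^esub> x \<in> carrier X"
    and N_smult_closed: "\<lbrakk>a \<in> carrier R; n \<in> carrier N\<rbrakk> \<Longrightarrow> a \<odot>\<^bsub>N\<^esub> n \<in> carrier N"
begin

abbreviation "F \<equiv> tensor_free X N"
abbreviation "K \<equiv> tensor_ker X R N"
abbreviation "T \<equiv> tensor_group X R N"

definition tens :: "'x \<Rightarrow> 'm \<Rightarrow> ('x \<times> 'm \<Rightarrow>\<^sub>0 int) set" where
  "tens x n = K #>\<^bsub>F\<^esub> frag_of (x, n)"

sublocale F: comm_group F
  unfolding tensor_free_def by (rule abelian_free_Abelian_group)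

lemma F_simps [simp]:
  "c \<in> carrier F \<longleftrightarrow> Poly_Mapping.keys c \<subseteq> carrier X \<times> carrier N"
  "c \<otimes>\<^bsub>F\<^esub> d = c + d" "\<one>\<^bsub>F\<^esub> = 0"
  by (simp_all add: tensor_free_def)

lemma F_inv: "Poly_Mapping.keys c \<subseteq> carrier X \<times> carrier N \<Longrightarrow> inv\<^bsub>F\<^esub> c = - c"
  by (simp add: tensor_free_def)

lemma keys_diff_subset: "Poly_Mapping.keys (c :: 'b \<Rightarrow>\<^sub>0 int) \<subseteq> A \<Longrightarrow> Poly_Mapping.keys d \<subseteq> A \<Longrightarrow> Poly_Mapping.keys (c - d) \<subseteq> A"
  using keys_diff[of c d] by blast

lemma F_diff_closed: "c \<in> carrier F \<Longrightarrow> d \<in> carrier F \<Longrightarrow> c - d \<in> carrier F"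
  by (simp only: F_simps keys_diff_subset)

lemma frag_of_F [simp]: "x \<in> carrier X \<Longrightarrow> n \<in> carrier N \<Longrightarrow> frag_of (x, n) \<in> carrier F"
  by simp

lemma tensor_rels_subset: "tensor_rels X R N \<subseteq> carrier F"
  unfolding tensor_rels_def
  by (auto intro!: F_diff_closed frag_of_F simp: X_smult_closed N_smult_closed simp del: F_simps(1))

lemma K_subgroup: "subgroup K F"
  unfolding tensor_ker_def by (rule F.generate_is_subgroup[OF tensor_rels_subset])

lemma K_normal: "K \<lhd> F"
  by (rule F.subgroup_imp_normal[OF K_subgroup])

sublocale T: comm_group T
  unfolding tensor_group_def by (rule F.abelian_FactGroup[OF K_subgroup])

lemma carrier_T: "carrier T = (\<lambda>c. K #>\<^bsub>F\<^esub> c) ` carrier F"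
  by (simp add: tensor_group_def carrier_FactGroup)

lemma T_cases:
  assumes "C \<in> carrier T"
  obtains c where "c \<in> carrier F" "C = K #>\<^bsub>F\<^esub> c"
  using assms unfolding carrier_T by blast

lemma T_mult: "c \<in> carrier F \<Longrightarrow> d \<in> carrier F \<Longrightarrow> (K #>\<^bsub>F\<^esub> c) \<otimes>\<^bsub>T\<^esub> (K #>\<^bsub>F\<^esub> d) = K #>\<^bsub>F\<^esub> (c + d)"
  using normal.rcos_sum[OF K_normal, of c d] by (simp add: tensor_group_def)

lemma T_one: "\<one>\<^bsub>T\<^esub> = K"
  by (simp add: tensor_group_def)

lemma coset_eqI:
  assumes "c \<in> carrier F" "d \<in> carrier F" "c - d \<in> K"
  shows "K #>\<^bsub>F\<^esub> c = K #>\<^bsub>F\<^esub> d"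
proof -
  have "c \<in> K #>\<^bsub>F\<^esub> d"
    using subgroup.rcos_module_rev[OF K_subgroup, of d c] assms by (simp add: F_inv F.is_group)
  then show ?thesis using F.repr_independence[OF _ assms(2) K_subgroup] by metis
qed

lemma rels_in_K: "r \<in> tensor_rels X R N \<Longrightarrow> r \<in> K"
  unfolding tensor_ker_def by (rule generate.incl)

lemma tens_closed [simp]: "x \<in> carrier X \<Longrightarrow> n \<in> carrier N \<Longrightarrow> tens x n \<in> carrier T"
  unfolding tens_def carrier_T by (intro imageI frag_of_F)

lemma F_add_closed: "c \<in> carrier F \<Longrightarrow> d \<in> carrier F \<Longrightarrow> c + d \<in> carrier F"
  using F.m_closed[of c d] by simp

lemma tens_add_left:
  assumes "x \<in> carrier X" "y \<in> carrier X" "n \<in> carrier N"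
  shows "tens (x \<oplus>\<^bsub>X\<^esub> y) n = tens x n \<otimes>\<^bsub>T\<^esub> tens y n"
proof -
  have "frag_of (x \<oplus>\<^bsub>X\<^esub> y, n) - frag_of (x, n) - frag_of (y, n) \<in> K"
    by (rule rels_in_K) (use assms in \<open>unfold tensor_rels_def, blast\<close>)
  then have "frag_of (x \<oplus>\<^bsub>X\<^esub> y, n) - (frag_of (x, n) + frag_of (y, n)) \<in> K" by (simp add: diff_diff_eq)
  then show ?thesis
    unfolding tens_def T_mult[OF frag_of_F[OF assms(1,3)] frag_of_F[OF assms(2,3)]]
    by (intro coset_eqI F_add_closed frag_of_F) (use assms in auto)
qed

lemma tens_add_right:
  assumes "x \<in> carrier X" "n \<in> carrier N" "m \<in> carrier N"
  shows "tens x (n \<oplus>\<^bsub>N\<^esub> m) = tens x n \<otimes>\<^bsub>T\<^esub> tens x m"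
proof -
  have "frag_of (x, n \<oplus>\<^bsub>N\<^esub> m) - frag_of (x, n) - frag_of (x, m) \<in> K"
    by (rule rels_in_K) (use assms in \<open>unfold tensor_rels_def, blast\<close>)
  then have "frag_of (x, n \<oplus>\<^bsub>N\<^esub> m) - (frag_of (x, n) + frag_of (x, m)) \<in> K" by (simp add: diff_diff_eq)
  then show ?thesis
    unfolding tens_def T_mult[OF frag_of_F[OF assms(1,2)] frag_of_F[OF assms(1,3)]]
    by (intro coset_eqI F_add_closed frag_of_F) (use assms in auto)
qed

lemma tens_balanced:
  assumes "x \<in> carrier X" "a \<in> carrier R" "n \<in> carrier N"
  shows "tens (a \<odot>\<^bsub>X\<^esub> x) n = tens x (a \<odot>\<^bsub>N\<^esub> n)"
proof -
  have "frag_of (a \<odot>\<^bsub>X\<^esub> x, n) - frag_of (x, a \<odot>\<^bsub>N\<^esub> n) \<in> K"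
    by (rule rels_in_K) (use assms in \<open>unfold tensor_rels_def, blast\<close>)
  then show ?thesis
    unfolding tens_def using assms
    by (intro coset_eqI frag_of_F X_smult_closed N_smult_closed)
qed

lemma tens_zero_left:
  assumes "n \<in> carrier N" shows "tens \<zero>\<^bsub>X\<^esub> n = \<one>\<^bsub>T\<^esub>"
proof -
  have "tens \<zero>\<^bsub>X\<^esub> n \<otimes>\<^bsub>T\<^esub> tens \<zero>\<^bsub>X\<^esub> n = tens \<zero>\<^bsub>X\<^esub> n" using tens_add_left[of "\<zero>\<^bsub>X\<^esub>" "\<zero>\<^bsub>X\<^esub>" n] assms by simp
  then show ?thesis using assms T.l_cancel_one'[of "tens \<zero>\<^bsub>X\<^esub> n" "tens \<zero>\<^bsub>X\<^esub> n"] by simp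
qed

lemma tens_zero_right:
  assumes "x \<in> carrier X" shows "tens x \<zero>\<^bsub>N\<^esub> = \<one>\<^bsub>T\<^esub>"
proof -
  have "tens x \<zero>\<^bsub>N\<^esub> \<otimes>\<^bsub>T\<^esub> tens x \<zero>\<^bsub>N\<^esub> = tens x \<zero>\<^bsub>N\<^esub>" using tens_add_right[of x "\<zero>\<^bsub>N\<^esub>" "\<zero>\<^bsub>N\<^esub>"] assms by simp
  then show ?thesis using assms T.l_cancel_one'[of "tens x \<zero>\<^bsub>N\<^esub>" "tens x \<zero>\<^bsub>N\<^esub>"] by simp
qed

lemma tens_minus_right:
  assumes "x \<in> carrier X" "n \<in> carrier N"
  shows "tens x (\<ominus>\<^bsub>N\<^esub> n) = inv\<^bsub>T\<^esub> tens x n"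
proof -
  have "tens x (\<ominus>\<^bsub>N\<^esub> n) \<otimes>\<^bsub>T\<^esub> tens x n = \<one>\<^bsub>T\<^esub>"
    using tens_add_right[of x "\<ominus>\<^bsub>N\<^esub> n" n] assms by (simp add: N.l_neg tens_zero_right)
  then show ?thesis using assms by (simp add: T.inv_equality)
qed

text \<open>Inverses are covered by the generators, since \<open>- (x \<otimes> n) = x \<otimes> (- n)\<close>.\<close>
lemma tensor_induct [consumes 1, case_names tens mult]:
  assumes C: "C \<in> carrier T"
    and tens: "\<And>x n. \<lbrakk>x \<in> carrier X; n \<in> carrier N\<rbrakk> \<Longrightarrow> P (tens x n)"
    and mult: "\<And>C D. \<lbrakk>C \<in> carrier T; D \<in> carrier T; P C; P D\<rbrakk> \<Longrightarrow> P (C \<otimes>\<^bsub>T\<^esub> D)"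
  shows "P C"
proof -
  obtain c where c: "c \<in> carrier F" "C = K #>\<^bsub>F\<^esub> c" using C by (auto simp: carrier_T)
  have "P (K #>\<^bsub>F\<^esub> c) \<and> P (K #>\<^bsub>F\<^esub> (- c))"
    using c(1)[unfolded F_simps(1)]
  proof (induction c rule: free_Abelian_group_induct[consumes 1, case_names zero diff frag])
    case zero
    have "tens \<zero>\<^bsub>X\<^esub> \<zero>\<^bsub>N\<^esub> = K" using tens_zero_right[of "\<zero>\<^bsub>X\<^esub>"] by (simp add: T_one)
    then have "P K" using tens[of "\<zero>\<^bsub>X\<^esub>" "\<zero>\<^bsub>N\<^esub>"] by simp
    moreover have "K #>\<^bsub>F\<^esub> 0 = K"
      using F.coset_join2[OF _ K_subgroup, of 0] subgroup.one_closed[OF K_subgroup] by simp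
    ultimately show ?case by simp
  next
    case (diff c d)
    then have "P ((K #>\<^bsub>F\<^esub> c) \<otimes>\<^bsub>T\<^esub> (K #>\<^bsub>F\<^esub> (- d)))" "P ((K #>\<^bsub>F\<^esub> d) \<otimes>\<^bsub>T\<^esub> (K #>\<^bsub>F\<^esub> (- c)))"
      by (auto intro!: mult simp: carrier_T)
    then show ?case using diff by (simp add: T_mult)
  next
    case (frag p)
    then obtain x n where p: "p = (x, n)" "x \<in> carrier X" "n \<in> carrier N" by auto
    have "K #>\<^bsub>F\<^esub> (- frag_of p) = inv\<^bsub>T\<^esub> tens x n"
      using normal.inv_FactGroup[OF K_normal, of "tens x n"] normal.rcos_inv[OF K_normal, of "frag_of p"] p tens_closed[OF p(2,3)]
      by (simp add: tens_def tensor_group_def F_inv)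
    also have "\<dots> = tens x (\<ominus>\<^bsub>N\<^esub> n)" using p by (simp add: tens_minus_right)
    finally show ?case using p tens[of x n] tens[of x "\<ominus>\<^bsub>N\<^esub> n"] by (simp add: tens_def)
  qed
  then show ?thesis using c by simp
qed

text \<open>The universal property of the tensor product: a balanced map extends to the free abelian group
  and kills the defining relations there.\<close>

lemma tensor_lift:
  assumes H: "abelian_group H"
    and closed: "\<And>x n. \<lbrakk>x \<in> carrier X; n \<in> carrier N\<rbrakk> \<Longrightarrow> \<beta> x n \<in> carrier H"
    and left: "\<And>x y n. \<lbrakk>x \<in> carrier X; y \<in> carrier X; n \<in> carrier N\<rbrakk> \<Longrightarrow> \<beta> (x \<oplus>\<^bsub>X\<^esub> y) n = \<beta> x n \<oplus>\<^bsub>H\<^esub> \<beta> y n"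
    and right: "\<And>x n m. \<lbrakk>x \<in> carrier X; n \<in> carrier N; m \<in> carrier N\<rbrakk> \<Longrightarrow> \<beta> x (n \<oplus>\<^bsub>N\<^esub> m) = \<beta> x n \<oplus>\<^bsub>H\<^esub> \<beta> x m"
    and balanced: "\<And>x a n. \<lbrakk>x \<in> carrier X; a \<in> carrier R; n \<in> carrier N\<rbrakk> \<Longrightarrow> \<beta> (a \<odot>\<^bsub>X\<^esub> x) n = \<beta> x (a \<odot>\<^bsub>N\<^esub> n)"
  obtains \<theta> where "\<And>C. C \<in> carrier T \<Longrightarrow> \<theta> C \<in> carrier H"
    and "\<And>C D. \<lbrakk>C \<in> carrier T; D \<in> carrier T\<rbrakk> \<Longrightarrow> \<theta> (C \<otimes>\<^bsub>T\<^esub> D) = \<theta> C \<oplus>\<^bsub>H\<^esub> \<theta> D"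
    and "\<And>x n. \<lbrakk>x \<in> carrier X; n \<in> carrier N\<rbrakk> \<Longrightarrow> \<theta> (tens x n) = \<beta> x n"
proof -
  interpret H: abelian_group H by (fact H)
  obtain h where h: "h \<in> hom F (add_monoid H)"
    and h_frag: "\<And>p. p \<in> carrier X \<times> carrier N \<Longrightarrow> h (frag_of p) = (\<lambda>(x, n). \<beta> x n) p"
    unfolding tensor_free_def
    by (rule comm_group.free_Abelian_group_universal[OF H.a_comm_group, of "\<lambda>(x, n). \<beta> x n" "carrier X \<times> carrier N"])
      (auto simp: closed)
  interpret h: group_hom F "add_monoid H" h
    using h by (simp add: group_hom_def group_hom_axioms_def H.a_group F.is_group)
  have h_add: "h (c + d) = h c \<oplus>\<^bsub>H\<^esub> h d" if "c \<in> carrier F" "d \<in> carrier F" for c d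
    using h.hom_mult[of c d] that by simp
  have h_eq: "h (c - d) = \<zero>\<^bsub>H\<^esub>" if "c \<in> carrier F" "d \<in> carrier F" "h c = h d" for c d
  proof -
    have "c - d \<in> carrier F" using that by (simp add: keys_diff_subset)
    then have "h c = h (c - d) \<oplus>\<^bsub>H\<^esub> h d" using h_add[of "c - d" d] that by simp
    then show ?thesis using that h.hom_closed[of "c - d"] h.hom_closed[of d] \<open>c - d \<in> carrier F\<close>
      by (simp del: F_simps)
  qed
  have hb: "h (frag_of (x, n)) = \<beta> x n" if "x \<in> carrier X" "n \<in> carrier N" for x n
    using h_frag[of "(x, n)"] that by simp
  have "tensor_rels X R N \<subseteq> kernel F (add_monoid H) h"
  proof
    fix r assume r: "r \<in> tensor_rels X R N"
    then have rF: "r \<in> carrier F" using tensor_rels_subset by blast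
    have "h r = \<zero>\<^bsub>H\<^esub>"
      using r unfolding tensor_rels_def
    proof (elim UnE CollectE exE conjE)
      fix x y n assume *: "r = frag_of (x \<oplus>\<^bsub>X\<^esub> y, n) - frag_of (x, n) - frag_of (y, n)" "x \<in> carrier X" "y \<in> carrier X" "n \<in> carrier N"
      show ?thesis unfolding *(1) diff_diff_eq
        by (rule h_eq) (use * in \<open>auto simp: h_add hb left simp del: F_simps(1) intro!: F_add_closed\<close>)
    next
      fix x n m assume *: "r = frag_of (x, n \<oplus>\<^bsub>N\<^esub> m) - frag_of (x, n) - frag_of (x, m)" "x \<in> carrier X" "n \<in> carrier N" "m \<in> carrier N"
      show ?thesis unfolding *(1) diff_diff_eq
        by (rule h_eq) (use * in \<open>auto simp: h_add hb right simp del: F_simps(1) intro!: F_add_closed\<close>)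
    next
      fix x a n assume *: "r = frag_of (a \<odot>\<^bsub>X\<^esub> x, n) - frag_of (x, a \<odot>\<^bsub>N\<^esub> n)" "x \<in> carrier X" "a \<in> carrier R" "n \<in> carrier N"
      show ?thesis unfolding *(1)
        by (rule h_eq) (use * in \<open>auto simp: hb balanced X_smult_closed N_smult_closed simp del: F_simps(1)\<close>)
    qed
    then show "r \<in> kernel F (add_monoid H) h" using rF by (simp add: kernel_def)
  qed
  then have "K \<subseteq> kernel F (add_monoid H) h"
    unfolding tensor_ker_def by (intro F.generate_subgroup_incl h.subgroup_kernel)
  then obtain \<theta> where \<theta>: "\<theta> \<in> hom T (add_monoid H)" "\<And>c. c \<in> carrier F \<Longrightarrow> \<theta> (K #>\<^bsub>F\<^esub> c) = h c"
    unfolding tensor_group_def by (rule h.FactGroup_universal_kernel[OF K_normal]) blast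
  show ?thesis
  proof (rule that)
    show "\<theta> C \<in> carrier H" if "C \<in> carrier T" for C using hom_in_carrier[OF \<theta>(1) that] by simp
    show "\<theta> (C \<otimes>\<^bsub>T\<^esub> D) = \<theta> C \<oplus>\<^bsub>H\<^esub> \<theta> D" if "C \<in> carrier T" "D \<in> carrier T" for C D
      using hom_mult[OF \<theta>(1) that] by simp
    show "\<theta> (tens x n) = \<beta> x n" if "x \<in> carrier X" "n \<in> carrier N" for x n
      using \<theta>(2)[OF frag_of_F[OF that]] hb[OF that] by (simp add: tens_def)
  qed
qed

text \<open>An endomorphism of \<open>X\<close> maps defining relations to defining relations; this makes
  the induced map on cosets well defined.\<close>

lemma tensor_map_coset:
  assumes closed: "\<And>x. x \<in> carrier X \<Longrightarrow> \<phi> x \<in> carrier X"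
    and add: "\<And>x y. \<lbrakk>x \<in> carrier X; y \<in> carrier X\<rbrakk> \<Longrightarrow> \<phi> (x \<oplus>\<^bsub>X\<^esub> y) = \<phi> x \<oplus>\<^bsub>X\<^esub> \<phi> y"
    and smult: "\<And>a x. \<lbrakk>a \<in> carrier R; x \<in> carrier X\<rbrakk> \<Longrightarrow> \<phi> (a \<odot>\<^bsub>X\<^esub> x) = a \<odot>\<^bsub>X\<^esub> \<phi> x"
    and c: "c \<in> carrier F"
  shows "tensor_map X R N \<phi> (K #>\<^bsub>F\<^esub> c) = K #>\<^bsub>F\<^esub> frag_extend (\<lambda>(x, n). frag_of (\<phi> x, n)) c"
    and "frag_extend (\<lambda>(x, n). frag_of (\<phi> x, n)) c \<in> carrier F"
proof -
  define g :: "('x \<times> 'm \<Rightarrow>\<^sub>0 int) \<Rightarrow> ('x \<times> 'm \<Rightarrow>\<^sub>0 int)" where "g = frag_extend (\<lambda>(x, n). frag_of (\<phi> x, n))"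
  have g_simps: "g (frag_of (x, n)) = frag_of (\<phi> x, n)" "g (c - d) = g c - g d" "g (c + d) = g c + g d" "g (- c) = - g c" "g 0 = 0"
    for x n c d by (simp_all add: g_def frag_extend_diff frag_extend_add frag_extend_minus)
  have g_rels: "g r \<in> tensor_rels X R N" if "r \<in> tensor_rels X R N" for r
    using that unfolding tensor_rels_def
  proof (elim UnE CollectE exE conjE)
    fix x y n assume *: "r = frag_of (x \<oplus>\<^bsub>X\<^esub> y, n) - frag_of (x, n) - frag_of (y, n)" "x \<in> carrier X" "y \<in> carrier X" "n \<in> carrier N"
    then have "g r = frag_of (\<phi> x \<oplus>\<^bsub>X\<^esub> \<phi> y, n) - frag_of (\<phi> x, n) - frag_of (\<phi> y, n)"
      by (simp add: g_simps add)
    then show "g r \<in> {frag_of (x \<oplus>\<^bsub>X\<^esub> y, n) - frag_of (x, n) - frag_of (y, n) | x y n.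
        x \<in> carrier X \<and> y \<in> carrier X \<and> n \<in> carrier N}
      \<union> {frag_of (x, n \<oplus>\<^bsub>N\<^esub> m) - frag_of (x, n) - frag_of (x, m) | x n m.
        x \<in> carrier X \<and> n \<in> carrier N \<and> m \<in> carrier N}
      \<union> {frag_of (a \<odot>\<^bsub>X\<^esub> x, n) - frag_of (x, a \<odot>\<^bsub>N\<^esub> n) | x a n.
        x \<in> carrier X \<and> a \<in> carrier R \<and> n \<in> carrier N}" using * closed by blast
  next
    fix x n m assume *: "r = frag_of (x, n \<oplus>\<^bsub>N\<^esub> m) - frag_of (x, n) - frag_of (x, m)" "x \<in> carrier X" "n \<in> carrier N" "m \<in> carrier N"
    then have "g r = frag_of (\<phi> x, n \<oplus>\<^bsub>N\<^esub> m) - frag_of (\<phi> x, n) - frag_of (\<phi> x, m)"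
      by (simp add: g_simps)
    then show "g r \<in> {frag_of (x \<oplus>\<^bsub>X\<^esub> y, n) - frag_of (x, n) - frag_of (y, n) | x y n.
        x \<in> carrier X \<and> y \<in> carrier X \<and> n \<in> carrier N}
      \<union> {frag_of (x, n \<oplus>\<^bsub>N\<^esub> m) - frag_of (x, n) - frag_of (x, m) | x n m.
        x \<in> carrier X \<and> n \<in> carrier N \<and> m \<in> carrier N}
      \<union> {frag_of (a \<odot>\<^bsub>X\<^esub> x, n) - frag_of (x, a \<odot>\<^bsub>N\<^esub> n) | x a n.
        x \<in> carrier X \<and> a \<in> carrier R \<and> n \<in> carrier N}" using * closed by blast
  next
    fix x a n assume *: "r = frag_of (a \<odot>\<^bsub>X\<^esub> x, n) - frag_of (x, a \<odot>\<^bsub>N\<^esub> n)" "x \<in> carrier X" "a \<in> carrier R" "n \<in> carrier N"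
    then have "g r = frag_of (a \<odot>\<^bsub>X\<^esub> \<phi> x, n) - frag_of (\<phi> x, a \<odot>\<^bsub>N\<^esub> n)"
      by (simp add: g_simps smult)
    then show "g r \<in> {frag_of (x \<oplus>\<^bsub>X\<^esub> y, n) - frag_of (x, n) - frag_of (y, n) | x y n.
        x \<in> carrier X \<and> y \<in> carrier X \<and> n \<in> carrier N}
      \<union> {frag_of (x, n \<oplus>\<^bsub>N\<^esub> m) - frag_of (x, n) - frag_of (x, m) | x n m.
        x \<in> carrier X \<and> n \<in> carrier N \<and> m \<in> carrier N}
      \<union> {frag_of (a \<odot>\<^bsub>X\<^esub> x, n) - frag_of (x, a \<odot>\<^bsub>N\<^esub> n) | x a n.
        x \<in> carrier X \<and> a \<in> carrier R \<and> n \<in> carrier N}" using * closed by blast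
  qed
  have g_K: "g k \<in> K" if "k \<in> K" for k
    using that unfolding tensor_ker_def
  proof (induction k rule: generate.induct)
    case one show ?case using generate.one[of F] by (simp add: g_simps)
  next
    case (incl r) then show ?case by (intro generate.incl g_rels)
  next
    case (inv r)
    have "g (inv\<^bsub>F\<^esub> r) = inv\<^bsub>F\<^esub> (g r)"
    proof -
      have "Poly_Mapping.keys r \<subseteq> carrier X \<times> carrier N" "Poly_Mapping.keys (g r) \<subseteq> carrier X \<times> carrier N"
        using subsetD[OF tensor_rels_subset inv] subsetD[OF tensor_rels_subset g_rels[OF inv]]
        by (simp_all only: F_simps)
      then show ?thesis by (simp only: F_inv g_simps)
    qed
    then show ?case using generate.inv[OF g_rels[OF inv], of F] by simp
  next
    case (eng h k) then show ?case using generate.eng[OF eng.IH] by (simp add: g_simps)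
  qed
  have "g c \<in> carrier F" if "Poly_Mapping.keys c \<subseteq> carrier X \<times> carrier N" for c
    using that
  proof (induction c rule: free_Abelian_group_induct[consumes 1, case_names zero diff frag])
    case (frag p) then show ?case by (auto simp: g_simps closed)
  qed (simp_all add: g_simps keys_diff_subset)
  then show gc: "frag_extend (\<lambda>(x, n). frag_of (\<phi> x, n)) c \<in> carrier F"
    using c by (simp add: g_def del: F_simps(1)) (simp add: g_def)
  have K0: "0 \<in> K" using subgroup.one_closed[OF K_subgroup] by simp
  have Kadd: "k + l \<in> K" if "k \<in> K" "l \<in> K" for k l
    using subgroup.m_closed[OF K_subgroup that] by simp
  show "tensor_map X R N \<phi> (K #>\<^bsub>F\<^esub> c) = K #>\<^bsub>F\<^esub> frag_extend (\<lambda>(x, n). frag_of (\<phi> x, n)) c"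
    unfolding tensor_map_def g_def[symmetric]
  proof (intro equalityI subsetI)
    fix z assume "z \<in> K <#>\<^bsub>F\<^esub> g ` (K #>\<^bsub>F\<^esub> c)"
    then obtain k l where "k \<in> K" "l \<in> K" "z = k + g (l + c)" by (auto simp: set_mult_def r_coset_def)
    then have "k + g l \<in> K" "z = (k + g l) + g c" by (simp_all add: g_simps Kadd g_K add.assoc)
    then show "z \<in> K #>\<^bsub>F\<^esub> g c" by (auto simp: r_coset_def)
  next
    fix z assume "z \<in> K #>\<^bsub>F\<^esub> g c"
    then obtain k where "k \<in> K" "z = k + g (0 + c)" by (auto simp: r_coset_def)
    then show "z \<in> K <#>\<^bsub>F\<^esub> g ` (K #>\<^bsub>F\<^esub> c)" using K0 unfolding set_mult_def r_coset_def by fastforce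
  qed
qed

lemma tensor_map_hom:
  assumes closed: "\<And>x. x \<in> carrier X \<Longrightarrow> \<phi> x \<in> carrier X"
    and add: "\<And>x y. \<lbrakk>x \<in> carrier X; y \<in> carrier X\<rbrakk> \<Longrightarrow> \<phi> (x \<oplus>\<^bsub>X\<^esub> y) = \<phi> x \<oplus>\<^bsub>X\<^esub> \<phi> y"
    and smult: "\<And>a x. \<lbrakk>a \<in> carrier R; x \<in> carrier X\<rbrakk> \<Longrightarrow> \<phi> (a \<odot>\<^bsub>X\<^esub> x) = a \<odot>\<^bsub>X\<^esub> \<phi> x"
  shows tensor_map_tens: "\<And>x n. \<lbrakk>x \<in> carrier X; n \<in> carrier N\<rbrakk> \<Longrightarrow> tensor_map X R N \<phi> (tens x n) = tens (\<phi> x) n"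
    and tensor_map_closed: "\<And>C. C \<in> carrier T \<Longrightarrow> tensor_map X R N \<phi> C \<in> carrier T"
    and tensor_map_mult: "\<And>C D. \<lbrakk>C \<in> carrier T; D \<in> carrier T\<rbrakk> \<Longrightarrow>
      tensor_map X R N \<phi> (C \<otimes>\<^bsub>T\<^esub> D) = tensor_map X R N \<phi> C \<otimes>\<^bsub>T\<^esub> tensor_map X R N \<phi> D"
proof -
  let ?g = "frag_extend (\<lambda>(x, n). frag_of (\<phi> x, n))"
  have map: "tensor_map X R N \<phi> (K #>\<^bsub>F\<^esub> c) = K #>\<^bsub>F\<^esub> ?g c" and g: "?g c \<in> carrier F"
    if "c \<in> carrier F" for c
    by (rule tensor_map_coset; fact closed add smult that)+
  show "tensor_map X R N \<phi> (tens x n) = tens (\<phi> x) n" if "x \<in> carrier X" "n \<in> carrier N" for x n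
    using map[OF frag_of_F[OF that]] by (simp add: tens_def)
  show "tensor_map X R N \<phi> C \<in> carrier T" if "C \<in> carrier T" for C
  proof -
    obtain c where "c \<in> carrier F" "C = K #>\<^bsub>F\<^esub> c" using \<open>C \<in> carrier T\<close> by (rule T_cases)
    then show ?thesis unfolding carrier_T by (simp only: map g imageI)
  qed
  show "tensor_map X R N \<phi> (C \<otimes>\<^bsub>T\<^esub> D) = tensor_map X R N \<phi> C \<otimes>\<^bsub>T\<^esub> tensor_map X R N \<phi> D"
    if C: "C \<in> carrier T" and D: "D \<in> carrier T" for C D
  proof -
    obtain c where c: "c \<in> carrier F" "C = K #>\<^bsub>F\<^esub> c" using C by (rule T_cases)
    obtain d where d: "d \<in> carrier F" "D = K #>\<^bsub>F\<^esub> d" using D by (rule T_cases)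
    show ?thesis
      unfolding c(2) d(2) T_mult[OF c(1) d(1)] map[OF c(1)] map[OF d(1)] map[OF F_add_closed[OF c(1) d(1)]]
        T_mult[OF g[OF c(1)] g[OF d(1)]] frag_extend_add ..
  qed
qed

end

section \<open>Semigroup algebras and their modules\<close>

lemma abelian_group_poly_mapping:
  fixes M (structure)
  assumes "carrier M = {f :: 'a \<Rightarrow>\<^sub>0 'k::field. Poly_Mapping.keys f \<subseteq> B}" "\<zero> = 0" "ring.add M = (+)"
  shows "abelian_group M"
proof (rule abelian_groupI)
  fix x y assume "x \<in> carrier M" "y \<in> carrier M"
  then show "x \<oplus> y \<in> carrier M" using keys_add[of x y] by (auto simp: assms)
next
  fix x assume "x \<in> carrier M"
  then show "\<exists>y\<in>carrier M. y \<oplus> x = \<zero>"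
    by (intro bexI[of _ "- x"]) (auto simp: assms in_keys_iff)
qed (simp_all add: assms add.assoc add.commute)

lemma semigroup_algebra_simps [simp]:
  "f \<in> carrier (semigroup_algebra T) \<longleftrightarrow> Poly_Mapping.keys f \<subseteq> carrier T"
  "f \<oplus>\<^bsub>semigroup_algebra T\<^esub> g = f + g" "\<zero>\<^bsub>semigroup_algebra T\<^esub> = 0"
  "f \<otimes>\<^bsub>semigroup_algebra T\<^esub> g = bilinear_ext (\<lambda>s t. Poly_Mapping.single (s \<otimes>\<^bsub>T\<^esub> t) 1) f g"
  by (simp_all add: semigroup_algebra_def)

lemma (in inverse_semigroup) nonunital_ring_semigroup_algebra:
  "nonunital_ring (semigroup_algebra S :: ('a \<Rightarrow>\<^sub>0 'k::field) ring)"
proof (intro nonunital_ring.intro nonunital_ring_axioms.intro)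
  show "abelian_group (semigroup_algebra S :: ('a \<Rightarrow>\<^sub>0 'k) ring)"
    by (rule abelian_group_poly_mapping[of _ "carrier S"]) (auto simp: semigroup_algebra_def)
next
  fix f g h :: "'a \<Rightarrow>\<^sub>0 'k"
  assume f: "f \<in> carrier (semigroup_algebra S)" and g: "g \<in> carrier (semigroup_algebra S)"
  show "f \<otimes>\<^bsub>semigroup_algebra S\<^esub> g \<in> carrier (semigroup_algebra S)"
    unfolding semigroup_algebra_simps
    by (rule keys_bilinear_ext) (use f g in \<open>auto intro!: closed\<close>)
  assume h: "h \<in> carrier (semigroup_algebra S)"
  show "f \<otimes>\<^bsub>semigroup_algebra S\<^esub> g \<otimes>\<^bsub>semigroup_algebra S\<^esub> h
      = f \<otimes>\<^bsub>semigroup_algebra S\<^esub> (g \<otimes>\<^bsub>semigroup_algebra S\<^esub> h)"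
    using f g h by (simp add: bilinear_ext_assoc[where A = "carrier S" and B = "carrier S" and C = "carrier S"] assoc)
qed (simp_all add: bilinear_ext_add_left bilinear_ext_add_right)

section \<open>The induced module\<close>

locale induced_module = inverse_semigroup S
  + N: unitary_left_module "semigroup_algebra (max_subgroup S e)" N
  for S :: "('s, 'z) monoid_scheme" (structure) and e :: "'s set"
    and N :: "('s set \<Rightarrow>\<^sub>0 'k::field, 'n) module" +
  assumes e_idem: "e \<in> idems (LS S)"
begin

sublocale LS: inverse_semigroup "LS S"
  by (rule inverse_semigroup_LS)

abbreviation "X \<equiv> kL S e :: ('s set \<Rightarrow>\<^sub>0 'k, 's set \<Rightarrow>\<^sub>0 'k) module"
abbreviation "G \<equiv> semigroup_algebra (max_subgroup S e) :: ('s set \<Rightarrow>\<^sub>0 'k) ring"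
abbreviation "V \<equiv> Ind S e N"
abbreviation "L \<equiv> L_class S e"
abbreviation "rng A \<equiv> A \<otimes>\<^bsub>LS S\<^esub> sinv (LS S) A"

lemma L_iff: "A \<in> L \<longleftrightarrow> A \<in> carrier (LS S) \<and> sinv (LS S) A \<otimes>\<^bsub>LS S\<^esub> A = e"
  by (auto simp: L_class_def sinv_LS)

lemma G_iff: "g \<in> carrier (max_subgroup S e) \<longleftrightarrow>
    g \<in> carrier (LS S) \<and> sinv (LS S) g \<otimes>\<^bsub>LS S\<^esub> g = e \<and> g \<otimes>\<^bsub>LS S\<^esub> sinv (LS S) g = e"
  using LS.greenH_idem_iff[OF e_idem] by (simp add: max_subgroup_def)

lemma max_subgroup_mult [simp]: "g \<otimes>\<^bsub>max_subgroup S e\<^esub> h = g \<otimes>\<^bsub>LS S\<^esub> h"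
  by (simp add: max_subgroup_def)

lemma L_closed [simp]: "A \<in> L \<Longrightarrow> A \<in> carrier (LS S)"
  by (simp add: L_iff)

lemma G_closed: "g \<in> carrier (max_subgroup S e) \<Longrightarrow> g \<in> carrier (LS S)"
  by (simp add: G_iff)

lemma e_in_L [simp]: "e \<in> L" and e_in_G [simp]: "e \<in> carrier (max_subgroup S e)"
  using e_idem by (simp_all add: L_iff G_iff)

lemma rng_idem [simp]: "A \<in> L \<Longrightarrow> rng A \<in> idems (LS S)"
  by simp

lemma rng_mult: "A \<in> L \<Longrightarrow> rng A \<otimes>\<^bsub>LS S\<^esub> A = A"
  by (simp add: LS.mult_sinv_mult)

lemma L_mult_e: "A \<in> L \<Longrightarrow> A \<otimes>\<^bsub>LS S\<^esub> e = A"
  using LS.cancel_simps(1)[of A] by (simp add: L_iff)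

lemma e_mult_G: "g \<in> carrier (max_subgroup S e) \<Longrightarrow> e \<otimes>\<^bsub>LS S\<^esub> g = g"
  using LS.mult_sinv_mult[of g] by (simp add: G_iff)

lemma L_mult_G:
  assumes "A \<in> L" "g \<in> carrier (max_subgroup S e)"
  shows "A \<otimes>\<^bsub>LS S\<^esub> g \<in> L" and "rng (A \<otimes>\<^bsub>LS S\<^esub> g) = rng A"
  using LS.L_act_group[of A g e] assms by (auto simp: L_iff G_iff)

lemma act_L_iff:
  assumes "A \<in> L" "B \<in> carrier (LS S)"
  shows "B \<otimes>\<^bsub>LS S\<^esub> A \<in> L \<longleftrightarrow> sinv (LS S) B \<otimes>\<^bsub>LS S\<^esub> B \<otimes>\<^bsub>LS S\<^esub> rng A = rng A"
  using LS.mult_in_L_iff[of A B] assms by (auto simp: L_iff)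

text \<open>The domain of \<open>B C\<close> is contained in that of \<open>C\<close>. This is why products annihilated by the
  truncation in the Schuetzenberger action do not spoil its associativity.\<close>
lemma act_L_mult:
  assumes A: "A \<in> L" and B: "B \<in> carrier (LS S)" and C: "C \<in> carrier (LS S)"
    and BCA: "B \<otimes>\<^bsub>LS S\<^esub> C \<otimes>\<^bsub>LS S\<^esub> A \<in> L"
  shows "C \<otimes>\<^bsub>LS S\<^esub> A \<in> L"
proof -
  have A': "A \<in> carrier (LS S)" using A by simp
  let ?d = "\<lambda>x. sinv (LS S) x \<otimes>\<^bsub>LS S\<^esub> x"
  have 1: "?d (B \<otimes>\<^bsub>LS S\<^esub> C) \<otimes>\<^bsub>LS S\<^esub> rng A = rng A"
    using BCA act_L_iff[OF A LS.closed[OF B C]] by blast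
  have "?d C \<otimes>\<^bsub>LS S\<^esub> rng A = ?d C \<otimes>\<^bsub>LS S\<^esub> (?d (B \<otimes>\<^bsub>LS S\<^esub> C) \<otimes>\<^bsub>LS S\<^esub> rng A)"
    unfolding 1 ..
  also have "\<dots> = ?d (B \<otimes>\<^bsub>LS S\<^esub> C) \<otimes>\<^bsub>LS S\<^esub> rng A"
    using A' B C by (simp add: LS.sinv_mult LS.assoc LS.cancel_simps)
  finally show ?thesis using 1 act_L_iff[OF A C] by simp
qed

subsection \<open>The bimodule\<close>

lemma X_simps [simp]:
  "x \<in> carrier X \<longleftrightarrow> Poly_Mapping.keys x \<subseteq> L" "x \<oplus>\<^bsub>X\<^esub> y = x + y" "\<zero>\<^bsub>X\<^esub> = 0"
  "a \<odot>\<^bsub>X\<^esub> x = bilinear_ext (\<lambda>A g. Poly_Mapping.single (A \<otimes>\<^bsub>LS S\<^esub> g) 1) x a"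
  by (simp_all add: kL_def)

lemma abelian_group_X: "abelian_group X"
  by (rule abelian_group_poly_mapping[of _ L]) (auto simp: kL_def)

lemma X_smult_closed:
  "a \<in> carrier G \<Longrightarrow> x \<in> carrier X \<Longrightarrow> a \<odot>\<^bsub>X\<^esub> x \<in> carrier X"
  unfolding X_simps by (rule keys_bilinear_ext) (auto intro!: L_mult_G)

sublocale B: balanced_modules X G N
  by (intro balanced_modules.intro balanced_modules_axioms.intro abelian_group_X N.M.abelian_group_axioms)
    (fact X_smult_closed N.smult_closed)+

abbreviation "tens \<equiv> B.tens"

text \<open>Elementary tensors \<open>A \<otimes> n\<close> with \<open>A\<close> a basis vector of \<open>kL\<close>. Coefficients of \<open>A\<close> can be moved
  into \<open>n\<close>, so these generate the induced module additively.\<close>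

definition pt :: "'s set \<Rightarrow> 'n \<Rightarrow> (('s set \<Rightarrow>\<^sub>0 'k) \<times> 'n \<Rightarrow>\<^sub>0 int) set" where
  "pt A n = tens (Poly_Mapping.single A 1) n"

definition schutz_basis :: "'s set \<Rightarrow> 's set \<Rightarrow> ('s set \<Rightarrow>\<^sub>0 'k)" where
  "schutz_basis B A = (if B \<otimes>\<^bsub>LS S\<^esub> A \<in> L then Poly_Mapping.single (B \<otimes>\<^bsub>LS S\<^esub> A) 1 else 0)"

lemma schutz_eq: "schutz S e = bilinear_ext schutz_basis"
  by (simp add: schutz_def schutz_basis_def[abs_def])

lemma schutz_closed: "schutz S e b x \<in> carrier X"
  unfolding X_simps schutz_eq by (rule keys_bilinear_ext) (simp add: schutz_basis_def)

text \<open>Right multiplication by \<open>g \<in> G\<close> does not change the range of \<open>A\<close>, so it does not affect whether \<open>B\<close>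
  sends \<open>A\<close> to \<open>0\<close>.\<close>
lemma schutz_smult:
  assumes "Poly_Mapping.keys b \<subseteq> carrier (LS S)" "x \<in> carrier X" "a \<in> carrier G"
  shows "schutz S e b (a \<odot>\<^bsub>X\<^esub> x) = a \<odot>\<^bsub>X\<^esub> schutz S e b x"
proof -
  have "bilinear_ext (\<lambda>A g. Poly_Mapping.single (A \<otimes>\<^bsub>LS S\<^esub> g) 1) (schutz_basis B A) (Poly_Mapping.single g 1)
      = bilinear_ext schutz_basis (Poly_Mapping.single B 1) (Poly_Mapping.single (A \<otimes>\<^bsub>LS S\<^esub> g) (1 :: 'k))"
    if "B \<in> carrier (LS S)" "A \<in> L" "g \<in> carrier (max_subgroup S e)" for A B g
  proof -
    have "B \<otimes>\<^bsub>LS S\<^esub> (A \<otimes>\<^bsub>LS S\<^esub> g) \<in> L \<longleftrightarrow> B \<otimes>\<^bsub>LS S\<^esub> A \<in> L"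
      using that by (simp add: act_L_iff L_mult_G)
    moreover have "B \<otimes>\<^bsub>LS S\<^esub> A \<otimes>\<^bsub>LS S\<^esub> g = B \<otimes>\<^bsub>LS S\<^esub> (A \<otimes>\<^bsub>LS S\<^esub> g)"
      using that by (simp add: LS.assoc G_closed)
    ultimately show ?thesis by (simp add: schutz_basis_def)
  qed
  note basis = this
  show ?thesis
    unfolding schutz_eq X_simps
    by (rule bilinear_ext_assoc[where A = "carrier (LS S)" and B = L
          and C = "carrier (max_subgroup S e)", OF basis, symmetric]) (use assms in auto)
qed

lemma schutz_schutz:
  assumes "Poly_Mapping.keys b \<subseteq> carrier (LS S)" "Poly_Mapping.keys c \<subseteq> carrier (LS S)" "x \<in> carrier X"
  shows "schutz S e (bilinear_ext (\<lambda>s t. Poly_Mapping.single (s \<otimes>\<^bsub>LS S\<^esub> t) 1) b c) x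
    = schutz S e b (schutz S e c x)"
proof -
  have "bilinear_ext schutz_basis (Poly_Mapping.single (B \<otimes>\<^bsub>LS S\<^esub> C) 1) (Poly_Mapping.single A 1)
      = bilinear_ext schutz_basis (Poly_Mapping.single B 1) (schutz_basis C A)"
    if "B \<in> carrier (LS S)" "C \<in> carrier (LS S)" "A \<in> L" for A B C
    using act_L_mult[OF that(3,1,2)] that by (simp add: schutz_basis_def LS.assoc)
  note basis = this
  show ?thesis
    unfolding schutz_eq
    by (rule bilinear_ext_assoc[where A = "carrier (LS S)" and B = "carrier (LS S)" and C = L, OF basis])
      (use assms in auto)
qed

subsection \<open>The action on the induced module\<close>

lemma V_simps [simp]:
  "carrier V = carrier B.T" "\<zero>\<^bsub>V\<^esub> = \<one>\<^bsub>B.T\<^esub>" "ring.add V = monoid.mult B.T"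
  by (simp_all add: Ind_def Let_def)

lemma V_smult: "a \<odot>\<^bsub>V\<^esub> C = tensor_map X G N (schutz S e (linear_ext (iota S) a)) C"
  by (simp add: Ind_def Let_def)

lemma abelian_group_V: "abelian_group V"
  by (rule abelian_groupI) (auto simp: B.T.m_ac intro: B.T.l_inv_ex)

sublocale V: abelian_group V
  by (rule abelian_group_V)

lemma tens_simps:
  "x \<in> carrier X \<Longrightarrow> n \<in> carrier N \<Longrightarrow> tens x n \<in> carrier V"
  "x \<in> carrier X \<Longrightarrow> y \<in> carrier X \<Longrightarrow> n \<in> carrier N \<Longrightarrow> tens (x + y) n = tens x n \<oplus>\<^bsub>V\<^esub> tens y n"
  "x \<in> carrier X \<Longrightarrow> n \<in> carrier N \<Longrightarrow> m \<in> carrier N \<Longrightarrow> tens x (n \<oplus>\<^bsub>N\<^esub> m) = tens x n \<oplus>\<^bsub>V\<^esub> tens x m"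
  "n \<in> carrier N \<Longrightarrow> tens 0 n = \<zero>\<^bsub>V\<^esub>"
  "x \<in> carrier X \<Longrightarrow> tens x \<zero>\<^bsub>N\<^esub> = \<zero>\<^bsub>V\<^esub>"
  using B.tens_closed[of x n] B.tens_add_left[of x y n] B.tens_add_right[of x n m] B.tens_zero_left[of n]
    B.tens_zero_right[of x] by simp_all

lemma keys_iota:
  "Poly_Mapping.keys a \<subseteq> carrier S \<Longrightarrow> Poly_Mapping.keys (linear_ext (iota S) a) \<subseteq> carrier (LS S)"
  using keys_linear_ext[of "iota S" a] iota_closed by blast

lemma V_smult_hom:
  assumes a: "a \<in> carrier (semigroup_algebra S)"
  shows V_smult_tens: "\<And>x n. x \<in> carrier X \<Longrightarrow> n \<in> carrier N \<Longrightarrow>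
      a \<odot>\<^bsub>V\<^esub> tens x n = tens (schutz S e (linear_ext (iota S) a) x) n"
    and V_smult_closed: "\<And>C. C \<in> carrier V \<Longrightarrow> a \<odot>\<^bsub>V\<^esub> C \<in> carrier V"
    and V_smult_add: "\<And>C D. C \<in> carrier V \<Longrightarrow> D \<in> carrier V \<Longrightarrow>
      a \<odot>\<^bsub>V\<^esub> (C \<oplus>\<^bsub>V\<^esub> D) = a \<odot>\<^bsub>V\<^esub> C \<oplus>\<^bsub>V\<^esub> a \<odot>\<^bsub>V\<^esub> D"
proof -
  let ?\<phi> = "schutz S e (linear_ext (iota S) a)"
  have \<phi>: "?\<phi> x \<in> carrier X" "?\<phi> (x \<oplus>\<^bsub>X\<^esub> y) = ?\<phi> x \<oplus>\<^bsub>X\<^esub> ?\<phi> y" for x y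
    using schutz_closed by (simp_all add: schutz_eq bilinear_ext_add_right del: X_simps(1))
  have \<phi>_smult: "?\<phi> (b \<odot>\<^bsub>X\<^esub> x) = b \<odot>\<^bsub>X\<^esub> ?\<phi> x" if "b \<in> carrier G" "x \<in> carrier X" for b x
    using schutz_smult[OF keys_iota that(2,1)] a by simp
  note hom = B.tensor_map_hom[of ?\<phi>, OF \<phi> \<phi>_smult]
  show "a \<odot>\<^bsub>V\<^esub> tens x n = tens (?\<phi> x) n" if "x \<in> carrier X" "n \<in> carrier N" for x n
    unfolding V_smult by (rule hom(1)) (use that in auto)
  show "a \<odot>\<^bsub>V\<^esub> C \<in> carrier V" if "C \<in> carrier V" for C
    unfolding V_smult V_simps by (rule hom(2)) (use that in auto)
  show "a \<odot>\<^bsub>V\<^esub> (C \<oplus>\<^bsub>V\<^esub> D) = a \<odot>\<^bsub>V\<^esub> C \<oplus>\<^bsub>V\<^esub> a \<odot>\<^bsub>V\<^esub> D" if "C \<in> carrier V" "D \<in> carrier V" for C D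
    unfolding V_smult V_simps by (rule hom(3)) (use that in auto)
qed

text \<open>The identity of \<open>kG\<close> fixes all products \<open>a x\<close>, and these generate the unitary module \<open>N\<close>.\<close>
lemma N_one:
  assumes "n \<in> carrier N" shows "Poly_Mapping.single e 1 \<odot>\<^bsub>N\<^esub> n = n"
proof -
  let ?u = "Poly_Mapping.single e 1 :: 's set \<Rightarrow>\<^sub>0 'k"
  have u: "?u \<in> carrier G" by simp
  have u_mult: "?u \<otimes>\<^bsub>G\<^esub> a = a" if "a \<in> carrier G" for a
    using that unfolding semigroup_algebra_simps
  proof (induction a rule: poly_mapping_supported_induct)
    case (single g c) then show ?case by (simp add: e_mult_G)
  qed (simp_all add: bilinear_ext_add_right)
  have hom: "?u \<odot>\<^bsub>N\<^esub> (x \<oplus>\<^bsub>N\<^esub> y) = ?u \<odot>\<^bsub>N\<^esub> x \<oplus>\<^bsub>N\<^esub> ?u \<odot>\<^bsub>N\<^esub> y" if "x \<in> carrier N" "y \<in> carrier N" for x y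
    using N.smult_r_distr[OF u that] .
  have zero: "?u \<odot>\<^bsub>N\<^esub> \<zero>\<^bsub>N\<^esub> = \<zero>\<^bsub>N\<^esub>"
  proof -
    have z: "?u \<odot>\<^bsub>N\<^esub> \<zero>\<^bsub>N\<^esub> \<in> carrier N" by (rule N.smult_closed[OF u N.M.zero_closed])
    have "?u \<odot>\<^bsub>N\<^esub> \<zero>\<^bsub>N\<^esub> \<oplus>\<^bsub>N\<^esub> ?u \<odot>\<^bsub>N\<^esub> \<zero>\<^bsub>N\<^esub> = ?u \<odot>\<^bsub>N\<^esub> \<zero>\<^bsub>N\<^esub>"
      using hom[of "\<zero>\<^bsub>N\<^esub>" "\<zero>\<^bsub>N\<^esub>"] by simp
    then show ?thesis using N.M.add.r_cancel_one[OF z z] by simp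
  qed
  have fixed: "?u \<odot>\<^bsub>N\<^esub> (a \<odot>\<^bsub>N\<^esub> x) = a \<odot>\<^bsub>N\<^esub> x" if "a \<in> carrier G" "x \<in> carrier N" for a x
    using N.smult_assoc[OF u that] u_mult[OF that(1)] by simp
  let ?P = "{a \<odot>\<^bsub>N\<^esub> x | a x. a \<in> carrier G \<and> x \<in> carrier N}"
  have "n \<in> generate (add_monoid N) ?P"
    using assms N.unitary by simp
  then have "n \<in> carrier N \<and> ?u \<odot>\<^bsub>N\<^esub> n = n"
  proof (induction n rule: generate.induct)
    case one then show ?case using zero by simp
  next
    case (incl h) then show ?case using fixed N.smult_closed by auto
  next
    case (inv h)
    then have h: "h \<in> carrier N" "?u \<odot>\<^bsub>N\<^esub> h = h" using fixed N.smult_closed by auto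
    have "?u \<odot>\<^bsub>N\<^esub> (\<ominus>\<^bsub>N\<^esub> h) \<oplus>\<^bsub>N\<^esub> h = \<zero>\<^bsub>N\<^esub>"
      using hom[OF N.M.a_inv_closed[OF h(1)] h(1)] unfolding h(2) N.M.l_neg[OF h(1)] zero by (rule sym)
    then have "\<ominus>\<^bsub>N\<^esub> h = ?u \<odot>\<^bsub>N\<^esub> (\<ominus>\<^bsub>N\<^esub> h)"
      by (rule N.M.minus_equality) (intro h(1) N.smult_closed[OF u] N.M.a_inv_closed)+
    then show ?case using N.M.a_inv_closed[OF h(1)] unfolding a_inv_def by metis
  next
    case (eng h k) then show ?case using hom by simp
  qed
  then show ?thesis by simp
qed

lemma tens_single:
  assumes "A \<in> L" "n \<in> carrier N"
  shows "tens (Poly_Mapping.single A c) n = pt A (Poly_Mapping.single e c \<odot>\<^bsub>N\<^esub> n)"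
  using B.tens_balanced[of "Poly_Mapping.single A 1" "Poly_Mapping.single e c" n] assms
  by (simp add: pt_def L_mult_e)

lemma pt_simps:
  assumes "A \<in> L" "n \<in> carrier N"
  shows pt_closed: "pt A n \<in> carrier V"
    and pt_add: "m \<in> carrier N \<Longrightarrow> pt A (n \<oplus>\<^bsub>N\<^esub> m) = pt A n \<oplus>\<^bsub>V\<^esub> pt A m"
  using assms unfolding pt_def by (simp_all add: tens_simps del: V_simps)

lemma pt_zero: "A \<in> L \<Longrightarrow> pt A \<zero>\<^bsub>N\<^esub> = \<zero>\<^bsub>V\<^esub>"
  unfolding pt_def by (intro tens_simps) simp

lemma V_induct [consumes 1, case_names pt add]:
  assumes C: "C \<in> carrier V"
    and pt: "\<And>A n. \<lbrakk>A \<in> L; n \<in> carrier N\<rbrakk> \<Longrightarrow> P (pt A n)"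
    and add: "\<And>C D. \<lbrakk>C \<in> carrier V; D \<in> carrier V; P C; P D\<rbrakk> \<Longrightarrow> P (C \<oplus>\<^bsub>V\<^esub> D)"
  shows "P C"
  using C[unfolded V_simps]
proof (induction C rule: B.tensor_induct)
  case (tens x n)
  have "Poly_Mapping.keys x \<subseteq> L" using tens by simp
  then show ?case
  proof (induction x rule: poly_mapping_supported_induct)
    case zero
    have "tens 0 n = pt e \<zero>\<^bsub>N\<^esub>" using tens by (simp add: tens_simps pt_zero)
    then show ?case using pt[of e "\<zero>\<^bsub>N\<^esub>"] by simp
  next
    case (single A c)
    then show ?case using tens by (simp add: tens_single pt N.smult_closed)
  next
    case (add f g)
    then show ?case using tens by (simp add: tens_simps assms(3) del: V_simps)
  qed
next
  case (mult C D)
  then show ?case using add by simp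
qed

lemma smult_pt:
  assumes "s \<in> carrier S" "A \<in> L" "n \<in> carrier N"
  shows "Poly_Mapping.single s c \<odot>\<^bsub>V\<^esub> pt A n =
    (if iota S s \<otimes>\<^bsub>LS S\<^esub> A \<in> L then pt (iota S s \<otimes>\<^bsub>LS S\<^esub> A) (Poly_Mapping.single e c \<odot>\<^bsub>N\<^esub> n) else \<zero>\<^bsub>V\<^esub>)"
proof -
  have "Poly_Mapping.single s c \<odot>\<^bsub>V\<^esub> pt A n
      = tens (pm_scale c (schutz_basis (iota S s) A)) n"
    using assms unfolding pt_def by (subst V_smult_tens) (simp_all add: schutz_eq)
  then show ?thesis using assms by (simp add: schutz_basis_def tens_single tens_simps del: V_simps)
qed

lemma V_smult_add_left:
  assumes "a \<in> carrier (semigroup_algebra S)" "b \<in> carrier (semigroup_algebra S)" "C \<in> carrier V"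
  shows "(a + b) \<odot>\<^bsub>V\<^esub> C = a \<odot>\<^bsub>V\<^esub> C \<oplus>\<^bsub>V\<^esub> b \<odot>\<^bsub>V\<^esub> C"
proof -
  have ab: "a + b \<in> carrier (semigroup_algebra S)" using assms(1,2) keys_add[of a b] by auto
  show ?thesis using assms(3)
  proof (induction C rule: V_induct)
    case (pt A n)
    then show ?case
      using schutz_closed assms ab unfolding pt_def
      by (simp add: V_smult_tens linear_ext_add schutz_eq bilinear_ext_add_left tens_simps del: V_simps semigroup_algebra_simps)
  next
    case (add C D)
    then show ?case using assms(1,2) ab
      by (simp add: V_smult_add V_smult_closed V.a_ac del: V_simps semigroup_algebra_simps)
  qed
qed

lemma V_smult_assoc:
  assumes "a \<in> carrier (semigroup_algebra S)" "b \<in> carrier (semigroup_algebra S)" "C \<in> carrier V"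
  shows "(a \<otimes>\<^bsub>semigroup_algebra S\<^esub> b) \<odot>\<^bsub>V\<^esub> C = a \<odot>\<^bsub>V\<^esub> (b \<odot>\<^bsub>V\<^esub> C)"
proof -
  have ab: "a \<otimes>\<^bsub>semigroup_algebra S\<^esub> b \<in> carrier (semigroup_algebra S)"
    by (rule nonunital_ring.m_closed[OF nonunital_ring_semigroup_algebra assms(1,2)])
  have keys: "Poly_Mapping.keys a \<subseteq> carrier S" "Poly_Mapping.keys b \<subseteq> carrier S" using assms by auto
  show ?thesis using assms(3)
  proof (induction C rule: V_induct)
    case (pt A n)
    have A: "Poly_Mapping.single A 1 \<in> carrier X" using pt by simp
    have iota: "linear_ext (iota S) (a \<otimes>\<^bsub>semigroup_algebra S\<^esub> b) = bilinear_ext (\<lambda>s t. Poly_Mapping.single (s \<otimes>\<^bsub>LS S\<^esub> t) 1)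
        (linear_ext (iota S) a) (linear_ext (iota S) b)"
      unfolding semigroup_algebra_simps by (rule linear_ext_mult[where A = "carrier S" and B = "carrier S"]) (use keys iota_mult in auto)
    show ?case unfolding pt_def V_smult_tens[OF ab A pt(2)] V_smult_tens[OF assms(2) A pt(2)]
        V_smult_tens[OF assms(1) schutz_closed pt(2)] iota schutz_schutz[OF keys_iota[OF keys(1)] keys_iota[OF keys(2)] A] ..
  next
    case (add C D)
    then show ?case using assms(1,2) ab
      by (simp add: V_smult_add V_smult_closed del: V_simps semigroup_algebra_simps)
  qed
qed

text \<open>Since \<open>\<iota>(p)\<close> is idempotent, it either fixes \<open>A\<close> or moves it out of \<open>L\<close>, depending on whether it is
  above the range of \<open>A\<close>.\<close>
lemma iota_idem_act:
  assumes "A \<in> L" "p \<in> idems S"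
  shows "iota S p \<otimes>\<^bsub>LS S\<^esub> A \<in> L \<longleftrightarrow> p \<in> rng A"
    and "p \<in> rng A \<Longrightarrow> iota S p \<otimes>\<^bsub>LS S\<^esub> A = A"
proof -
  have p: "p \<in> carrier S" using assms by simp
  have "sinv (LS S) (iota S p) \<otimes>\<^bsub>LS S\<^esub> iota S p = iota S p"
    using assms p by (simp add: iota_sinv iota_mult[symmetric])
  then show "iota S p \<otimes>\<^bsub>LS S\<^esub> A \<in> L \<longleftrightarrow> p \<in> rng A"
    using act_L_iff[OF assms(1) iota_closed[OF p]] iota_mult_idem_iff[OF assms(2) rng_idem[OF assms(1)]] by simp
  assume "p \<in> rng A"
  then have *: "iota S p \<otimes>\<^bsub>LS S\<^esub> rng A = rng A"
    using iota_mult_idem_iff[OF assms(2) rng_idem[OF assms(1)]] by simp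
  have "iota S p \<otimes>\<^bsub>LS S\<^esub> A = iota S p \<otimes>\<^bsub>LS S\<^esub> (rng A \<otimes>\<^bsub>LS S\<^esub> A)" using assms by (simp add: rng_mult)
  also have "\<dots> = iota S p \<otimes>\<^bsub>LS S\<^esub> rng A \<otimes>\<^bsub>LS S\<^esub> A" 
    by (rule LS.assoc[symmetric]) (use assms p in auto)
  finally show "iota S p \<otimes>\<^bsub>LS S\<^esub> A = A" unfolding * using assms by (simp add: rng_mult)
qed

lemma smult_idem_pt:
  assumes "A \<in> L" "p \<in> idems S" "n \<in> carrier N"
  shows "Poly_Mapping.single p 1 \<odot>\<^bsub>V\<^esub> pt A n = (if p \<in> rng A then pt A n else \<zero>\<^bsub>V\<^esub>)"
  using smult_pt[of p A n 1] iota_idem_act[OF assms(1,2)] assms by (simp add: N_one)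

text \<open>Every \<open>A\<close> has a local unit: any idempotent of \<open>S\<close> in \<open>A \<otimes> A\<inverse>\<close>. So every
  \<open>A \<otimes> n\<close> is fixed by some element of \<open>kS\<close>, which makes the induced module unitary.\<close>

lemma local_unit:
  assumes "A \<in> L"
  obtains p where "p \<in> idems S" "p \<in> rng A"
proof -
  have "rng A \<in> carrier (LS S)" using assms by simp
  then obtain a where "a \<in> rng A" using LS_nonempty by blast
  then show ?thesis using LS_idem_cofinal[OF rng_idem[OF assms]] that by blast
qed

lemma unitary_V: "unitary_left_module (semigroup_algebra S) V"
proof (intro unitary_left_module.intro unitary_left_module_axioms.intro nonunital_ring_semigroup_algebra abelian_group_V)
  let ?P = "{a \<odot>\<^bsub>V\<^esub> x | a x. a \<in> carrier (semigroup_algebra S) \<and> x \<in> carrier V}"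
  show "carrier V = generate (add_monoid V) ?P"
  proof
    have "C \<in> generate (add_monoid V) ?P" if "C \<in> carrier V" for C
      using that
    proof (induction C rule: V_induct)
      case (pt A n)
      obtain p where p: "p \<in> idems S" "p \<in> rng A" using pt(1) by (rule local_unit)
      then have "pt A n = Poly_Mapping.single p 1 \<odot>\<^bsub>V\<^esub> pt A n"
        using smult_idem_pt[OF pt(1) p(1) pt(2)] by simp
      moreover have "Poly_Mapping.single p 1 \<in> carrier (semigroup_algebra S)" using p by simp
      ultimately have "pt A n \<in> ?P" using pt_closed[OF pt] by blast
      then show ?case by (rule generate.incl)
    next
      case (add C D)
      show ?case using generate.eng[OF add(3,4)] by simp
    qed
    then show "carrier V \<subseteq> generate (add_monoid V) ?P" by blast
    have "?P \<subseteq> carrier (add_monoid V)" using V_smult_closed by auto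
    then show "generate (add_monoid V) ?P \<subseteq> carrier V"
      using group.generate_incl[OF V.a_group] by simp
  qed
qed (auto simp: V_smult_closed V_smult_add_left V_smult_add V_smult_assoc simp del: V_simps semigroup_algebra_simps(1,4))

end

section \<open>Finite sums and finite-dimensionality\<close>

lemma finsum_additive:
  assumes A: "abelian_group A" and B: "abelian_group B"
    and closed: "\<And>x. x \<in> carrier A \<Longrightarrow> h x \<in> carrier B"
    and add: "\<And>x y. \<lbrakk>x \<in> carrier A; y \<in> carrier A\<rbrakk> \<Longrightarrow> h (x \<oplus>\<^bsub>A\<^esub> y) = h x \<oplus>\<^bsub>B\<^esub> h y"
    and "finite J" and g: "\<And>j. j \<in> J \<Longrightarrow> g j \<in> carrier A"
  shows "h (\<Oplus>\<^bsub>A\<^esub>j\<in>J. g j) = (\<Oplus>\<^bsub>B\<^esub>j\<in>J. h (g j))"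
proof -
  interpret A: abelian_group A by (fact A)
  interpret B: abelian_group B by (fact B)
  have z: "h \<zero>\<^bsub>A\<^esub> \<in> carrier B" using closed by simp
  have "h \<zero>\<^bsub>A\<^esub> \<oplus>\<^bsub>B\<^esub> h \<zero>\<^bsub>A\<^esub> = h \<zero>\<^bsub>A\<^esub>" using add[of "\<zero>\<^bsub>A\<^esub>" "\<zero>\<^bsub>A\<^esub>"] by simp
  then have zero: "h \<zero>\<^bsub>A\<^esub> = \<zero>\<^bsub>B\<^esub>" using B.add.r_cancel_one[OF z z] by simp
  show ?thesis using assms(5) g
  proof (induction J)
    case empty then show ?case by (simp add: zero)
  next
    case (insert j J)
    then have "(\<Oplus>\<^bsub>A\<^esub>i\<in>J. g i) \<in> carrier A" by (intro A.finsum_closed) auto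
    then show ?case using insert closed by (simp add: add Pi_iff)
  qed
qed

lemma (in abelian_group) finsum_Times:
  assumes "finite A" "finite B" and g: "\<And>a b. a \<in> A \<Longrightarrow> b \<in> B \<Longrightarrow> g a b \<in> carrier G"
  shows "(\<Oplus>p\<in>A \<times> B. g (fst p) (snd p)) = (\<Oplus>a\<in>A. \<Oplus>b\<in>B. g a b)"
  using assms(1) g
proof (induction A)
  case empty then show ?case by simp
next
  case (insert a A)
  have "insert a A \<times> B = Pair a ` B \<union> A \<times> B" by auto
  then have "(\<Oplus>p\<in>insert a A \<times> B. g (fst p) (snd p))
      = (\<Oplus>p\<in>Pair a ` B. g (fst p) (snd p)) \<oplus> (\<Oplus>p\<in>A \<times> B. g (fst p) (snd p))"
    using insert assms(2) by (simp only:) (rule finsum_Un_disjoint; fastforce)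
  also have "(\<Oplus>p\<in>Pair a ` B. g (fst p) (snd p)) = (\<Oplus>b\<in>B. g a b)"
    using insert by (subst finsum_reindex) (auto simp: inj_on_def)
  also have "(\<Oplus>p\<in>A \<times> B. g (fst p) (snd p)) = (\<Oplus>a\<in>A. \<Oplus>b\<in>B. g a b)"
    using insert by simp
  finally show ?case using insert by (subst finsum_insert) (auto intro!: finsum_closed)
qed

text \<open>A spanning family may repeat a vector; its coefficient in the range of the family is the sum
  of the coefficients over the fibre.\<close>

lemma finite_dimensional_family:
  fixes M (structure) and scal :: "'k::field \<Rightarrow> 'm \<Rightarrow> 'm"
  assumes M: "abelian_group M" and J: "finite J" and v: "\<And>j. j \<in> J \<Longrightarrow> v j \<in> carrier M"
    and closed: "\<And>c x. x \<in> carrier M \<Longrightarrow> scal c x \<in> carrier M"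
    and add: "\<And>c d x. x \<in> carrier M \<Longrightarrow> scal (c + d) x = scal c x \<oplus> scal d x"
    and zero: "\<And>x. x \<in> carrier M \<Longrightarrow> scal 0 x = \<zero>"
    and span: "\<And>x. x \<in> carrier M \<Longrightarrow> \<exists>c. x = (\<Oplus>j\<in>J. scal (c j) (v j))"
  shows "finite_dimensional scal M"
proof -
  interpret abelian_group M by (fact M)
  have scal_sum: "scal (\<Sum>j\<in>K. c j) x = (\<Oplus>j\<in>K. scal (c j) x)"
    if "finite K" "x \<in> carrier M" for K and c :: "'j \<Rightarrow> 'k" and x
    using that(1)
  proof (induction K)
    case empty then show ?case using that(2) by (simp add: zero)
  next
    case (insert j K) then show ?case using that(2) by (simp add: add closed)
  qed
  have "\<exists>d. x = (\<Oplus>b\<in>v ` J. scal (d b) b)" if x: "x \<in> carrier M" for x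
  proof -
    obtain c where c: "x = (\<Oplus>j\<in>J. scal (c j) (v j))" using span[OF x] by blast
    define fib where "fib b = {j \<in> J. v j = b}" for b
    have "J = (\<Union>b\<in>v ` J. fib b)" by (auto simp: fib_def)
    then have "x = (\<Oplus>j\<in>(\<Union>b\<in>v ` J. fib b). scal (c j) (v j))" using c by simp
    also have "\<dots> = (\<Oplus>b\<in>v ` J. \<Oplus>j\<in>fib b. scal (c j) (v j))"
      by (rule add.finprod_UN_disjoint)
        (use J v closed in \<open>auto simp: fib_def pairwise_def disjnt_def\<close>)
    also have "\<dots> = (\<Oplus>b\<in>v ` J. scal (\<Sum>j\<in>fib b. c j) b)"
    proof (rule finsum_cong')
      show "(\<lambda>b. scal (\<Sum>j\<in>fib b. c j) b) \<in> v ` J \<rightarrow> carrier M" using v closed by auto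
      fix b assume b: "b \<in> v ` J"
      have "(\<Oplus>j\<in>fib b. scal (c j) (v j)) = (\<Oplus>j\<in>fib b. scal (c j) b)"
        by (rule finsum_cong') (use b v closed in \<open>auto simp: fib_def\<close>)
      also have "\<dots> = scal (\<Sum>j\<in>fib b. c j) b"
        using b v J by (intro scal_sum[symmetric]) (auto simp: fib_def)
      finally show "(\<Oplus>j\<in>fib b. scal (c j) (v j)) = scal (\<Sum>j\<in>fib b. c j) b" .
    qed simp
    finally show ?thesis by (intro exI)
  qed
  then show ?thesis unfolding finite_dimensional_def using J v by (intro exI[of _ "v ` J"]) auto
qed

context induced_module
begin

section \<open>A map from the induced module onto the original one\<close>

definition restr :: "('s set \<Rightarrow>\<^sub>0 'k) \<Rightarrow> ('s set \<Rightarrow>\<^sub>0 'k)" where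
  "restr x = Poly_Mapping.mapp (\<lambda>A c. c when A \<in> carrier (max_subgroup S e)) x"

lemma lookup_restr: "Poly_Mapping.lookup (restr x) A = (Poly_Mapping.lookup x A when A \<in> carrier (max_subgroup S e))"
  by (auto simp: restr_def lookup_mapp when_def in_keys_iff)

lemma restr_closed: "restr x \<in> carrier G"
  by (auto simp: in_keys_iff lookup_restr when_def split: if_splits)

lemma restr_add: "restr (x + y) = restr x + restr y"
  by (rule poly_mapping_eqI) (simp add: lookup_restr lookup_add when_def)

lemma restr_zero [simp]: "restr 0 = 0"
  by (rule poly_mapping_eqI) (simp add: lookup_restr)

lemma restr_single: "restr (Poly_Mapping.single A c) = (if A \<in> carrier (max_subgroup S e) then Poly_Mapping.single A c else 0)"
  by (rule poly_mapping_eqI) (auto simp: lookup_restr lookup_single when_def)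

lemma G_eq_L_rng: "A \<in> carrier (max_subgroup S e) \<longleftrightarrow> A \<in> L \<and> rng A = e"
  by (auto simp: G_iff L_iff)

lemma restr_smult:
  assumes "x \<in> carrier X" "a \<in> carrier G"
  shows "restr (a \<odot>\<^bsub>X\<^esub> x) = restr x \<otimes>\<^bsub>G\<^esub> a"
proof -
  have "Poly_Mapping.keys x \<subseteq> L" using assms by simp
  then show ?thesis unfolding X_simps semigroup_algebra_simps
  proof (induction x rule: poly_mapping_supported_induct)
    case (single A c)
    have "Poly_Mapping.keys a \<subseteq> carrier (max_subgroup S e)" using assms by simp
    then show ?case
    proof (induction a rule: poly_mapping_supported_induct)
      case (single g d)
      then have "A \<otimes>\<^bsub>LS S\<^esub> g \<in> carrier (max_subgroup S e) \<longleftrightarrow> A \<in> carrier (max_subgroup S e)"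
        using L_mult_G[OF \<open>A \<in> L\<close>, of g] \<open>A \<in> L\<close> by (simp add: G_eq_L_rng)
      then show ?case by (simp add: restr_single)
    qed (simp_all add: bilinear_ext_add_right restr_add)
  qed (simp_all add: bilinear_ext_add_left restr_add)
qed

text \<open>Right translation by \<open>G\<close> preserves \<open>A \<otimes> A\<inverse>\<close>, so restricting the support of \<open>x\<close> to \<open>G\<close>
  is a homomorphism of right \<open>kG\<close>-modules, and \<open>(x, n) \<mapsto> (x restricted to G) n\<close> is balanced.
  The resulting map sends \<open>e \<otimes> n\<close> to \<open>n\<close>.\<close>

lemma evaluation_map:
  obtains \<theta> where "\<And>C. C \<in> carrier V \<Longrightarrow> \<theta> C \<in> carrier N"
    and "\<And>C D. \<lbrakk>C \<in> carrier V; D \<in> carrier V\<rbrakk> \<Longrightarrow> \<theta> (C \<oplus>\<^bsub>V\<^esub> D) = \<theta> C \<oplus>\<^bsub>N\<^esub> \<theta> D"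
    and "\<And>A n. \<lbrakk>A \<in> L; n \<in> carrier N\<rbrakk> \<Longrightarrow> \<theta> (pt A n) = restr (Poly_Mapping.single A 1) \<odot>\<^bsub>N\<^esub> n"
proof -
  obtain \<theta> where \<theta>: "\<And>C. C \<in> carrier B.T \<Longrightarrow> \<theta> C \<in> carrier N"
    "\<And>C D. \<lbrakk>C \<in> carrier B.T; D \<in> carrier B.T\<rbrakk> \<Longrightarrow> \<theta> (C \<otimes>\<^bsub>B.T\<^esub> D) = \<theta> C \<oplus>\<^bsub>N\<^esub> \<theta> D"
    "\<And>x n. \<lbrakk>x \<in> carrier X; n \<in> carrier N\<rbrakk> \<Longrightarrow> \<theta> (tens x n) = restr x \<odot>\<^bsub>N\<^esub> n"
  proof (rule B.tensor_lift[where H = N and \<beta> = "\<lambda>x n. restr x \<odot>\<^bsub>N\<^esub> n"])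
    show "abelian_group N" by (rule N.M.abelian_group_axioms)
    show "restr x \<odot>\<^bsub>N\<^esub> n \<in> carrier N" if "n \<in> carrier N" for x n
      using restr_closed that by (rule N.smult_closed)
    show "restr (x \<oplus>\<^bsub>X\<^esub> y) \<odot>\<^bsub>N\<^esub> n = restr x \<odot>\<^bsub>N\<^esub> n \<oplus>\<^bsub>N\<^esub> restr y \<odot>\<^bsub>N\<^esub> n" if "n \<in> carrier N" for x y n
      using N.smult_l_distr[OF restr_closed restr_closed that] by (simp add: restr_add)
    show "restr x \<odot>\<^bsub>N\<^esub> (n \<oplus>\<^bsub>N\<^esub> m) = restr x \<odot>\<^bsub>N\<^esub> n \<oplus>\<^bsub>N\<^esub> restr x \<odot>\<^bsub>N\<^esub> m" if "n \<in> carrier N" "m \<in> carrier N" for x n m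
      using restr_closed that by (rule N.smult_r_distr)
    show "restr (a \<odot>\<^bsub>X\<^esub> x) \<odot>\<^bsub>N\<^esub> n = restr x \<odot>\<^bsub>N\<^esub> (a \<odot>\<^bsub>N\<^esub> n)"
      if "x \<in> carrier X" "a \<in> carrier G" "n \<in> carrier N" for x a n
      unfolding restr_smult[OF that(1,2)] using restr_closed that(2,3) by (rule N.smult_assoc)
  qed blast
  show ?thesis by (rule that[of \<theta>]) (use \<theta> in \<open>simp_all add: pt_def\<close>)
qed

lemma pt_e_eq_zero:
  assumes "n \<in> carrier N" "pt e n = \<zero>\<^bsub>V\<^esub>" shows "n = \<zero>\<^bsub>N\<^esub>"
proof -
  obtain \<theta> where "\<And>A n. \<lbrakk>A \<in> L; n \<in> carrier N\<rbrakk> \<Longrightarrow> \<theta> (pt A n) = restr (Poly_Mapping.single A 1) \<odot>\<^bsub>N\<^esub> n"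
    by (rule evaluation_map) blast
  then have \<theta>: "\<theta> (pt e n) = n" if "n \<in> carrier N" for n
    using that by (simp add: restr_single N_one)
  have "pt e n = pt e \<zero>\<^bsub>N\<^esub>" by (rule trans[OF assms(2) pt_zero[OF e_in_L, symmetric]])
  then show ?thesis using \<theta>[OF assms(1)] \<theta>[OF N.M.zero_closed] by metis
qed

section \<open>Decomposition in the finite index case\<close>

text \<open>If \<open>B = A g\<close> with \<open>g \<in> G\<close> then \<open>B \<otimes> n = A \<otimes> g n\<close>.\<close>
lemma pt_orbit:
  assumes A: "A \<in> L" and B: "B \<in> L" and eq: "rng A = rng B" and n: "n \<in> carrier N"
  shows "\<exists>m\<in>carrier N. pt B n = pt A m"
proof -
  let ?g = "sinv (LS S) A \<otimes>\<^bsub>LS S\<^esub> B"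
  have g: "A \<otimes>\<^bsub>LS S\<^esub> ?g = B" "?g \<in> carrier (max_subgroup S e)"
    using LS.H_related_in_orbit[of A B e] A B eq by (auto simp: L_iff G_iff)
  let ?a = "Poly_Mapping.single ?g 1 :: 's set \<Rightarrow>\<^sub>0 'k"
  have a: "?a \<in> carrier G" using g by simp
  have "tens (?a \<odot>\<^bsub>X\<^esub> Poly_Mapping.single A 1) n = pt A (?a \<odot>\<^bsub>N\<^esub> n)"
    using B.tens_balanced[of "Poly_Mapping.single A 1" ?a n] A a n by (simp add: pt_def)
  then have "pt B n = pt A (?a \<odot>\<^bsub>N\<^esub> n)" using g by (simp add: pt_def)
  then show ?thesis using N.smult_closed[OF a n] by blast
qed

text \<open>The idempotents \<open>A \<otimes> A\<inverse>\<close> for \<open>A \<in> L\<close> label the \<open>G\<close>-orbits on \<open>L\<close>.\<close>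

definition ranges :: "'s set set" where
  "ranges = {A \<otimes>\<^bsub>LS S\<^esub> sinv (LS S) A | A. A \<in> carrier (LS S) \<and> sinv (LS S) A \<otimes>\<^bsub>LS S\<^esub> A = e}"

lemma rng_in_ranges [simp]: "A \<in> L \<Longrightarrow> rng A \<in> ranges"
  by (auto simp: ranges_def L_iff)

lemma rangesE:
  assumes "f \<in> ranges" obtains A where "A \<in> L" "rng A = f"
  using assms by (auto simp: ranges_def L_iff)

end

locale finite_index_module = induced_module S e N
  for S :: "('s, 'z) monoid_scheme" (structure) and e :: "'s set"
    and N :: "('s set \<Rightarrow>\<^sub>0 'k::field, 'n) module" +
  assumes finite_index: "finite_index S e"
begin

text \<open>The range of \<open>A \<in> L\<close> is R-related to \<open>A\<close>, hence D-related to \<open>e\<close>.\<close>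
lemma finite_ranges: "finite ranges"
proof (rule finite_subset)
  show "ranges \<subseteq> {f \<in> idems (LS S). greenD (LS S) e f}"
    by (auto simp: ranges_def LS.greenD_mult_sinv)
  show "finite {f \<in> idems (LS S). greenD (LS S) e f}" using finite_index by (simp add: finite_index_def)
qed

text \<open>In the reverse inclusion order \<open>f \<subseteq> g\<close> means \<open>g \<le> f\<close>, and idempotents of a D-class with
  finitely many of them are incomparable.\<close>
lemma ranges_antichain:
  assumes f: "f \<in> ranges" and g: "g \<in> ranges" and "f \<subseteq> g" shows "g = f"
proof -
  have "f \<in> idems (LS S)" "g \<in> idems (LS S)" using f g by (auto simp: ranges_def)
  then have "g \<otimes>\<^bsub>LS S\<^esub> f = g" using assms(3) by (rule LS_idem_mult_subset)
  then show ?thesis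
    using LS.finite_D_class_idems_incomparable[of e f g] finite_ranges f g by (simp add: ranges_def)
qed

lemma ex_separating_idem:
  assumes f: "f \<in> ranges"
  shows "\<exists>p. p \<in> idems S \<and> p \<in> f \<and> (\<forall>g\<in>ranges. p \<in> g \<longrightarrow> g = f)"
proof -
  have "\<exists>p \<in> f \<inter> idems S. \<forall>g \<in> ranges - {f}. p \<notin> g"
  proof (rule separating_idem)
    show "finite (ranges - {f})" using finite_ranges by simp
    show "f \<in> idems (LS S)" using f by (auto simp: ranges_def)
    show "g \<in> carrier (LS S) \<and> \<not> f \<subseteq> g" if "g \<in> ranges - {f}" for g
      using that ranges_antichain[OF f] by (auto simp: ranges_def)
  qed
  then show ?thesis by blast
qed

definition sep :: "'s set \<Rightarrow> 's" where
  "sep f = (SOME p. p \<in> idems S \<and> p \<in> f \<and> (\<forall>g\<in>ranges. p \<in> g \<longrightarrow> g = f))"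

definition rep :: "'s set \<Rightarrow> 's set" where
  "rep f = (SOME A. A \<in> L \<and> rng A = f)"

lemma sep:
  assumes "f \<in> ranges"
  shows "sep f \<in> idems S" "g \<in> ranges \<Longrightarrow> sep f \<in> g \<longleftrightarrow> g = f"
  using someI_ex[OF ex_separating_idem[OF assms]] unfolding sep_def by auto

lemma rep:
  assumes "f \<in> ranges" shows "rep f \<in> L" "rng (rep f) = f"
proof -
  have "\<exists>A. A \<in> L \<and> rng A = f" using assms by (blast elim: rangesE)
  from someI_ex[OF this] show "rep f \<in> L" "rng (rep f) = f" unfolding rep_def by auto
qed

text \<open>The action of the separating idempotent of \<open>f\<close> is the projection to the summand
  \<open>rep f \<otimes> N\<close>.\<close>
definition proj where
  "proj f C = Poly_Mapping.single (sep f) 1 \<odot>\<^bsub>V\<^esub> C"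

lemma sep_in_algebra: "f \<in> ranges \<Longrightarrow> Poly_Mapping.single (sep f) 1 \<in> carrier (semigroup_algebra S)"
  using sep(1) by simp

lemma proj_pt:
  "f \<in> ranges \<Longrightarrow> A \<in> L \<Longrightarrow> n \<in> carrier N \<Longrightarrow> proj f (pt A n) = (if f = rng A then pt A n else \<zero>\<^bsub>V\<^esub>)"
  unfolding proj_def using sep(1)[of f] sep(2)[of f "rng A"]
  by (auto simp: smult_idem_pt simp del: V_simps)

lemma proj_closed: "f \<in> ranges \<Longrightarrow> C \<in> carrier V \<Longrightarrow> proj f C \<in> carrier V"
  unfolding proj_def by (rule V_smult_closed[OF sep_in_algebra])

lemma proj_add:
  "f \<in> ranges \<Longrightarrow> C \<in> carrier V \<Longrightarrow> D \<in> carrier V \<Longrightarrow> proj f (C \<oplus>\<^bsub>V\<^esub> D) = proj f C \<oplus>\<^bsub>V\<^esub> proj f D"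
  unfolding proj_def by (rule V_smult_add[OF sep_in_algebra])

lemma proj_eq_pt_rep:
  assumes f: "f \<in> ranges" and C: "C \<in> carrier V"
  shows "\<exists>n\<in>carrier N. proj f C = pt (rep f) n"
  using C
proof (induction C rule: V_induct)
  case (pt A n)
  show ?case
  proof (cases "f = rng A")
    case True
    then show ?thesis using pt_orbit[of "rep f" A n] rep[OF f] pt f by (simp add: proj_pt)
  next
    case False
    then have "proj f (pt A n) = pt (rep f) \<zero>\<^bsub>N\<^esub>" using f pt rep(1)[OF f] by (simp add: proj_pt pt_zero)
    then show ?thesis by blast
  qed
next
  case (add C D)
  obtain n m where "n \<in> carrier N" "m \<in> carrier N" "proj f C = pt (rep f) n" "proj f D = pt (rep f) m"
    using add by blast
  then have "proj f (C \<oplus>\<^bsub>V\<^esub> D) = pt (rep f) (n \<oplus>\<^bsub>N\<^esub> m)" "n \<oplus>\<^bsub>N\<^esub> m \<in> carrier N"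
    using add rep(1)[OF f] f by (simp_all add: proj_add pt_add del: V_simps)
  then show ?case by blast
qed

text \<open>On \<open>A \<otimes> n\<close> exactly one of the projections acts as the identity, and the others as zero.\<close>
lemma sum_proj:
  assumes "C \<in> carrier V"
  shows "C = (\<Oplus>\<^bsub>V\<^esub>f\<in>ranges. proj f C)"
  using assms
proof (induction C rule: V_induct)
  case (pt A n)
  have "(\<Oplus>\<^bsub>V\<^esub>f\<in>ranges. proj f (pt A n)) = (\<Oplus>\<^bsub>V\<^esub>f\<in>ranges. if rng A = f then pt A n else \<zero>\<^bsub>V\<^esub>)"
    by (rule V.finsum_cong') (use pt in \<open>auto simp: proj_pt pt_closed simp del: V_simps\<close>)
  also have "\<dots> = pt A n"
    by (rule V.finsum_singleton) (use pt finite_ranges in \<open>auto simp: pt_closed simp del: V_simps\<close>)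
  finally show ?case by simp
next
  case (add C D)
  have "(\<Oplus>\<^bsub>V\<^esub>f\<in>ranges. proj f (C \<oplus>\<^bsub>V\<^esub> D)) = (\<Oplus>\<^bsub>V\<^esub>f\<in>ranges. proj f C \<oplus>\<^bsub>V\<^esub> proj f D)"
    by (rule V.finsum_cong') (use add(1,2) in \<open>auto simp: proj_add proj_closed simp del: V_simps\<close>)
  also have "\<dots> = (\<Oplus>\<^bsub>V\<^esub>f\<in>ranges. proj f C) \<oplus>\<^bsub>V\<^esub> (\<Oplus>\<^bsub>V\<^esub>f\<in>ranges. proj f D)"
    by (rule V.finsum_addf) (use add(1,2) in \<open>auto simp: proj_closed simp del: V_simps\<close>)
  finally show ?case using add(3,4) by metis
qed

section \<open>Simplicity\<close>

lemma smult_transport: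
  assumes A: "A \<in> L" and B: "B \<in> L" and n: "n \<in> carrier N"
  shows "\<exists>a\<in>carrier (semigroup_algebra S). tens (Poly_Mapping.single B c) n = a \<odot>\<^bsub>V\<^esub> pt A n"
proof -
  obtain a b where ab: "a \<in> A" "b \<in> B" using LS_nonempty A B by (meson L_closed)
  let ?s = "b \<otimes> sinv S a"
  have s: "?s \<in> carrier S" using LS_elem[OF L_closed[OF A] ab(1)] LS_elem[OF L_closed[OF B] ab(2)] by simp
  have "iota S ?s \<otimes>\<^bsub>LS S\<^esub> A = B"
    using A B by (intro iota_transport ab L_closed) (simp_all only: L_class_def mem_Collect_eq)
  then have "Poly_Mapping.single ?s c \<odot>\<^bsub>V\<^esub> pt A n = tens (Poly_Mapping.single B c) n"
    using smult_pt[OF s A n, of c] B n by (simp add: tens_single)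
  then show ?thesis using s by (intro bexI[of _ "Poly_Mapping.single ?s c"]) simp_all
qed

lemma submodule_facts:
  assumes "submodule W (semigroup_algebra S) V"
  shows "W \<subseteq> carrier V" "\<zero>\<^bsub>V\<^esub> \<in> W" "C \<in> W \<Longrightarrow> D \<in> W \<Longrightarrow> C \<oplus>\<^bsub>V\<^esub> D \<in> W" "C \<in> W \<Longrightarrow> \<ominus>\<^bsub>V\<^esub> C \<in> W"
    "a \<in> carrier (semigroup_algebra S) \<Longrightarrow> C \<in> W \<Longrightarrow> a \<odot>\<^bsub>V\<^esub> C \<in> W"
proof -
  interpret W: submodule W "semigroup_algebra S" V by (fact assms)
  show "W \<subseteq> carrier V" using W.subset by simp
  show "\<zero>\<^bsub>V\<^esub> \<in> W" using W.one_closed by simp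
  show "C \<in> W \<Longrightarrow> D \<in> W \<Longrightarrow> C \<oplus>\<^bsub>V\<^esub> D \<in> W" using W.m_closed by simp
  show "C \<in> W \<Longrightarrow> \<ominus>\<^bsub>V\<^esub> C \<in> W" using W.m_inv_closed by (simp add: a_inv_def)
  show "a \<in> carrier (semigroup_algebra S) \<Longrightarrow> C \<in> W \<Longrightarrow> a \<odot>\<^bsub>V\<^esub> C \<in> W" by (rule W.smult_closed)
qed

text \<open>For fixed \<open>A\<close>, the vectors \<open>n\<close> with \<open>A \<otimes> n \<in> W\<close> form a submodule of \<open>N\<close>, because
  \<open>A g\<close> is reached from \<open>A\<close> by acting with an element of \<open>S\<close>.\<close>

lemma fibre_submodule:
  assumes W: "submodule W (semigroup_algebra S) V" and A: "A \<in> L"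
  shows "submodule {n \<in> carrier N. pt A n \<in> W} G N"
proof -
  note W = submodule_facts[OF W]
  let ?H = "{n \<in> carrier N. pt A n \<in> W}"
  have neg: "\<ominus>\<^bsub>N\<^esub> n \<in> ?H" if n: "n \<in> ?H" for n
  proof -
    have "pt A (\<ominus>\<^bsub>N\<^esub> n) \<oplus>\<^bsub>V\<^esub> pt A n = \<zero>\<^bsub>V\<^esub>"
      using pt_add[OF A, of "\<ominus>\<^bsub>N\<^esub> n" n] n A by (simp add: N.M.l_neg pt_zero del: V_simps)
    then have "\<ominus>\<^bsub>V\<^esub> pt A n = pt A (\<ominus>\<^bsub>N\<^esub> n)"
      by (rule V.minus_equality) (use n A in \<open>auto simp: pt_closed simp del: V_simps\<close>)
    then show ?thesis using W(4)[of "pt A n"] n by simp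
  qed
  have smult: "a \<odot>\<^bsub>N\<^esub> n \<in> ?H" if a: "a \<in> carrier G" and n: "n \<in> ?H" for a n
  proof -
    have nN: "n \<in> carrier N" using n by simp
    have "tens (bilinear_ext (\<lambda>A g. Poly_Mapping.single (A \<otimes>\<^bsub>LS S\<^esub> g) 1) (Poly_Mapping.single A 1) a) n \<in> W
      \<and> bilinear_ext (\<lambda>A g. Poly_Mapping.single (A \<otimes>\<^bsub>LS S\<^esub> g) 1) (Poly_Mapping.single A 1) a \<in> carrier X"
      using a[unfolded semigroup_algebra_simps]
    proof (induction a rule: poly_mapping_supported_induct)
      case zero then show ?case using W(2) nN by (simp add: tens_simps del: V_simps)
    next
      case (single g c)
      have Ag: "A \<otimes>\<^bsub>LS S\<^esub> g \<in> L" using A single by (rule L_mult_G)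
      obtain b where "b \<in> carrier (semigroup_algebra S)"
        "tens (Poly_Mapping.single (A \<otimes>\<^bsub>LS S\<^esub> g) c) n = b \<odot>\<^bsub>V\<^esub> pt A n"
        using smult_transport[OF A Ag nN] by blast
      then show ?case using W(5) n Ag by simp
    next
      case (add f g)
      then show ?case using W(3) nN keys_add
        by (auto simp: bilinear_ext_add_right tens_simps subset_iff simp del: V_simps dest!: subsetD[OF keys_add])
    qed
    then have "tens (a \<odot>\<^bsub>X\<^esub> Poly_Mapping.single A 1) n \<in> W" by simp
    then have "pt A (a \<odot>\<^bsub>N\<^esub> n) \<in> W"
      using B.tens_balanced[of "Poly_Mapping.single A 1" a n] A a nN by (simp add: pt_def)
    then show ?thesis using N.smult_closed[OF a nN] by simp
  qed
  show ?thesis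
  proof (intro submodule.intro subgroup.intro submodule_axioms.intro)
    show "inv\<^bsub>add_monoid N\<^esub> n \<in> ?H" if "n \<in> ?H" for n using neg[OF that] by (simp add: a_inv_def)
  qed (use smult A W pt_zero pt_add in \<open>auto simp del: V_simps\<close>)
qed

text \<open>A submodule \<open>W\<close> that has a vector with a non-zero component contains this component, which has the
  form \<open>A \<otimes> n\<close> with \<open>n\<close> non-zero. By simplicity of \<open>N\<close> it contains \<open>A \<otimes> N\<close>, hence everything. If no
  vector has a non-zero component then \<open>W\<close> is zero, vectors being the sums of their components.\<close>
lemma simple_induced:
  assumes N: "simple_module G N"
  shows "simple_module (semigroup_algebra S) V"
  unfolding simple_module_def
proof (intro conjI allI impI unitary_V)
  obtain a n where "a \<in> carrier G" "n \<in> carrier N" "a \<odot>\<^bsub>N\<^esub> n \<noteq> \<zero>\<^bsub>N\<^esub>"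
    using N unfolding simple_module_def by blast
  then obtain n where n: "n \<in> carrier N" "n \<noteq> \<zero>\<^bsub>N\<^esub>" using N.smult_closed by blast
  obtain p where p: "p \<in> idems S" "p \<in> rng e" using e_in_L by (rule local_unit)
  have "Poly_Mapping.single p 1 \<odot>\<^bsub>V\<^esub> pt e n \<noteq> \<zero>\<^bsub>V\<^esub>"
    using smult_idem_pt[OF e_in_L p(1) n(1)] p pt_e_eq_zero n by auto
  moreover have "Poly_Mapping.single p 1 \<in> carrier (semigroup_algebra S)" using p by simp
  ultimately show "\<exists>a\<in>carrier (semigroup_algebra S). \<exists>x\<in>carrier V. a \<odot>\<^bsub>V\<^esub> x \<noteq> \<zero>\<^bsub>V\<^esub>"
    using pt_closed[OF e_in_L n(1)] by blast
next
  fix W assume sub: "submodule W (semigroup_algebra S) V"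
  note W = submodule_facts[OF sub]
  show "W = {\<zero>\<^bsub>V\<^esub>} \<or> W = carrier V"
  proof (rule disjCI)
    assume "W \<noteq> carrier V"
    have proj_zero: "proj f C = \<zero>\<^bsub>V\<^esub>" if C: "C \<in> W" and f: "f \<in> ranges" for C f
    proof (rule ccontr)
      assume nz: "proj f C \<noteq> \<zero>\<^bsub>V\<^esub>"
      obtain n where n: "n \<in> carrier N" "proj f C = pt (rep f) n"
        using proj_eq_pt_rep[OF f] C W(1) by blast
      have A: "rep f \<in> L" using f by (rule rep)
      let ?H = "{n \<in> carrier N. pt (rep f) n \<in> W}"
      have "n \<in> ?H" using n W(5)[OF sep_in_algebra[OF f] C] by (simp add: proj_def)
      moreover have "n \<noteq> \<zero>\<^bsub>N\<^esub>" using nz n A pt_zero by auto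
      moreover have "?H = {\<zero>\<^bsub>N\<^esub>} \<or> ?H = carrier N"
        using N fibre_submodule[OF sub A] unfolding simple_module_def by blast
      ultimately have H: "?H = carrier N" by blast
      have "D \<in> W" if "D \<in> carrier V" for D
        using that
      proof (induction D rule: V_induct)
        case (pt B m)
        have "pt (rep f) m \<in> W" using pt H by blast
        then show ?case using smult_transport[OF A pt, of 1] W(5) by (auto simp: pt_def)
      next
        case (add C D) then show ?case using W(3) by blast
      qed
      then show False using W(1) \<open>W \<noteq> carrier V\<close> by blast
    qed
    have "C = \<zero>\<^bsub>V\<^esub>" if "C \<in> W" for C
    proof -
      have "C = (\<Oplus>\<^bsub>V\<^esub>f\<in>ranges. proj f C)" using that W(1) by (intro sum_proj) blast
      also have "\<dots> = (\<Oplus>\<^bsub>V\<^esub>f\<in>ranges. \<zero>\<^bsub>V\<^esub>)"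
        by (rule V.finsum_cong') (use proj_zero[OF that] in auto)
      finally show ?thesis by (simp only: V.finsum_zero)
    qed
    then show "W = {\<zero>\<^bsub>V\<^esub>}" using W(2) by blast
  qed
qed

section \<open>Finite-dimensionality\<close>

abbreviation "nscale \<equiv> group_module_scale e N"
abbreviation "vscale \<equiv> Ind_scale S e N"

lemma nscale_facts:
  assumes "n \<in> carrier N"
  shows "nscale c n \<in> carrier N" "nscale (c + d) n = nscale c n \<oplus>\<^bsub>N\<^esub> nscale d n" "nscale 0 n = \<zero>\<^bsub>N\<^esub>"
proof -
  have u: "Poly_Mapping.single e c \<in> carrier G" for c :: 'k by simp
  show cl: "nscale c n \<in> carrier N" for c unfolding group_module_scale_def using u assms by (rule N.smult_closed)
  show add: "nscale (c + d) n = nscale c n \<oplus>\<^bsub>N\<^esub> nscale d n" for c d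
    unfolding group_module_scale_def using N.smult_l_distr[OF u u assms, of c d] by (simp add: single_add)
  show "nscale 0 n = \<zero>\<^bsub>N\<^esub>" using add[of 0 0] N.M.add.r_cancel_one[OF cl cl, of 0 0] by simp
qed

lemma vscale_facts:
  shows vscale_closed: "C \<in> carrier V \<Longrightarrow> vscale c C \<in> carrier V"
    and vscale_add: "C \<in> carrier V \<Longrightarrow> D \<in> carrier V \<Longrightarrow> vscale c (C \<oplus>\<^bsub>V\<^esub> D) = vscale c C \<oplus>\<^bsub>V\<^esub> vscale c D"
    and vscale_pt: "A \<in> L \<Longrightarrow> n \<in> carrier N \<Longrightarrow> vscale c (pt A n) = pt A (nscale c n)"
proof -
  have 1: "pm_scale c x \<in> carrier X" if "x \<in> carrier X" for x
    using that keys_pm_scale[of c x] by auto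
  have 2: "pm_scale c (x \<oplus>\<^bsub>X\<^esub> y) = pm_scale c x \<oplus>\<^bsub>X\<^esub> pm_scale c y" for x y by (simp add: pm_scale_add)
  have 3: "pm_scale c (b \<odot>\<^bsub>X\<^esub> x) = b \<odot>\<^bsub>X\<^esub> pm_scale c x" for b x by (simp add: bilinear_ext_pm_scale_left)
  note hom = B.tensor_map_hom[of "pm_scale c", OF 1 2 3]
  show "vscale c C \<in> carrier V" if "C \<in> carrier V"
    unfolding Ind_scale_def V_simps by (rule hom(2)) (use that in auto)
  show "vscale c (C \<oplus>\<^bsub>V\<^esub> D) = vscale c C \<oplus>\<^bsub>V\<^esub> vscale c D" if "C \<in> carrier V" "D \<in> carrier V"
    unfolding Ind_scale_def V_simps by (rule hom(3)) (use that in auto)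
  have "vscale c (tens x n) = tens (pm_scale c x) n" if "x \<in> carrier X" "n \<in> carrier N" for x n
    unfolding Ind_scale_def by (rule hom(1)) (use that in auto)
  from this[of "Poly_Mapping.single A 1" n]
  show "vscale c (pt A n) = pt A (nscale c n)" if "A \<in> L" "n \<in> carrier N"
    using that by (simp add: pt_def[of A n] tens_single group_module_scale_def)
qed

lemma vscale_add_left:
  assumes "C \<in> carrier V" shows "vscale (c + d) C = vscale c C \<oplus>\<^bsub>V\<^esub> vscale d C"
  using assms
proof (induction C rule: V_induct)
  case (pt A n) then show ?case by (simp add: vscale_pt nscale_facts pt_add del: V_simps)
next
  case (add C D) then show ?case by (simp add: vscale_add vscale_closed V.a_ac del: V_simps)
qed

lemma vscale_zero:
  assumes "C \<in> carrier V" shows "vscale 0 C = \<zero>\<^bsub>V\<^esub>"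
  using vscale_add_left[OF assms, of 0 0] V.add.r_cancel_one[OF vscale_closed vscale_closed, OF assms assms, of 0 0] by simp

text \<open>If \<open>B\<close> spans \<open>N\<close>, the tensors of vectors in \<open>B\<close> with a transversal of the finitely many \<open>G\<close>-orbits
  span the induced module.\<close>

lemma finite_dimensional_induced:
  assumes "finite_dimensional nscale N"
  shows "finite_dimensional vscale V"
proof -
  obtain B where B: "finite B" "B \<subseteq> carrier N"
    and span: "\<forall>x \<in> carrier N. \<exists>c. x = (\<Oplus>\<^bsub>N\<^esub>b\<in>B. nscale (c b) b)"
    using assms unfolding finite_dimensional_def by (elim exE conjE)
  let ?v = "\<lambda>p. pt (rep (fst p)) (snd p)"
  show ?thesis
  proof (rule finite_dimensional_family[where J = "ranges \<times> B" and v = ?v])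
    show "finite (ranges \<times> B)" using finite_ranges B by simp
    show v: "?v p \<in> carrier V" if "p \<in> ranges \<times> B" for p
      using that rep(1) B by (intro pt_closed) auto
    fix C assume C: "C \<in> carrier V"
    have "\<exists>c. proj f C = (\<Oplus>\<^bsub>V\<^esub>b\<in>B. vscale (c b) (pt (rep f) b))" if f: "f \<in> ranges" for f
    proof -
      have A: "rep f \<in> L" using f by (rule rep)
      obtain n where n: "n \<in> carrier N" "proj f C = pt (rep f) n" using proj_eq_pt_rep[OF f C] by blast
      obtain c where c: "n = (\<Oplus>\<^bsub>N\<^esub>b\<in>B. nscale (c b) b)" using bspec[OF span n(1)] by blast
      have "proj f C = (\<Oplus>\<^bsub>V\<^esub>b\<in>B. pt (rep f) (nscale (c b) b))"
        unfolding n(2) c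
        by (rule finsum_additive[OF N.M.abelian_group_axioms abelian_group_V])
          (use A B nscale_facts in \<open>auto simp: pt_closed pt_add simp del: V_simps\<close>)
      also have "\<dots> = (\<Oplus>\<^bsub>V\<^esub>b\<in>B. vscale (c b) (pt (rep f) b))"
        by (rule V.finsum_cong') (use A B in \<open>auto simp: vscale_pt[symmetric] vscale_closed pt_closed subset_iff simp del: V_simps\<close>)
      finally show ?thesis by blast
    qed
    then have "\<forall>f\<in>ranges. \<exists>c. proj f C = (\<Oplus>\<^bsub>V\<^esub>b\<in>B. vscale (c b) (pt (rep f) b))" by blast
    from bchoice[OF this] obtain c
      where c: "\<forall>f\<in>ranges. proj f C = (\<Oplus>\<^bsub>V\<^esub>b\<in>B. vscale (c f b) (pt (rep f) b))" ..
    have cl: "vscale (c f b) (pt (rep f) b) \<in> carrier V" if "f \<in> ranges" "b \<in> B" for f b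
      using v[of "(f, b)"] that by (intro vscale_closed) auto
    have "C = (\<Oplus>\<^bsub>V\<^esub>f\<in>ranges. proj f C)" using C by (rule sum_proj)
    also have "\<dots> = (\<Oplus>\<^bsub>V\<^esub>f\<in>ranges. \<Oplus>\<^bsub>V\<^esub>b\<in>B. vscale (c f b) (pt (rep f) b))"
    proof (rule V.finsum_cong')
      show "(\<lambda>f. \<Oplus>\<^bsub>V\<^esub>b\<in>B. vscale (c f b) (pt (rep f) b)) \<in> ranges \<rightarrow> carrier V"
        using cl by (intro funcsetI V.finsum_closed) auto
    qed (use c in simp_all)
    also have "\<dots> = (\<Oplus>\<^bsub>V\<^esub>p\<in>ranges \<times> B. vscale (c (fst p) (snd p)) (?v p))"
      by (rule V.finsum_Times[symmetric]) (use finite_ranges B cl in auto)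
    finally show "\<exists>c. C = (\<Oplus>\<^bsub>V\<^esub>p\<in>ranges \<times> B. vscale (c p) (?v p))"
      by (rule exI[of _ "\<lambda>p. c (fst p) (snd p)"])
  qed (use vscale_closed vscale_add_left vscale_zero abelian_group_V in auto)
qed

text \<open>The evaluation map \<open>\<theta>\<close> is linear and onto, so the images of a spanning set span.\<close>
lemma finite_dimensional_of_induced:
  assumes "finite_dimensional vscale V"
  shows "finite_dimensional nscale N"
proof -
  obtain \<theta> where cl: "\<And>C. C \<in> carrier V \<Longrightarrow> \<theta> C \<in> carrier N"
    and \<theta>_add: "\<And>C D. \<lbrakk>C \<in> carrier V; D \<in> carrier V\<rbrakk> \<Longrightarrow> \<theta> (C \<oplus>\<^bsub>V\<^esub> D) = \<theta> C \<oplus>\<^bsub>N\<^esub> \<theta> D"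
    and \<theta>_pt: "\<And>A n. \<lbrakk>A \<in> L; n \<in> carrier N\<rbrakk> \<Longrightarrow> \<theta> (pt A n) = restr (Poly_Mapping.single A 1) \<odot>\<^bsub>N\<^esub> n"
    by (rule evaluation_map) blast
  have scale: "\<theta> (vscale c C) = nscale c (\<theta> C)" if "C \<in> carrier V" for c C
    using that
  proof (induction C rule: V_induct)
    case (pt A n)
    let ?u = "Poly_Mapping.single e c" and ?a = "restr (Poly_Mapping.single A 1)"
    have u: "?u \<in> carrier G" by simp
    have "?a \<otimes>\<^bsub>G\<^esub> ?u = ?u \<otimes>\<^bsub>G\<^esub> ?a"
      using pt(1) by (simp add: restr_single L_mult_e e_mult_G)
    then have "?a \<odot>\<^bsub>N\<^esub> nscale c n = nscale c (?a \<odot>\<^bsub>N\<^esub> n)"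
      unfolding group_module_scale_def
      using N.smult_assoc[OF restr_closed u pt(2)] N.smult_assoc[OF u restr_closed pt(2)] by metis
    then show ?case using pt \<theta>_pt by (simp add: vscale_pt nscale_facts del: V_simps)
  next
    case (add C D)
    have u: "Poly_Mapping.single e c \<in> carrier G" by simp
    show ?case
      using add cl N.smult_r_distr[OF u cl cl, of C D]
      by (simp add: vscale_add vscale_closed \<theta>_add group_module_scale_def del: V_simps)
  qed
  obtain B where B: "finite B" "B \<subseteq> carrier V"
    and span: "\<forall>x \<in> carrier V. \<exists>c. x = (\<Oplus>\<^bsub>V\<^esub>b\<in>B. vscale (c b) b)"
    using assms unfolding finite_dimensional_def by (elim exE conjE)
  show ?thesis
  proof (rule finite_dimensional_family[where J = B and v = \<theta>])
    fix n assume n: "n \<in> carrier N"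
    obtain c where c: "pt e n = (\<Oplus>\<^bsub>V\<^esub>b\<in>B. vscale (c b) b)" using bspec[OF span pt_closed[OF e_in_L n]] by blast
    have "n = \<theta> (pt e n)" using n by (simp add: \<theta>_pt restr_single N_one)
    also have "\<dots> = (\<Oplus>\<^bsub>N\<^esub>b\<in>B. \<theta> (vscale (c b) b))"
      unfolding c
      by (rule finsum_additive[OF abelian_group_V N.M.abelian_group_axioms cl \<theta>_add B(1)])
        (use B vscale_closed in auto)
    also have "\<dots> = (\<Oplus>\<^bsub>N\<^esub>b\<in>B. nscale (c b) (\<theta> b))"
      by (rule N.M.finsum_cong') (use B scale nscale_facts cl in \<open>auto simp: subset_iff\<close>)
    finally show "\<exists>c. n = (\<Oplus>\<^bsub>N\<^esub>b\<in>B. nscale (c b) (\<theta> b))" by blast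
  qed (use B cl nscale_facts N.M.abelian_group_axioms in \<open>auto simp: subset_iff\<close>)
qed

end

section \<open>Induction from a maximal subgroup of finite index\<close>

theorem proposition4p4:
  fixes S :: "'s monoid" and e :: "'s set" and N :: "('s set \<Rightarrow>\<^sub>0 'k::field, 'n) module"
  assumes "inverse_semigroup S"
    and "e \<in> idems (LS S)"
    and "finite_index S e"
    and "simple_module (semigroup_algebra (max_subgroup S e)) N"
  shows "simple_module (semigroup_algebra S) (Ind S e N)
    \<and> (finite_dimensional (Ind_scale S e N) (Ind S e N)
       \<longleftrightarrow> finite_dimensional (group_module_scale e N) N)"
proof -
  have "unitary_left_module (semigroup_algebra (max_subgroup S e)) N"
    using assms(4) by (simp add: simple_module_def)
  then interpret finite_index_module S e N
    using assms(1-3)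
    by (intro finite_index_module.intro induced_module.intro induced_module_axioms.intro
        finite_index_module_axioms.intro)
  show ?thesis
    using simple_induced[OF assms(4)] finite_dimensional_induced finite_dimensional_of_induced by blast
qed

end
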